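(* Let $4\le n<\infty$ and let $F$ be a field with $\operatorname{char}F\ne2$. Then every PC-map $\mathrm{UT}(n,F)\to\mathrm{UT}(n,F)$ is a composition of a graph automorphism, a standard subcentral PC-map, a quasi-inner automorphism, a field automorphism, and a central PC-map.
   Context: $\mathrm{UT}(n,F)$ is the group of upper unitriangular $n\times n$ matrices over $F$; $\mathrm{T}(n,F)$ the group of invertible upper triangular matrices. $a_{ij}$ denotes entries, $e$ the identity, $e_{ij}$ matrix units, $t_{ij}(\alpha)=e+\alpha e_{ij}$. $[x,y]=xyx^{-1}y^{-1}$. A PC-map is a bijection $\varphi$ of the group with $\varphi([x,y])=[\varphi(x),\varphi(y)]$ for all $x,y$. A quasi-inner automorphism is conjugation by an element of $\mathrm{T}(n,F)$. A field automorphism is $(a_{ij})\mapsto(\theta(a_{ij}))$ for a field automorphism $\theta$ of $F$. The graph automorphism is either the identity or the map $a\mapsto w\,(a^{t})^{-1}w^{-1}$, where $w$ is the matrix with $1$ on the anti-diagonal and $0$ elsewhere (this preserves $\mathrm{UT}(n,F)$). A standard subcentral PC-map is a map $a\mapsto t_{2n}(\alpha a_{12})\,a\,t_{1\,n-1}(\beta a_{n-1\,n})$ for fixed $\alpha,\beta\in F$. A central PC-map is a PC-map of the form $a\mapsto a\,t_{1n}(f(a))$ for some function $f:\mathrm{UT}(n,F)\to F$. *)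

theory Defs
  imports "Jordan_Normal_Form.Matrix"
begin

text \<open>Matrices are n x n matrices of the JNF library, indices 0..n-1
 (so the paper's entry a_ij is A $$ (i-1, j-1)).\<close>

definition minv :: "'a::field mat \<Rightarrow> 'a mat" where
  "minv A = (SOME B. B \<in> carrier_mat (dim_row A) (dim_row A) \<and>
              A * B = 1\<^sub>m (dim_row A) \<and> B * A = 1\<^sub>m (dim_row A))"

definition comm :: "'a::field mat \<Rightarrow> 'a mat \<Rightarrow> 'a mat" where
  "comm x y = x * y * minv x * minv y"

definition UT :: "nat \<Rightarrow> 'a::field mat set" where
  "UT n = {A \<in> carrier_mat n n. upper_triangular A \<and> (\<forall>i<n. A $$ (i,i) = 1)}"

definition TT :: "nat \<Rightarrow> 'a::field mat set" where
  "TT n = {A \<in> carrier_mat n n. upper_triangular A \<and> invertible_mat A}"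

definition munit :: "nat \<Rightarrow> nat \<Rightarrow> nat \<Rightarrow> 'a::field mat" where
  "munit n i j = mat n n (\<lambda>(k,l). if k = i \<and> l = j then 1 else 0)"

definition tv :: "nat \<Rightarrow> nat \<Rightarrow> nat \<Rightarrow> 'a::field \<Rightarrow> 'a mat" where
  "tv n i j \<alpha> = 1\<^sub>m n + \<alpha> \<cdot>\<^sub>m munit n i j"

definition PC_map :: "nat \<Rightarrow> ('a::field mat \<Rightarrow> 'a mat) \<Rightarrow> bool" where
  "PC_map n \<phi> \<longleftrightarrow> bij_betw \<phi> (UT n) (UT n) \<and>
     (\<forall>x\<in>UT n. \<forall>y\<in>UT n. \<phi> (comm x y) = comm (\<phi> x) (\<phi> y))"

definition quasi_inner :: "nat \<Rightarrow> ('a::field mat \<Rightarrow> 'a mat) \<Rightarrow> bool" where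
  "quasi_inner n \<psi> \<longleftrightarrow> (\<exists>t\<in>TT n. \<forall>a\<in>UT n. \<psi> a = t * a * minv t)"

definition field_automorphism :: "('a::field \<Rightarrow> 'a) \<Rightarrow> bool" where
  "field_automorphism \<theta> \<longleftrightarrow> bij \<theta> \<and> \<theta> 1 = 1 \<and>
     (\<forall>x y. \<theta> (x + y) = \<theta> x + \<theta> y) \<and> (\<forall>x y. \<theta> (x * y) = \<theta> x * \<theta> y)"

definition field_aut_map :: "nat \<Rightarrow> ('a::field mat \<Rightarrow> 'a mat) \<Rightarrow> bool" where
  "field_aut_map n \<psi> \<longleftrightarrow>
     (\<exists>\<theta>. field_automorphism \<theta> \<and> (\<forall>a\<in>UT n. \<psi> a = map_mat \<theta> a))"

definition antidiag :: "nat \<Rightarrow> 'a::field mat" where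
  "antidiag n = mat n n (\<lambda>(i,j). if i + j = n - 1 then 1 else 0)"

definition graph_aut :: "nat \<Rightarrow> ('a::field mat \<Rightarrow> 'a mat) \<Rightarrow> bool" where
  "graph_aut n \<psi> \<longleftrightarrow> (\<forall>a\<in>UT n. \<psi> a = a) \<or>
     (\<forall>a\<in>UT n. \<psi> a = antidiag n * minv (transpose_mat a) * minv (antidiag n))"

definition std_subcentral :: "nat \<Rightarrow> ('a::field mat \<Rightarrow> 'a mat) \<Rightarrow> bool" where
  "std_subcentral n \<psi> \<longleftrightarrow> (\<exists>\<alpha> \<beta>. \<forall>a\<in>UT n.
     \<psi> a = tv n 1 (n - 1) (\<alpha> * a $$ (0,1)) * a * tv n 0 (n - 2) (\<beta> * a $$ (n - 2, n - 1)))"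

definition central_PC :: "nat \<Rightarrow> ('a::field mat \<Rightarrow> 'a mat) \<Rightarrow> bool" where
  "central_PC n \<psi> \<longleftrightarrow> PC_map n \<psi> \<and>
     (\<exists>f. \<forall>a\<in>UT n. \<psi> a = a * tv n 0 (n - 1) (f a))"

end

theory Submission
  imports Defs "Jordan_Normal_Form.Determinant"
begin

text \<open>
  Call an element good if it commutes with all its conjugates and does not centralise the second
  centre. Since the characteristic is not 2, the good elements are exactly those of the form
  \<open>1 + (first row) + c e\<^bsub>2n\<^esub>\<close> with nonzero (1,2) entry and their mirror images
  \<open>1 + (last column) + d e\<^bsub>1,n-1\<^esub>\<close>; their centralisers in the second centre tell the two
  kinds apart, so after a graph automorphism a PC-map \<open>\<phi>\<close> preserves each kind. The commutator of a
  row element and a column element is the central element given by the standard pairing of the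
  row with the column, so \<open>\<phi>\<close> preserves this pairing up to a bijection of \<open>F\<close>. This forces
  \<open>\<phi>\<close> to act on rows and columns semilinearly by a triangular matrix, and a field and a diagonal block
  automorphism reduce to the case where \<open>\<phi>\<close> fixes the inner entries of rows and columns. For such
  \<open>\<phi>\<close>, the commutators of \<open>g\<close> with row and column elements recover the middle block of \<open>\<phi> g\<close>
  exactly, and its first row and last column up to an inner automorphism and a standard subcentral
  map; only the corner entry remains free, and this is the central PC-map.
\<close>

section \<open>Triangular groups and PC-maps\<close>

text \<open>A PC-map is not assumed multiplicative, so only facts expressed by commutators can be
  transported. Linearity has to be produced, and its only source is the pairing. Three obstacles
  shape the argument. Good elements have a nonzero superdiagonal entry at one end, so they do not
  supply all row vectors; rows with zero entry there return as the centraliser of the good rows, and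
  the union gives every row, as a perfect pairing requires. The pairing involves n - 2 inner entries
  and the linearity argument needs two of them, so n = 3 is out of reach. Finally, a commutator of g
  with a row reads entries of the inverse of g, while one with a column reads entries of g, so the
  last column is recovered through the inverse. The standard subcentral maps arise because a good
  row carries an entry c (a good column an entry d) outside its row (column) that the pairing cannot
  see; their images contribute one free scalar each.\<close>

lemma mat_mult_entry:
  assumes "A \<in> carrier_mat n n" "B \<in> carrier_mat n n" "i < n" "j < n"
  shows "(A * B) $$ (i, j) = (\<Sum>k<n. A $$ (i, k) * B $$ (k, j))"
  using assms by (simp add: scalar_prod_def lessThan_atLeast0)

lemma UT_carrier: "A \<in> UT n \<Longrightarrow> A \<in> carrier_mat n n"
  by (simp add: UT_def)

lemma UT_diag: "A \<in> UT n \<Longrightarrow> i < n \<Longrightarrow> A $$ (i, i) = 1"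
  by (simp add: UT_def)

lemma UT_lower: "A \<in> UT n \<Longrightarrow> j < i \<Longrightarrow> i < n \<Longrightarrow> A $$ (i, j) = 0"
  by (auto simp: UT_def)

lemma UT_I:
  assumes "A \<in> carrier_mat n n" "\<And>i. i < n \<Longrightarrow> A $$ (i, i) = 1"
    and "\<And>i j. i < n \<Longrightarrow> j < i \<Longrightarrow> A $$ (i, j) = 0"
  shows "A \<in> UT n"
  using assms by (auto simp: UT_def)

lemma triangular_mult_entries:
  fixes A B :: "'a::field mat"
  assumes A: "A \<in> carrier_mat n n" "upper_triangular A"
    and B: "B \<in> carrier_mat n n" "upper_triangular B"
    and "i < n"
  shows "j < i \<Longrightarrow> (A * B) $$ (i, j) = 0"
    and "(A * B) $$ (i, i) = A $$ (i, i) * B $$ (i, i)"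
proof -
  assume "j < i"
  have "A $$ (i, k) * B $$ (k, j) = 0" if "k < n" for k
    using that upper_triangularD[OF A(2), of k i] upper_triangularD[OF B(2), of j k] A(1) B(1) \<open>j < i\<close> \<open>i < n\<close>
    by (cases "k < i") auto
  then show "(A * B) $$ (i, j) = 0"
    using mat_mult_entry[OF A(1) B(1) \<open>i < n\<close>, of j] \<open>j < i\<close> \<open>i < n\<close>
    by (simp add: sum.neutral)
next
  have "(A * B) $$ (i, i) = (\<Sum>k<n. if k = i then A $$ (i, i) * B $$ (i, i) else 0)"
    unfolding mat_mult_entry[OF A(1) B(1) \<open>i < n\<close> \<open>i < n\<close>]
  proof (rule sum.cong[OF refl])
    fix k assume "k \<in> {..<n}"
    then show "A $$ (i, k) * B $$ (k, i) = (if k = i then A $$ (i, i) * B $$ (i, i) else 0)"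
      using upper_triangularD[OF A(2), of k i] upper_triangularD[OF B(2), of i k] A(1) B(1) \<open>i < n\<close>
      by (cases k i rule: linorder_cases) auto
  qed
  then show "(A * B) $$ (i, i) = A $$ (i, i) * B $$ (i, i)"
    using \<open>i < n\<close> by simp
qed

lemma upper_triangular_mult:
  fixes A B :: "'a::field mat"
  assumes "A \<in> carrier_mat n n" "upper_triangular A" "B \<in> carrier_mat n n" "upper_triangular B"
  shows "upper_triangular (A * B)"
  using triangular_mult_entries(1)[OF assms] assms by (intro upper_triangularI) auto

text \<open>\<open>minv\<close> is a \<open>SOME\<close> choice, so every fact about it starts from
  the existence of a two-sided inverse, supplied here by the determinant.\<close>

lemma det_nonzero_minv:
  fixes A :: "'a::field mat"
  assumes A: "A \<in> carrier_mat n n" and "det A \<noteq> 0"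
  shows "minv A \<in> carrier_mat n n" "A * minv A = 1\<^sub>m n" "minv A * A = 1\<^sub>m n"
proof -
  have "\<exists>B. B \<in> carrier_mat n n \<and> A * B = 1\<^sub>m n \<and> B * A = 1\<^sub>m n"
    using det_non_zero_imp_unit[OF A assms(2), of undefined]
    by (auto simp: Units_def ring_mat_def)
  then have "minv A \<in> carrier_mat n n \<and> A * minv A = 1\<^sub>m n \<and> minv A * A = 1\<^sub>m n"
    unfolding minv_def using A by (metis (mono_tags, lifting) carrier_matD(1) someI_ex)
  then show "minv A \<in> carrier_mat n n" "A * minv A = 1\<^sub>m n" "minv A * A = 1\<^sub>m n"
    by auto
qed

lemma minv_unique:
  fixes A :: "'a::field mat"
  assumes A: "A \<in> carrier_mat n n" and B: "B \<in> carrier_mat n n" and AB: "A * B = 1\<^sub>m n"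
  shows "minv A = B"
proof -
  have "det A * det B = 1"
    using det_mult[OF A B] AB by simp
  then have "det A \<noteq> 0" by auto
  note m = det_nonzero_minv[OF A this]
  have "minv A * A * B = minv A * (A * B)"
    using m A B by (intro assoc_mult_mat)
  then show ?thesis using m B AB by simp
qed

text \<open>If \<open>B\<close> had a nonzero entry below the diagonal, the lowest such entry of its
  column would survive in \<open>A * B\<close>, multiplied by a nonzero diagonal entry of
  \<open>A\<close>.\<close>

lemma inverse_upper_triangular:
  fixes A B :: "'a::field mat"
  assumes A: "A \<in> carrier_mat n n" "upper_triangular A" and B: "B \<in> carrier_mat n n"
    and diag: "\<And>i. i < n \<Longrightarrow> A $$ (i, i) \<noteq> 0" and AB: "A * B = 1\<^sub>m n"
  shows "upper_triangular B"
proof (rule ccontr)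
  assume "\<not> upper_triangular B"
  then obtain i j where ij: "i < n" "j < i" "B $$ (i, j) \<noteq> 0"
    using B by (auto simp: upper_triangular_def)
  define k where "k = (GREATEST k. k < n \<and> j < k \<and> B $$ (k, j) \<noteq> 0)"
  have k: "k < n" "j < k" "B $$ (k, j) \<noteq> 0"
    using GreatestI_nat[of "\<lambda>k. k < n \<and> j < k \<and> B $$ (k, j) \<noteq> 0" i n] ij
    unfolding k_def by auto
  have above: "B $$ (l, j) = 0" if "k < l" "l < n" for l
    using Greatest_le_nat[of "\<lambda>k. k < n \<and> j < k \<and> B $$ (k, j) \<noteq> 0" l n] that k(2)
    unfolding k_def[symmetric] by force
  have "(A * B) $$ (k, j) = (\<Sum>l<n. if l = k then A $$ (k, k) * B $$ (k, j) else 0)"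
    unfolding mat_mult_entry[OF A(1) B k(1), of j, OF less_trans[OF k(2,1)]]
  proof (rule sum.cong[OF refl])
    fix l assume "l \<in> {..<n}"
    then show "A $$ (k, l) * B $$ (l, j) = (if l = k then A $$ (k, k) * B $$ (k, j) else 0)"
      using A k above by (cases "l < k"; cases "l = k") auto
  qed
  then have "(A * B) $$ (k, j) = A $$ (k, k) * B $$ (k, j)"
    using k by simp
  then show False
    using AB k diag[OF k(1)] by simp
qed

lemma TT_I:
  fixes A B :: "'a::field mat"
  assumes "A \<in> carrier_mat n n" "upper_triangular A" "B \<in> carrier_mat n n" "A * B = 1\<^sub>m n"
  shows "A \<in> TT n"
  using assms mat_mult_left_right_inverse[OF assms(1,3,4)]
  by (auto simp: TT_def invertible_mat_def inverts_mat_def)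

lemma TT_facts:
  fixes A :: "'a::field mat"
  assumes "A \<in> TT n"
  shows "A \<in> carrier_mat n n" "upper_triangular A" "i < n \<Longrightarrow> A $$ (i, i) \<noteq> 0"
    and "minv A \<in> carrier_mat n n" "A * minv A = 1\<^sub>m n" "minv A * A = 1\<^sub>m n"
    and "upper_triangular (minv A)" "minv A \<in> TT n"
proof -
  show A: "A \<in> carrier_mat n n" "upper_triangular A"
    using assms by (auto simp: TT_def)
  obtain B where B: "A * B = 1\<^sub>m n" "B * A = 1\<^sub>m (dim_row B)"
    using assms by (auto simp: TT_def invertible_mat_def inverts_mat_def)
  have dc: "dim_col B = n" using arg_cong[OF B(1), of dim_col] by simp
  have dr: "dim_row B = n" using arg_cong[OF B(2), of dim_col] A by simp
  have Bc: "B \<in> carrier_mat n n" using dc dr by blast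
  have "det A * det B = 1"
    using det_mult[OF A(1) Bc] B by simp
  then have d: "det A \<noteq> 0" by auto
  show m: "minv A \<in> carrier_mat n n" "A * minv A = 1\<^sub>m n" "minv A * A = 1\<^sub>m n"
    using det_nonzero_minv[OF A(1) d] by auto
  have diag: "A $$ (i, i) \<noteq> 0" if "i < n" for i
    using d that A unfolding det_upper_triangular[OF A(2,1)]
    by (auto simp: prod_list_zero_iff diag_mat_def)
  show u: "upper_triangular (minv A)"
    by (rule inverse_upper_triangular[OF A m(1) diag m(2)])
  show "minv A \<in> TT n"
    by (rule TT_I[OF m(1) u A(1) m(3)])
  show "i < n \<Longrightarrow> A $$ (i, i) \<noteq> 0" by (rule diag)
qed

lemma UT_subset_TT:
  fixes A :: "'a::field mat"
  assumes "A \<in> UT n"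
  shows "A \<in> TT n"
proof -
  have A: "A \<in> carrier_mat n n" "upper_triangular A"
    using assms by (auto simp: UT_def)
  have "prod_list (diag_mat A) \<noteq> 0"
    using assms by (auto simp: prod_list_zero_iff diag_mat_def UT_def)
  then have "det A \<noteq> 0"
    using det_upper_triangular[OF A(2,1)] by simp
  from det_nonzero_minv[OF A(1) this] show ?thesis
    using TT_I[OF A] by blast
qed

lemma TT_mult:
  fixes A B :: "'a::field mat"
  assumes "A \<in> TT n" "B \<in> TT n"
  shows "A * B \<in> TT n"
proof (rule TT_I)
  note a = TT_facts[OF assms(1)] and b = TT_facts[OF assms(2)]
  show "A * B \<in> carrier_mat n n" "minv B * minv A \<in> carrier_mat n n"
    using a b by auto
  show "upper_triangular (A * B)"
    using a b upper_triangular_mult by blast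
  have "A * B * (minv B * minv A) = A * (B * minv B) * minv A"
    using a(1,4) b(1,4) by (simp add: assoc_mult_mat[of _ n n _ n _ n])
  then show "A * B * (minv B * minv A) = 1\<^sub>m n"
    using a b by simp
qed

lemma UT_one: "1\<^sub>m n \<in> UT n"
  by (auto simp: UT_def)

lemma UT_mult:
  fixes A B :: "'a::field mat"
  assumes "A \<in> UT n" "B \<in> UT n"
  shows "A * B \<in> UT n"
proof -
  have "A \<in> carrier_mat n n" "upper_triangular A" "B \<in> carrier_mat n n" "upper_triangular B"
    using assms by (auto simp: UT_def)
  note e = triangular_mult_entries[OF this]
  show ?thesis
    by (rule UT_I) (use assms e UT_carrier[OF assms(1)] UT_carrier[OF assms(2)] in \<open>auto simp: UT_diag\<close>)
qed

lemma conj_UT: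
  fixes t a :: "'a::field mat"
  assumes t: "t \<in> TT n" and a: "a \<in> UT n"
  shows "t * a * minv t \<in> UT n"
proof -
  note tt = TT_facts[OF t]
  have ac: "a \<in> carrier_mat n n" "upper_triangular a" using a by (auto simp: UT_def)
  have tac: "t * a \<in> carrier_mat n n" "upper_triangular (t * a)"
    using tt ac upper_triangular_mult by auto
  note e1 = triangular_mult_entries[OF tt(1,2) ac]
    and e2 = triangular_mult_entries[OF tac tt(4,7)]
    and e3 = triangular_mult_entries[OF tt(1,2) tt(4,7)]
  show ?thesis
  proof (rule UT_I)
    show "t * a * minv t \<in> carrier_mat n n" using tac tt by auto
    show "(t * a * minv t) $$ (i, i) = 1" if "i < n" for i
      using e1(2)[OF that] e2(2)[OF that] e3(2)[OF that] tt(5) UT_diag[OF a that] that by simp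
    show "(t * a * minv t) $$ (i, j) = 0" if "i < n" "j < i" for i j
      by (rule e2(1)[OF that])
  qed
qed

lemma UT_minv:
  fixes A :: "'a::field mat"
  assumes "A \<in> UT n"
  shows "minv A \<in> UT n" "A * minv A = 1\<^sub>m n" "minv A * A = 1\<^sub>m n"
proof -
  note t = TT_facts[OF UT_subset_TT[OF assms]]
  show "A * minv A = 1\<^sub>m n" "minv A * A = 1\<^sub>m n"
    by (rule t(5), rule t(6))
  have "minv A $$ (i, i) = 1" if "i < n" for i
    using triangular_mult_entries(2)[OF t(1,2) t(4,7) that] t(5) UT_diag[OF assms that] that
    by simp
  then show "minv A \<in> UT n"
    using t(4,7) by (auto simp: UT_def)
qed

section \<open>Commutators\<close>

lemma comm_UT:
  fixes x y :: "'a::field mat"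
  assumes "x \<in> UT n" "y \<in> UT n"
  shows "comm x y \<in> UT n"
  unfolding comm_def using assms by (intro UT_mult UT_minv(1))

lemma comm_mult:
  fixes x y :: "'a::field mat"
  assumes "x \<in> UT n" "y \<in> UT n"
  shows "comm x y * (y * x) = x * y"
proof -
  have c: "x \<in> carrier_mat n n" "y \<in> carrier_mat n n" "minv x \<in> carrier_mat n n" "minv y \<in> carrier_mat n n"
    using assms by (auto intro: UT_carrier UT_minv(1))
  have "comm x y * (y * x) = x * y * (minv x * ((minv y * y) * x))"
    unfolding comm_def using c by (simp add: assoc_mult_mat[of _ n n _ n _ n])
  then show ?thesis
    using c UT_minv[OF assms(1)] UT_minv[OF assms(2)] by simp
qed

lemma UT_right_cancel:
  fixes a b z :: "'a::field mat"
  assumes "z \<in> UT n" "a \<in> carrier_mat n n" "b \<in> carrier_mat n n" "a * z = b * z"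
  shows "a = b"
proof -
  have c: "z \<in> carrier_mat n n" "minv z \<in> carrier_mat n n"
    using assms by (auto intro: UT_carrier UT_minv(1))
  have "a * z * minv z = b * z * minv z" using assms(4) by simp
  then have "a * (z * minv z) = b * (z * minv z)"
    using c assms(2,3) by (simp add: assoc_mult_mat[of _ n n _ n _ n])
  then show ?thesis using UT_minv(2)[OF assms(1)] assms(2,3) by simp
qed

text \<open>Lets a commutator be verified by comparing two products, without computing the inverses
  of \<open>x\<close> and \<open>y\<close>.\<close>

lemma comm_eqI:
  fixes x y :: "'a::field mat"
  assumes "x \<in> UT n" "y \<in> UT n" "c \<in> carrier_mat n n" "c * (y * x) = x * y"
  shows "comm x y = c"
  using UT_right_cancel[of "y * x" n "comm x y" c] comm_mult[of x n y] assms
  by (simp add: UT_mult comm_UT UT_carrier)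

lemma comm_eq_one_iff:
  fixes x y :: "'a::field mat"
  assumes "x \<in> UT n" "y \<in> UT n"
  shows "comm x y = 1\<^sub>m n \<longleftrightarrow> x * y = y * x"
proof
  have c: "y * x \<in> carrier_mat n n" using assms by (auto intro: UT_carrier UT_mult)
  show "x * y = y * x" if "comm x y = 1\<^sub>m n"
    using comm_mult[OF assms] left_mult_one_mat[OF c] that by simp
  show "comm x y = 1\<^sub>m n" if "x * y = y * x"
    by (rule comm_eqI[OF assms]) (use c that in auto)
qed

section \<open>Elementary consequences of preserving commutators\<close>

lemma PC_mapD:
  assumes "PC_map n \<phi>"
  shows "x \<in> UT n \<Longrightarrow> \<phi> x \<in> UT n"
    and "x \<in> UT n \<Longrightarrow> y \<in> UT n \<Longrightarrow> \<phi> (comm x y) = comm (\<phi> x) (\<phi> y)"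
    and "x \<in> UT n \<Longrightarrow> y \<in> UT n \<Longrightarrow> \<phi> x = \<phi> y \<Longrightarrow> x = y"
    and "y \<in> UT n \<Longrightarrow> \<exists>x\<in>UT n. \<phi> x = y"
proof -
  have b: "bij_betw \<phi> (UT n) (UT n)" using assms by (simp add: PC_map_def)
  show "x \<in> UT n \<Longrightarrow> \<phi> x \<in> UT n" using b by (rule bij_betw_apply)
  show "x \<in> UT n \<Longrightarrow> y \<in> UT n \<Longrightarrow> \<phi> (comm x y) = comm (\<phi> x) (\<phi> y)"
    using assms by (simp add: PC_map_def)
  show "x \<in> UT n \<Longrightarrow> y \<in> UT n \<Longrightarrow> \<phi> x = \<phi> y \<Longrightarrow> x = y"
    using b by (auto simp: bij_betw_def inj_on_def)
  show "y \<in> UT n \<Longrightarrow> \<exists>x\<in>UT n. \<phi> x = y"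
    using b by (metis bij_betw_iff_bijections)
qed

text \<open>The identity is its own commutator with itself, so its image is of the form
  \<open>comm a a\<close>, which is trivial.\<close>

lemma PC_map_one:
  fixes \<phi> :: "'a::field mat \<Rightarrow> 'a mat"
  assumes "PC_map n \<phi>"
  shows "\<phi> (1\<^sub>m n) = 1\<^sub>m n"
proof -
  note D = PC_mapD[OF assms]
  have "comm (1\<^sub>m n) (1\<^sub>m n) = (1\<^sub>m n :: 'a mat)"
    using comm_eq_one_iff[OF UT_one UT_one, of n] by simp
  moreover have "comm (\<phi> (1\<^sub>m n)) (\<phi> (1\<^sub>m n)) = 1\<^sub>m n"
    using comm_eq_one_iff[OF D(1) D(1)] UT_one by blast
  ultimately show ?thesis
    using D(2)[OF UT_one UT_one] by simp
qed

lemma PC_map_comm_one_iff: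
  fixes \<phi> :: "'a::field mat \<Rightarrow> 'a mat"
  assumes "PC_map n \<phi>" "x \<in> UT n" "y \<in> UT n"
  shows "comm (\<phi> x) (\<phi> y) = 1\<^sub>m n \<longleftrightarrow> comm x y = 1\<^sub>m n"
  using PC_mapD[OF assms(1)] PC_map_one[OF assms(1)] assms(2,3) by (metis UT_one comm_UT)

lemma PC_map_comp:
  assumes "PC_map n \<phi>" "PC_map n \<psi>"
  shows "PC_map n (\<lambda>a. \<phi> (\<psi> a))"
  using assms PC_mapD(1)[OF assms(2)] unfolding PC_map_def
  by (auto dest: bij_betw_trans simp: comp_def)

text \<open>As \<open>B\<close> is injective, preservation of commutators by \<open>c\<close> can be
  tested after applying \<open>B\<close>. In this way the central factor is seen to be a PC-map
  without any computation with it.\<close>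

lemma PC_map_factor:
  assumes B: "PC_map n B" and \<phi>: "PC_map n \<phi>"
    and c: "\<And>a. a \<in> UT n \<Longrightarrow> c a \<in> UT n" "\<And>a. a \<in> UT n \<Longrightarrow> B (c a) = \<phi> a"
  shows "PC_map n c"
proof -
  note BD = PC_mapD[OF B] and D = PC_mapD[OF \<phi>]
  have "c (comm x y) = comm (c x) (c y)" if "x \<in> UT n" "y \<in> UT n" for x y
  proof (rule BD(3))
    have cxy: "c x \<in> UT n" "c y \<in> UT n" "comm x y \<in> UT n"
      using that c(1) comm_UT by auto
    then show "c (comm x y) \<in> UT n" "comm (c x) (c y) \<in> UT n"
      using c(1) comm_UT by auto
    show "B (c (comm x y)) = B (comm (c x) (c y))"
      using that cxy by (simp add: c(2) BD(2) D(2))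
  qed
  moreover have "bij_betw c (UT n) (UT n)"
    unfolding bij_betw_def
  proof (intro conjI inj_onI subset_antisym subsetI)
    show "x = y" if "x \<in> UT n" "y \<in> UT n" "c x = c y" for x y
      using D(3)[OF that(1,2)] c(2)[OF that(1)] c(2)[OF that(2)] that(3) by simp
    show "x \<in> UT n" if "x \<in> c ` UT n" for x using that c by auto
    show "x \<in> c ` UT n" if x: "x \<in> UT n" for x
    proof -
      obtain a where a: "a \<in> UT n" "\<phi> a = B x"
        using D(4)[OF BD(1)[OF x]] by blast
      then have "x = c a"
        using BD(3)[OF x c(1)[OF a(1)]] c(2)[OF a(1)] by simp
      then show ?thesis using a(1) by blast
    qed
  qed
  ultimately show ?thesis by (simp add: PC_map_def)
qed

section \<open>Automorphisms as PC-maps\<close>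

lemma mult_hom_minv:
  fixes h :: "'a::field mat \<Rightarrow> 'a mat"
  assumes h: "\<And>a. a \<in> UT n \<Longrightarrow> h a \<in> UT n"
    and mult: "\<And>a b. a \<in> UT n \<Longrightarrow> b \<in> UT n \<Longrightarrow> h (a * b) = h a * h b"
    and x: "x \<in> UT n"
  shows "h (minv x) = minv (h x)"
proof -
  have "h (1\<^sub>m n) * h (1\<^sub>m n) = 1\<^sub>m n * h (1\<^sub>m n)"
    using mult[OF UT_one UT_one] left_mult_one_mat[OF UT_carrier[OF h[OF UT_one]]] by simp
  then have "h (1\<^sub>m n) = 1\<^sub>m n"
    using UT_right_cancel[OF h[OF UT_one]] h[OF UT_one] by (simp add: UT_carrier)
  then have "h x * h (minv x) = 1\<^sub>m n"
    using mult[OF x UT_minv(1)[OF x]] UT_minv(2)[OF x] by simp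
  then show ?thesis
    using minv_unique[OF UT_carrier[OF h[OF x]] UT_carrier[OF h[OF UT_minv(1)[OF x]]]] by simp
qed

lemma automorphism_PC:
  fixes h :: "'a::field mat \<Rightarrow> 'a mat"
  assumes h: "\<And>a. a \<in> UT n \<Longrightarrow> h a \<in> UT n"
    and mult: "\<And>a b. a \<in> UT n \<Longrightarrow> b \<in> UT n \<Longrightarrow> h (a * b) = h a * h b"
    and k: "\<And>a. a \<in> UT n \<Longrightarrow> k a \<in> UT n"
    and "\<And>a. a \<in> UT n \<Longrightarrow> h (k a) = a" "\<And>a. a \<in> UT n \<Longrightarrow> k (h a) = a"
  shows "PC_map n h"
  unfolding PC_map_def
proof (intro conjI ballI)
  show "bij_betw h (UT n) (UT n)"
    by (rule bij_betw_byWitness[of _ k]) (use assms in auto)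
  show "h (comm x y) = comm (h x) (h y)" if "x \<in> UT n" "y \<in> UT n" for x y
    unfolding comm_def using that
    by (simp add: mult UT_mult UT_minv(1) mult_hom_minv[of n h, OF h mult])
qed

lemma conj_conj_minv:
  fixes t a :: "'a::field mat"
  assumes t: "t \<in> TT n" and a: "a \<in> carrier_mat n n"
  shows "t * (minv t * a * t) * minv t = a" "minv t * (t * a * minv t) * t = a"
proof -
  note tt = TT_facts[OF t]
  have "t * (minv t * a * t) * minv t = (t * minv t) * a * (t * minv t)"
    "minv t * (t * a * minv t) * t = (minv t * t) * a * (minv t * t)"
    using tt(1,4) a by (simp_all add: assoc_mult_mat[of _ n n _ n _ n])
  then show "t * (minv t * a * t) * minv t = a" "minv t * (t * a * minv t) * t = a"
    using tt(5,6) a by auto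
qed

lemma minv_minv: "t \<in> TT n \<Longrightarrow> minv (minv t) = t"
  using TT_facts[of t n] minv_unique by metis

lemma conj_mult:
  fixes t a b :: "'a::field mat"
  assumes t: "t \<in> TT n" and a: "a \<in> carrier_mat n n" and b: "b \<in> carrier_mat n n"
  shows "t * (a * b) * minv t = (t * a * minv t) * (t * b * minv t)"
proof -
  note tt = TT_facts[OF t]
  have "(t * a * minv t) * (t * b * minv t) = t * a * ((minv t * t) * b * minv t)"
    using tt(1,4) a b by (simp add: assoc_mult_mat[of _ n n _ n _ n])
  then show ?thesis
    using tt a b by (simp add: assoc_mult_mat[of _ n n _ n _ n])
qed

lemma conj_PC:
  fixes t :: "'a::field mat"
  assumes t: "t \<in> TT n"
  shows "PC_map n (\<lambda>a. t * a * minv t)"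
proof (rule automorphism_PC[where k = "\<lambda>a. minv t * a * t"])
  note tt = TT_facts[OF t]
  show "t * a * minv t \<in> UT n" "minv t * (t * a * minv t) * t = a"
    "t * (minv t * a * t) * minv t = a" if "a \<in> UT n" for a
    using conj_UT[OF t that] conj_conj_minv[OF t UT_carrier[OF that]] by auto
  show "minv t * a * t \<in> UT n" if "a \<in> UT n" for a
    using conj_UT[OF tt(8) that] minv_minv[OF t] by simp
  show "t * (a * b) * minv t = (t * a * minv t) * (t * b * minv t)"
    if "a \<in> UT n" "b \<in> UT n" for a b
    using conj_mult[OF t] that by (auto dest: UT_carrier)
qed

lemma field_aut_simps:
  assumes "field_automorphism \<theta>"
  shows "\<theta> 0 = 0" "\<theta> 1 = 1" "\<theta> (x + y) = \<theta> x + \<theta> y" "\<theta> (x * y) = \<theta> x * \<theta> y"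
    "\<theta> (- x) = - \<theta> x" "\<theta> (x - y) = \<theta> x - \<theta> y" "\<theta> (sum f S) = (\<Sum>i\<in>S. \<theta> (f i))"
    "\<theta> x = 0 \<longleftrightarrow> x = 0" "bij \<theta>" "inv_into UNIV \<theta> (\<theta> x) = x" "\<theta> (inv_into UNIV \<theta> x) = x"
proof -
  have add: "\<theta> (x + y) = \<theta> x + \<theta> y" for x y
    using assms by (simp add: field_automorphism_def)
  show z: "\<theta> 0 = 0" using add[of 0 0] by (metis add_0 add_cancel_left_right)
  show m: "\<theta> (- x) = - \<theta> x" for x using add[of x "- x"] z by (simp add: eq_neg_iff_add_eq_0 add.commute)
  show "\<theta> (x - y) = \<theta> x - \<theta> y" using add[of x "- y"] m by simp
  show "\<theta> (sum f S) = (\<Sum>i\<in>S. \<theta> (f i))"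
    by (induction S rule: infinite_finite_induct) (auto simp: z add)
  show b: "bij \<theta>" using assms by (simp add: field_automorphism_def)
  show "\<theta> x = 0 \<longleftrightarrow> x = 0" using b z by (metis bij_pointE)
  show "\<theta> 1 = 1" "\<theta> (x + y) = \<theta> x + \<theta> y" "\<theta> (x * y) = \<theta> x * \<theta> y"
    using assms by (auto simp: field_automorphism_def)
  show "inv_into UNIV \<theta> (\<theta> x) = x" "\<theta> (inv_into UNIV \<theta> x) = x"
    using b by (auto simp: bij_is_inj bij_is_surj surj_f_inv_f)
qed

lemma field_aut_inv:
  assumes "field_automorphism \<theta>"
  shows "field_automorphism (inv_into UNIV \<theta>)"
proof -
  note s = field_aut_simps[OF assms]
  have i: "inv_into UNIV \<theta> x = y \<longleftrightarrow> x = \<theta> y" for x y using s(10,11) by metis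
  show ?thesis
    unfolding field_automorphism_def using s bij_imp_bij_inv[OF s(9)] by (simp add: i)
qed

lemma map_mat_mult_field_aut:
  fixes a b :: "'a::field mat"
  assumes "field_automorphism \<theta>" "a \<in> carrier_mat n n" "b \<in> carrier_mat n n"
  shows "map_mat \<theta> (a * b) = map_mat \<theta> a * map_mat \<theta> b"
  using assms by (intro eq_matI)
    (auto simp: scalar_prod_def field_aut_simps[OF assms(1)])

lemma map_mat_UT:
  assumes "field_automorphism \<theta>" "a \<in> UT n"
  shows "map_mat \<theta> a \<in> UT n"
  using field_aut_simps(1,2)[OF assms(1)] UT_carrier[OF assms(2)]
  by (intro UT_I) (auto simp: UT_diag[OF assms(2)] UT_lower[OF assms(2)])

lemma map_mat_inv_field_aut:
  assumes "field_automorphism \<theta>"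
  shows "map_mat \<theta> (map_mat (inv_into UNIV \<theta>) a) = a" "map_mat (inv_into UNIV \<theta>) (map_mat \<theta> a) = a"
  using field_aut_simps[OF assms] by (auto intro!: eq_matI)

lemma field_aut_PC:
  assumes "field_automorphism \<theta>"
  shows "PC_map n (map_mat \<theta>)"
  by (rule automorphism_PC[where k = "map_mat (inv_into UNIV \<theta>)"])
    (auto simp: map_mat_UT assms field_aut_inv map_mat_inv_field_aut
      intro!: map_mat_mult_field_aut dest: UT_carrier)

section \<open>Row and column elements\<close>

lemma mat_eqI:
  assumes "A \<in> carrier_mat n n" "B \<in> carrier_mat n n"
    and "\<And>i j. i < n \<Longrightarrow> j < n \<Longrightarrow> A $$ (i, j) = B $$ (i, j)"
  shows "A = B"
  using assms by (intro eq_matI) auto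

lemma sum_delta_mult:
  fixes f :: "nat \<Rightarrow> 'a::field"
  shows "(\<Sum>k<n. (if k = i then c else 0) * f k) = (if i < n then c * f i else 0)"
    and "(\<Sum>k<n. (if i = k then c else 0) * f k) = (if i < n then c * f i else 0)"
    and "(\<Sum>k<n. f k * (if k = i then c else 0)) = (if i < n then f i * c else 0)"
    and "(\<Sum>k<n. f k * (if i = k then c else 0)) = (if i < n then f i * c else 0)"
proof -
  show a: "(\<Sum>k<n. (if k = i then c else 0) * f k) = (if i < n then c * f i else 0)" for c and f :: "nat \<Rightarrow> 'a"
    by (simp add: if_distrib[of "\<lambda>x. x * _"] cong: if_cong)
  show "(\<Sum>k<n. (if i = k then c else 0) * f k) = (if i < n then c * f i else 0)"
    using a[of c f] by (simp add: eq_commute[of i])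
  show "(\<Sum>k<n. f k * (if k = i then c else 0)) = (if i < n then f i * c else 0)"
    using a[of c f] by (simp add: mult.commute)
  show "(\<Sum>k<n. f k * (if i = k then c else 0)) = (if i < n then f i * c else 0)"
    using a[of c f] by (simp add: mult.commute eq_commute[of i])
qed

section \<open>Products with transvections, row elements and column elements\<close>

lemma tv_carrier [simp]: "tv n p q h \<in> carrier_mat n n"
  by (simp add: tv_def munit_def)

lemma tv_entry:
  assumes "i < n" "j < n"
  shows "tv n p q h $$ (i, j) = (if i = j then 1 else 0) + (if i = p \<and> j = q then h else 0)"
  using assms by (simp add: tv_def munit_def)

lemma tv_UT: "p < q \<Longrightarrow> tv n p q h \<in> UT n"
  by (rule UT_I) (auto simp: tv_entry)

lemma tv_mult_left:
  fixes A :: "'a::field mat"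
  assumes "A \<in> carrier_mat n n" "i < n" "j < n" "q < n"
  shows "(tv n p q h * A) $$ (i, j) = A $$ (i, j) + (if i = p then h * A $$ (q, j) else 0)"
  using assms by (cases "i = p")
    (simp_all add: mat_mult_entry[of _ n] tv_entry distrib_right sum.distrib sum_delta_mult del: index_mult_mat)

lemma tv_mult_right:
  fixes A :: "'a::field mat"
  assumes "A \<in> carrier_mat n n" "i < n" "j < n" "p < n"
  shows "(A * tv n p q h) $$ (i, j) = A $$ (i, j) + (if j = q then A $$ (i, p) * h else 0)"
  using assms by (cases "j = q")
    (simp_all add: mat_mult_entry[of _ n] tv_entry distrib_left sum.distrib sum_delta_mult del: index_mult_mat)

text \<open>In use \<open>r 0 = 0\<close>. The entry \<open>c\<close> at (1, n - 1), called hidden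
  below, is the one freedom outside the first row that commuting with all conjugates allows.\<close>

definition rowm :: "nat \<Rightarrow> (nat \<Rightarrow> 'a::field) \<Rightarrow> 'a \<Rightarrow> 'a mat" where
  "rowm n r c = mat n n (\<lambda>(i, j). (if i = j then 1 else 0) + (if i = 0 then r j else 0)
     + (if i = 1 \<and> j = n - 1 then c else 0))"

text \<open>Mirror image of \<open>rowm\<close> in the anti-diagonal, with hidden entry
  \<open>d\<close> at (0, n - 2). It also parametrises the second centre, when \<open>s\<close> is
  supported on 0 and 1.\<close>

definition colm :: "nat \<Rightarrow> (nat \<Rightarrow> 'a::field) \<Rightarrow> 'a \<Rightarrow> 'a mat" where
  "colm n s d = mat n n (\<lambda>(i, j). (if i = j then 1 else 0) + (if j = n - 1 then s i else 0)
     + (if i = 0 \<and> j = n - 2 then d else 0))"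

lemma rowm_carrier [simp]: "rowm n r c \<in> carrier_mat n n"
  by (simp add: rowm_def)

lemma colm_carrier [simp]: "colm n s d \<in> carrier_mat n n"
  by (simp add: colm_def)

lemma rowm_entry:
  assumes "i < n" "j < n"
  shows "rowm n r c $$ (i, j) = (if i = j then 1 else 0) + (if i = 0 then r j else 0)
     + (if i = 1 \<and> j = n - 1 then c else 0)"
  using assms by (simp add: rowm_def)

lemma colm_entry:
  assumes "i < n" "j < n"
  shows "colm n s d $$ (i, j) = (if i = j then 1 else 0) + (if j = n - 1 then s i else 0)
     + (if i = 0 \<and> j = n - 2 then d else 0)"
  using assms by (simp add: colm_def)

lemma rowm_UT: "4 \<le> n \<Longrightarrow> r 0 = 0 \<Longrightarrow> rowm n r c \<in> UT n"
  by (rule UT_I) (auto simp: rowm_entry)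

lemma colm_UT: "4 \<le> n \<Longrightarrow> s (n - 1) = 0 \<Longrightarrow> colm n s d \<in> UT n"
  by (rule UT_I) (auto simp: colm_entry)

lemma rowm_mult_left:
  fixes A :: "'a::field mat"
  assumes "A \<in> carrier_mat n n" "4 \<le> n" "i < n" "j < n"
  shows "(rowm n r c * A) $$ (i, j) = A $$ (i, j) + (if i = 0 then \<Sum>k<n. r k * A $$ (k, j) else 0)
    + (if i = 1 then c * A $$ (n - 1, j) else 0)"
  using assms by (cases "i = 0"; cases "i = 1")
    (simp_all add: mat_mult_entry[of _ n] rowm_entry distrib_right sum.distrib sum_delta_mult del: index_mult_mat)

lemma rowm_mult_right:
  fixes A :: "'a::field mat"
  assumes "A \<in> carrier_mat n n" "4 \<le> n" "i < n" "j < n"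
  shows "(A * rowm n r c) $$ (i, j) = A $$ (i, j) + A $$ (i, 0) * r j
    + (if j = n - 1 then A $$ (i, 1) * c else 0)"
  using assms by (cases "j = n - 1")
    (simp_all add: mat_mult_entry[of _ n] rowm_entry distrib_left sum.distrib sum_delta_mult del: index_mult_mat)

lemma colm_mult_left:
  fixes A :: "'a::field mat"
  assumes "A \<in> carrier_mat n n" "4 \<le> n" "i < n" "j < n"
  shows "(colm n s d * A) $$ (i, j) = A $$ (i, j) + s i * A $$ (n - 1, j)
    + (if i = 0 then d * A $$ (n - 2, j) else 0)"
  using assms by (cases "i = 0")
    (simp_all add: mat_mult_entry[of _ n] colm_entry distrib_right sum.distrib sum_delta_mult del: index_mult_mat)

lemma colm_mult_right:
  fixes A :: "'a::field mat"
  assumes "A \<in> carrier_mat n n" "4 \<le> n" "i < n" "j < n"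
  shows "(A * colm n s d) $$ (i, j) = A $$ (i, j)
    + (if j = n - 1 then \<Sum>k<n. A $$ (i, k) * s k else 0) + (if j = n - 2 then A $$ (i, 0) * d else 0)"
  using assms by (cases "j = n - 1"; cases "j = n - 2")
    (simp_all add: mat_mult_entry[of _ n] colm_entry distrib_left sum.distrib sum_delta_mult del: index_mult_mat)

lemma colm_eq_tv: "4 \<le> n \<Longrightarrow> colm n (\<lambda>i. if i = 0 then a else 0) 0 = tv n 0 (n - 1) a"
  by (rule mat_eqI[of _ n]) (auto simp: colm_entry tv_entry)

lemma rowm_eqI:
  assumes "\<And>j. j < n \<Longrightarrow> r j = r' j" "c = c'"
  shows "rowm n r c = rowm n r' c'"
  using assms by (intro eq_matI) (auto simp: rowm_def)

lemma colm_eqI: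
  assumes "\<And>i. i < n \<Longrightarrow> s i = s' i" "d = d'"
  shows "colm n s d = colm n s' d'"
  using assms by (intro eq_matI) (auto simp: colm_def)

text \<open>Conjugation by \<open>g\<close> multiplies the row r by the inverse of \<open>g\<close>
  on the right, because column 0 of \<open>g\<close> is a unit column. The entry \<open>c\<close>
  stays in place and, through column 1 of \<open>g\<close>, adds \<open>c * g $$ (0, 1)\<close> to
  the corner. Dividing by the original element subtracts r and removes \<open>c\<close>.\<close>

lemma comm_rowm:
  fixes g :: "'a::field mat" and c :: 'a
  assumes n: "4 \<le> n" and r: "r 0 = 0" and g: "g \<in> UT n"
  defines "r' \<equiv> \<lambda>j. (\<Sum>k<n. r k * minv g $$ (k, j)) - r j + (if j = n - 1 then c * g $$ (0, 1) else 0)"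
  shows "comm g (rowm n r c) = rowm n r' 0" "r' 0 = 0" "r' 1 = 0"
proof -
  let ?h = "minv g"
  have h: "?h \<in> UT n" and hg: "?h * g = 1\<^sub>m n" using UT_minv[OF g] by auto
  note gc = UT_carrier[OF g] and hc = UT_carrier[OF h]
  have "(\<Sum>k<n. r k * ?h $$ (k, 0)) = 0"
    using UT_lower[OF h] r by (intro sum.neutral) (metis lessThan_iff mult_eq_0_iff neq0_conv)
  then show r0: "r' 0 = 0" using n r by (simp add: r'_def)
  \<comment> \<open>Only k = 1 contributes: \<open>r 0\<close> vanishes, and for larger k the entry
    lies below the diagonal.\<close>
  have "(\<Sum>k<n. r k * ?h $$ (k, 1)) = (\<Sum>k<n. (if k = 1 then r 1 else 0) * 1)"
  proof (rule sum.cong[OF refl])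
    fix k assume "k \<in> {..<n}"
    then show "r k * ?h $$ (k, 1) = (if k = 1 then r 1 else 0) * 1"
      using UT_lower[OF h, of 1 k] UT_diag[OF h, of 1] r by (cases "k = 0"; cases "k = 1") auto
  qed
  then have "(\<Sum>k<n. r k * ?h $$ (k, 1)) = r 1" using n by (simp add: sum_delta_mult del: mult_1_right)
  then show r1: "r' 1 = 0" using n by (simp add: r'_def)
  let ?x = "rowm n r c"
  have x: "?x \<in> UT n" using rowm_UT[of n r] n r by auto
  show "comm g ?x = rowm n r' 0"
  proof (rule comm_eqI[OF g x])
    show "rowm n r' 0 \<in> carrier_mat n n" by simp
    note xg = mult_carrier_mat[OF rowm_carrier[of n r c] gc]
      and gx = mult_carrier_mat[OF gc rowm_carrier[of n r c]]
    show "rowm n r' 0 * (?x * g) = g * ?x"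
    proof (rule mat_eqI[OF mult_carrier_mat[OF rowm_carrier xg] gx])
      fix i j assume ij: "i < n" "j < n"
      have Y: "(?x * g) $$ (k, j) = g $$ (k, j) + (if k = 0 then \<Sum>l<n. r l * g $$ (l, j) else 0)
        + (if k = 1 then c * g $$ (n - 1, j) else 0)" if "k < n" for k
        using rowm_mult_left[OF gc n that ij(2)] .
      have gN: "g $$ (n - 1, j) = (if j = n - 1 then 1 else 0)"
        using UT_lower[OF g, of j "n - 1"] UT_diag[OF g, of "n - 1"] n ij by auto
      have gi0: "g $$ (i, 0) = (if i = 0 then 1 else 0)"
        using UT_lower[OF g, of 0 i] UT_diag[OF g, of 0] n ij by auto
      have gi1: "g $$ (i, 1) = (if i = 1 then 1 else if i = 0 then g $$ (0, 1) else 0)"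
        using UT_lower[OF g, of 1 i] UT_diag[OF g, of 1] n ij by auto
      \<comment> \<open>\<open>?x * g\<close> differs from \<open>g\<close> only in rows 0 and 1,
        and there \<open>r'\<close> vanishes.\<close>
      have "(\<Sum>k<n. r' k * (?x * g) $$ (k, j)) = (\<Sum>k<n. r' k * g $$ (k, j))"
      proof (rule sum.cong[OF refl])
        fix k assume "k \<in> {..<n}"
        then show "r' k * (?x * g) $$ (k, j) = r' k * g $$ (k, j)"
          using Y[of k] r0 r1 by (cases "k = 0"; cases "k = 1") (auto simp del: index_mult_mat)
      qed
      also have "\<dots> = (\<Sum>k<n. (\<Sum>l<n. r l * ?h $$ (l, k)) * g $$ (k, j))
          - (\<Sum>k<n. r k * g $$ (k, j)) + (\<Sum>k<n. (if k = n - 1 then c * g $$ (0, 1) else 0) * g $$ (k, j))"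
        by (simp only: r'_def distrib_right left_diff_distrib sum.distrib sum_subtractf)
      also have "(\<Sum>k<n. (if k = n - 1 then c * g $$ (0, 1) else 0) * g $$ (k, j))
          = (if j = n - 1 then c * g $$ (0, 1) else 0)"
        using n by (simp add: sum_delta_mult gN[unfolded One_nat_def])
      also have "(\<Sum>k<n. (\<Sum>l<n. r l * ?h $$ (l, k)) * g $$ (k, j))
          = (\<Sum>l<n. r l * (?h * g) $$ (l, j))"
      proof -
        have "(\<Sum>k<n. (\<Sum>l<n. r l * ?h $$ (l, k)) * g $$ (k, j))
            = (\<Sum>k<n. \<Sum>l<n. r l * (?h $$ (l, k) * g $$ (k, j)))"
          by (simp add: sum_distrib_right mult.assoc)
        also have "\<dots> = (\<Sum>l<n. \<Sum>k<n. r l * (?h $$ (l, k) * g $$ (k, j)))"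
          by (rule sum.swap)
        also have "\<dots> = (\<Sum>l<n. r l * (?h * g) $$ (l, j))"
          using ij by (intro sum.cong refl) (simp only: lessThan_iff mat_mult_entry[OF hc gc] sum_distrib_left)
        finally show ?thesis .
      qed
      also have "\<dots> = (\<Sum>l<n. r l * (if l = j then 1 else 0))"
        unfolding hg using ij by (intro sum.cong) auto
      also have "\<dots> = r j"
        using ij by (simp only: sum_delta_mult) simp
      finally have S: "(\<Sum>k<n. r' k * (?x * g) $$ (k, j)) = r j - (\<Sum>k<n. r k * g $$ (k, j))
        + (if j = n - 1 then c * g $$ (0, 1) else 0)" .
      show "(rowm n r' 0 * (?x * g)) $$ (i, j) = (g * ?x) $$ (i, j)"
        unfolding rowm_mult_left[OF xg n ij] rowm_mult_right[OF gc n ij] Y[OF ij(1)] S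
        using gN gi0 gi1 by auto
    qed
  qed
qed

text \<open>Mirror of \<open>comm_rowm\<close>, but a column is multiplied by \<open>g\<close> from
  the left, so entries of \<open>g\<close> itself appear. The sign of the corner term comes from the
  (n - 2, n - 1) entry of the inverse of \<open>g\<close>.\<close>

lemma comm_colm:
  fixes g :: "'a::field mat" and d :: 'a
  assumes n: "4 \<le> n" and s: "s (n - 1) = 0" and g: "g \<in> UT n"
  defines "s' \<equiv> \<lambda>i. (\<Sum>k<n. g $$ (i, k) * s k) - s i - (if i = 0 then d * g $$ (n - 2, n - 1) else 0)"
  shows "comm g (colm n s d) = colm n s' 0" "s' (n - 1) = 0" "s' (n - 2) = 0"
proof -
  note gc = UT_carrier[OF g]
  have "(\<Sum>k<n. g $$ (n - 1, k) * s k) = 0"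
    using UT_lower[OF g] s n by (intro sum.neutral ballI) (case_tac "x = n - 1", auto)
  then show sN: "s' (n - 1) = 0" using n s by (simp add: s'_def)
  have "(\<Sum>k<n. g $$ (n - 2, k) * s k) = (\<Sum>k<n. (if k = n - 2 then s (n - 2) else 0) * 1)"
  proof (rule sum.cong[OF refl])
    fix k assume "k \<in> {..<n}"
    then consider "k = n - 1" | "k = n - 2" | "k < n - 2" by force
    then show "g $$ (n - 2, k) * s k = (if k = n - 2 then s (n - 2) else 0) * 1"
      using UT_lower[OF g, of k "n - 2"] UT_diag[OF g, of "n - 2"] s n by cases auto
  qed
  then have "(\<Sum>k<n. g $$ (n - 2, k) * s k) = s (n - 2)" using n by (simp add: sum_delta_mult del: mult_1_right)
  then show "s' (n - 2) = 0" using n by (simp add: s'_def)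
  let ?y = "colm n s d"
  have y: "?y \<in> UT n" using colm_UT[of n s] n s by auto
  show "comm g ?y = colm n s' 0"
  proof (rule comm_eqI[OF g y])
    show "colm n s' 0 \<in> carrier_mat n n" by simp
    note yg = mult_carrier_mat[OF colm_carrier[of n s d] gc]
      and gy = mult_carrier_mat[OF gc colm_carrier[of n s d]]
    show "colm n s' 0 * (?y * g) = g * ?y"
    proof (rule mat_eqI[OF mult_carrier_mat[OF colm_carrier yg] gy])
      fix i j assume ij: "i < n" "j < n"
      have nn: "n - 1 < n" using n by simp
      have gN: "g $$ (n - 1, j) = (if j = n - 1 then 1 else 0)"
        using UT_lower[OF g, of j "n - 1"] UT_diag[OF g, of "n - 1"] n ij by auto
      have gM: "g $$ (n - 2, j) = (if j = n - 2 then 1 else if j = n - 1 then g $$ (n - 2, n - 1) else 0)"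
        using UT_lower[OF g, of j "n - 2"] UT_diag[OF g, of "n - 2"] n ij by auto
      have gi0: "g $$ (i, 0) = (if i = 0 then 1 else 0)"
        using UT_lower[OF g, of 0 i] UT_diag[OF g, of 0] n ij by auto
      show "(colm n s' 0 * (?y * g)) $$ (i, j) = (g * ?y) $$ (i, j)"
        unfolding colm_mult_left[OF yg n ij] colm_mult_right[OF gc n ij] colm_mult_left[OF gc n ij]
          colm_mult_left[OF gc n nn ij(2)]
        using n s gM by (auto simp: gN[unfolded One_nat_def] gi0 s'_def)
    qed
  qed
qed

text \<open>The column formula with \<open>g = rowm n r c\<close> leaves only the corner, and
  neither hidden entry enters: this is the pairing.\<close>

lemma comm_rowm_colm:
  fixes r s :: "nat \<Rightarrow> 'a::field"
  assumes n: "4 \<le> n" and r: "r 0 = 0" and s: "s (n - 1) = 0"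
  shows "comm (rowm n r c) (colm n s d) = tv n 0 (n - 1) (\<Sum>k<n. r k * s k)"
proof -
  let ?g = "rowm n r c"
  have g: "?g \<in> UT n" using rowm_UT[of n r] n r by auto
  have "(\<Sum>k<n. ?g $$ (i, k) * s k) - s i - (if i = 0 then d * ?g $$ (n - 2, n - 1) else 0)
      = (if i = 0 then \<Sum>k<n. r k * s k else 0)" if "i < n" for i
  proof -
    have "(\<Sum>k<n. ?g $$ (i, k) * s k) = (\<Sum>k<n. (if i = k then 1 else 0) * s k)
      + (if i = 0 then \<Sum>k<n. r k * s k else 0)
      + (if i = 1 then \<Sum>k<n. (if k = n - 1 then c else 0) * s k else 0)"
      using that by (cases "i = 0"; cases "i = 1") (simp_all add: rowm_entry distrib_right sum.distrib)
    then show ?thesis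
      using that n s by (simp add: sum_delta_mult rowm_entry)
  qed
  then show ?thesis
    unfolding comm_colm(1)[of n s, OF n s g] colm_eq_tv[OF n, symmetric] by (intro colm_eqI) auto
qed

section \<open>Elements commuting with their conjugates\<close>

text \<open>The conjugate of \<open>x\<close> by \<open>g\<close> is \<open>comm g x * x\<close>, so
  \<open>x\<close> commutes with it exactly when it commutes with \<open>comm g x\<close>; the
  commutator form is the one a PC-map transports.\<close>

definition conj_commuting :: "nat \<Rightarrow> 'a::field mat \<Rightarrow> bool" where
  "conj_commuting n x \<longleftrightarrow> (\<forall>g\<in>UT n. comm x (comm g x) = 1\<^sub>m n)"

definition second_central :: "nat \<Rightarrow> 'a::field mat \<Rightarrow> bool" where
  "second_central n u \<longleftrightarrow> (\<forall>g\<in>UT n. \<forall>h\<in>UT n. comm h (comm g u) = 1\<^sub>m n)"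

definition K1 :: "nat \<Rightarrow> 'a::field mat set" where
  "K1 n = {rowm n r c | r c. r 0 = 0 \<and> r 1 \<noteq> 0}"

definition K2 :: "nat \<Rightarrow> 'a::field mat set" where
  "K2 n = {colm n s d | s d. s (n - 1) = 0 \<and> s (n - 2) \<noteq> 0}"

lemma sq_mult_carrier: "A \<in> carrier_mat n n \<Longrightarrow> B \<in> carrier_mat n n \<Longrightarrow> A * B \<in> carrier_mat n n"
  by (rule mult_carrier_mat)

lemma K1_I: "r 0 = 0 \<Longrightarrow> r 1 \<noteq> 0 \<Longrightarrow> rowm n r c \<in> K1 n"
  by (auto simp: K1_def)

lemma K2_I: "s (n - 1) = 0 \<Longrightarrow> s (n - 2) \<noteq> 0 \<Longrightarrow> colm n s d \<in> K2 n"
  by (auto simp: K2_def)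

lemma tv_minv:
  assumes "p < q" "q < n"
  shows "minv (tv n p q a) = tv n p q (- a)"
  using assms by (intro minv_unique[of _ n] mat_eqI[of _ n])
    (auto simp: tv_mult_left tv_entry simp del: index_mult_mat intro!: sq_mult_carrier)

text \<open>For a matrix unit \<open>e = e\<^bsub>pq\<^esub>\<close> and \<open>g = 1 + e\<close>, the conjugate \<open>g x g\<inverse>\<close> is
  \<open>x + e x - x e\<close>, because \<open>e x e = 0\<close>. That \<open>x\<close> commutes with it says
  \<open>2 x e x = x\<^sup>2 e + e x\<^sup>2\<close>.\<close>

lemma conj_commuting_quadratic:
  fixes x :: "'a::field mat"
  assumes x: "x \<in> UT n" and a: "conj_commuting n x" and pq: "p < q" "q < n"
    and ij: "i < n" "j < n"
  shows "2 * x $$ (i, p) * x $$ (q, j)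
    = (if j = q then (x * x) $$ (i, p) else 0) + (if i = p then (x * x) $$ (q, j) else 0)"
proof -
  let ?g = "tv n p q 1 :: 'a mat" and ?h = "tv n p q (-1) :: 'a mat"
  have g: "?g \<in> UT n" using tv_UT[of p q n] pq by blast
  have h: "minv ?g = ?h" using tv_minv[OF pq, of 1] by simp
  note xc = UT_carrier[OF x] and cc = UT_carrier[OF comm_UT[OF g x]]
  have p: "p < n" using pq by simp
  define W where "W = ?g * x * ?h"
  have Wc: "W \<in> carrier_mat n n"
    unfolding W_def by (intro mult_carrier_mat[of _ n n]) (auto intro: xc)
  have gx: "?g * x \<in> carrier_mat n n" by (rule mult_carrier_mat[OF tv_carrier xc])
  \<comment> \<open>The term \<open>e x e\<close> would contribute \<open>x $$ (q, p)\<close>, which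
    lies below the diagonal.\<close>
  have W: "W $$ (k, l) = x $$ (k, l) + (if k = p then x $$ (q, l) else 0) - (if l = q then x $$ (k, p) else 0)"
    if "k < n" "l < n" for k l
    unfolding W_def tv_mult_right[OF gx that p] tv_mult_left[OF xc that pq(2)]
      tv_mult_left[OF xc that(1) p pq(2)]
    using UT_lower[OF x pq] by auto
  have "W = comm ?g x * x"
  proof -
    have hc: "?h \<in> carrier_mat n n" "?g \<in> carrier_mat n n" by auto
    have "W = comm ?g x * (x * ?g) * ?h"
      unfolding W_def comm_mult[OF g x] ..
    also have "\<dots> = comm ?g x * (x * (?g * ?h))"
      using cc xc hc by (simp add: assoc_mult_mat[of _ n n _ n _ n])
    also have "?g * ?h = 1\<^sub>m n"
      using UT_minv(2)[OF g] h by simp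
    finally show ?thesis using xc by simp
  qed
  moreover have "x * comm ?g x = comm ?g x * x"
    using a g comm_eq_one_iff[OF x comm_UT[OF g x]] by (auto simp: conj_commuting_def)
  ultimately have "x * W = W * x"
    using xc cc by (metis assoc_mult_mat)
  then have "(x * W) $$ (i, j) = (W * x) $$ (i, j)" by simp
  moreover have "(x * W) $$ (i, j) = (x * x) $$ (i, j) + x $$ (i, p) * x $$ (q, j)
      - (if j = q then (x * x) $$ (i, p) else 0)"
  proof -
    have "(x * W) $$ (i, j) = (\<Sum>k<n. x $$ (i, k) * x $$ (k, j)
        + x $$ (i, k) * (if k = p then x $$ (q, j) else 0)
        - x $$ (i, k) * (if j = q then x $$ (k, p) else 0))"
      unfolding mat_mult_entry[OF xc Wc ij]
      using ij by (intro sum.cong refl) (simp add: W distrib_left right_diff_distrib)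
    then show ?thesis
      using p ij by (simp add: sum.distrib sum_subtractf sum_delta_mult mat_mult_entry[OF xc xc] del: index_mult_mat)
  qed
  moreover have "(W * x) $$ (i, j) = (x * x) $$ (i, j) + (if i = p then (x * x) $$ (q, j) else 0)
      - x $$ (i, p) * x $$ (q, j)"
  proof -
    have "(W * x) $$ (i, j) = (\<Sum>k<n. x $$ (i, k) * x $$ (k, j)
        + (if i = p then x $$ (q, k) else 0) * x $$ (k, j)
        - (if k = q then x $$ (i, p) else 0) * x $$ (k, j))"
      unfolding mat_mult_entry[OF Wc xc ij]
      using ij by (intro sum.cong refl) (simp add: W distrib_right left_diff_distrib)
    then show ?thesis
      using pq ij by (simp add: sum.distrib sum_subtractf sum_delta_mult mat_mult_entry[OF xc xc] del: index_mult_mat)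
  qed
  ultimately show ?thesis
    by (simp add: algebra_simps del: index_mult_mat)
qed

text \<open>At \<open>p = 1\<close>, \<open>i = 0\<close> the right-hand side of the quadratic
  identity is zero unless \<open>j = q\<close>; cancelling 2 and the (0, 1) entry clears every row
  from 2 on. Then \<open>q = n - 1\<close> clears row 1 up to its last entry: \<open>p < q\<close>
  excludes \<open>p = n - 1\<close>, which is why the hidden entry survives.\<close>

lemma conj_commuting_K1:
  fixes x :: "'a::field mat"
  assumes n: "4 \<le> n" and two: "(2::'a) \<noteq> 0"
    and x: "x \<in> UT n" and a: "conj_commuting n x" and x01: "x $$ (0, 1) \<noteq> 0"
  shows "x \<in> K1 n"
proof -
  note quad = conj_commuting_quadratic[OF x a] and xc = UT_carrier[OF x]
  have rows: "x $$ (q, j) = 0" if "2 \<le> q" "q < n" "j < n" "j \<noteq> q" for q j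
    using quad[of 1 q 0 j] that n two x01 by simp
  have row1: "x $$ (1, p) = 0" if p: "2 \<le> p" "p < n - 1" for p
  proof -
    have pn: "p < n" using p by simp
    \<comment> \<open>The rows from 2 on are already unit rows, so only k = 0, 1 and p
      contribute.\<close>
    have "(x * x) $$ (0, p) = (\<Sum>k<n. (if k = 0 then x $$ (0, p) else 0)
        + (if k = 1 then x $$ (0, 1) * x $$ (1, p) else 0) + (if k = p then x $$ (0, p) else 0))"
      unfolding mat_mult_entry[OF xc xc order_le_less_trans[OF le0 pn] pn]
    proof (rule sum.cong[OF refl])
      fix k assume k: "k \<in> {..<n}"
      consider "k = 0" | "k = 1" | "k = p" | "2 \<le> k" "k \<noteq> p" by linarith
      then show "x $$ (0, k) * x $$ (k, p) = (if k = 0 then x $$ (0, p) else 0)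
        + (if k = 1 then x $$ (0, 1) * x $$ (1, p) else 0) + (if k = p then x $$ (0, p) else 0)"
        using k p pn rows[of k p] UT_diag[OF x, of 0] UT_diag[OF x, of p] by cases auto
    qed
    also have "\<dots> = x $$ (0, p) + x $$ (0, 1) * x $$ (1, p) + x $$ (0, p)"
      using pn n by (simp add: sum.distrib)
    finally have "2 * x $$ (0, p) = x $$ (0, p) + x $$ (0, 1) * x $$ (1, p) + x $$ (0, p)"
      using quad[of p "n - 1" 0 "n - 1"] p n UT_diag[OF x, of "n - 1"] by (simp del: index_mult_mat)
    then show ?thesis using x01 by simp
  qed
  let ?y = "rowm n (\<lambda>j. if j = 0 then 0 else x $$ (0, j)) (x $$ (1, n - 1))"
  have "x = ?y"
  proof (rule mat_eqI[OF xc rowm_carrier])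
    fix i j assume ij: "i < n" "j < n"
    consider "i = 0" | "i = 1" "j = 0" | "i = 1" "j = 1" | "i = 1" "2 \<le> j" "j < n - 1" | "i = 1" "j = n - 1"
      | "2 \<le> i" "i = j" | "2 \<le> i" "i \<noteq> j"
      using ij by linarith
    then show "x $$ (i, j) = ?y $$ (i, j)"
      using ij n rows[of i j] row1[of j] UT_diag[OF x, of i] UT_lower[OF x, of 0 1]
      by cases (auto simp: rowm_entry)
  qed
  moreover have "?y \<in> K1 n" using x01 by (intro K1_I) auto
  ultimately show ?thesis by simp
qed

text \<open>The reflected argument: \<open>q = n - 2\<close>, \<open>j = n - 1\<close> clears the
  columns before n - 2, then \<open>p = 0\<close> clears column n - 2 up to its top entry.\<close>

lemma conj_commuting_K2:
  fixes x :: "'a::field mat"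
  assumes n: "4 \<le> n" and two: "(2::'a) \<noteq> 0"
    and x: "x \<in> UT n" and a: "conj_commuting n x" and xN: "x $$ (n - 2, n - 1) \<noteq> 0"
  shows "x \<in> K2 n"
proof -
  note quad = conj_commuting_quadratic[OF x a] and xc = UT_carrier[OF x]
  have nn: "n - 1 < n" "n - 2 < n" using n by auto
  have cols: "x $$ (i, p) = 0" if "p < n - 2" "i < n" "i \<noteq> p" for i p
  proof -
    have "n - 1 \<noteq> n - 2" using n by simp
    then show ?thesis using quad[of p "n - 2" i "n - 1"] that n two xN by simp
  qed
  have colM: "x $$ (q, n - 2) = 0" if q: "1 \<le> q" "q < n - 2" for q
  proof -
    have qn: "q < n" and qN: "n - 1 \<noteq> q" using q by auto
    have "(x * x) $$ (q, n - 1) = (\<Sum>k<n. (if k = q then x $$ (q, n - 1) else 0)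
        + (if k = n - 2 then x $$ (q, n - 2) * x $$ (n - 2, n - 1) else 0)
        + (if k = n - 1 then x $$ (q, n - 1) else 0))"
      unfolding mat_mult_entry[OF xc xc qn nn(1)]
    proof (rule sum.cong[OF refl])
      fix k assume k: "k \<in> {..<n}"
      then consider "k = q" | "k = n - 2" | "k = n - 1" | "k < n - 2" "k \<noteq> q"
        unfolding lessThan_iff by linarith
      then show "x $$ (q, k) * x $$ (k, n - 1) = (if k = q then x $$ (q, n - 1) else 0)
        + (if k = n - 2 then x $$ (q, n - 2) * x $$ (n - 2, n - 1) else 0)
        + (if k = n - 1 then x $$ (q, n - 1) else 0)"
        using k q qn n cols[of k q] UT_diag[OF x, of q] UT_diag[OF x, of "n - 1"] by cases auto
    qed
    also have "\<dots> = x $$ (q, n - 1) + x $$ (q, n - 2) * x $$ (n - 2, n - 1) + x $$ (q, n - 1)"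
      using qn nn by (simp add: sum.distrib)
    finally have "2 * x $$ (q, n - 1) = x $$ (q, n - 1) + x $$ (q, n - 2) * x $$ (n - 2, n - 1) + x $$ (q, n - 1)"
      using quad[of 0 q 0 "n - 1"] q qn qN n UT_diag[OF x, of 0] by (simp del: index_mult_mat)
    then show ?thesis using xN by simp
  qed
  let ?y = "colm n (\<lambda>i. if i = n - 1 then 0 else x $$ (i, n - 1)) (x $$ (0, n - 2))"
  have "x = ?y"
  proof (rule mat_eqI[OF xc colm_carrier])
    fix i j assume ij: "i < n" "j < n"
    consider "j = n - 1" | "j = n - 2" | "j < n - 2" using ij by linarith
    then show "x $$ (i, j) = ?y $$ (i, j)"
    proof cases
      case 1
      then show ?thesis using ij n UT_diag[OF x, of "n - 1"] by (cases "i = n - 1") (auto simp: colm_entry)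
    next
      case 2
      consider "i = n - 1" | "i = n - 2" | "i = 0" | "1 \<le> i" "i < n - 2" using ij by linarith
      then show ?thesis
        using 2 ij n colM[of i] UT_diag[OF x, of i] UT_lower[OF x, of "n - 2" "n - 1"]
        by cases (auto simp: colm_entry)
    next
      case 3
      then show ?thesis
        using ij n cols[of j i] UT_diag[OF x, of i] by (cases "i = j") (auto simp: colm_entry)
    qed
  qed
  moreover have "?y \<in> K2 n" using xN n by (intro K2_I) auto
  ultimately show ?thesis by simp
qed

text \<open>With \<open>r' 1 = 0\<close> the second row never meets the entry \<open>c\<close>, and
  the two row parts multiply to zero because \<open>r 0\<close> and \<open>r' 0\<close>
  vanish.\<close>

lemma rowm_commute:
  fixes r r' :: "nat \<Rightarrow> 'a::field"
  assumes n: "4 \<le> n" and "r 0 = 0" "r' 0 = 0" "r' 1 = 0"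
  shows "rowm n r c * rowm n r' 0 = rowm n r' 0 * rowm n r c"
proof (rule mat_eqI)
  fix i j assume ij: "i < n" "j < n"
  have "(\<Sum>k<n. r k * rowm n r' 0 $$ (k, j)) = (\<Sum>k<n. r k * (if k = j then 1 else 0))"
    using ij assms by (intro sum.cong refl) (auto simp: rowm_entry)
  also have "\<dots> = r j" using ij by (simp only: sum_delta_mult) simp
  finally show "(rowm n r c * rowm n r' 0) $$ (i, j) = (rowm n r' 0 * rowm n r c) $$ (i, j)"
    using rowm_mult_left[OF rowm_carrier[of n r' 0] n ij, of r c]
      rowm_mult_right[OF rowm_carrier[of n r' 0] n ij, of r c]
      assms ij by (auto simp: rowm_entry simp del: index_mult_mat)
qed (auto intro!: sq_mult_carrier)

lemma colm_commute:
  fixes s s' :: "nat \<Rightarrow> 'a::field"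
  assumes n: "4 \<le> n" and "s (n - 1) = 0" "s' (n - 1) = 0" "s' (n - 2) = 0"
  shows "colm n s d * colm n s' 0 = colm n s' 0 * colm n s d"
proof (rule mat_eqI)
  fix i j assume ij: "i < n" "j < n"
  have "(\<Sum>k<n. colm n s' 0 $$ (i, k) * s k) = (\<Sum>k<n. (if i = k then 1 else 0) * s k)"
    using ij assms by (intro sum.cong refl) (auto simp: colm_entry)
  also have "\<dots> = s i" using ij by (simp only: sum_delta_mult) simp
  finally show "(colm n s d * colm n s' 0) $$ (i, j) = (colm n s' 0 * colm n s d) $$ (i, j)"
    using colm_mult_left[OF colm_carrier[of n s' 0] n ij, of s d]
      colm_mult_right[OF colm_carrier[of n s' 0] n ij, of s d]
      assms ij by (auto simp: colm_entry simp del: index_mult_mat)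
qed (auto intro!: sq_mult_carrier)

lemma comm_rowm_form:
  fixes g :: "'a::field mat"
  assumes "4 \<le> n" "r 0 = 0" "g \<in> UT n"
  obtains r' where "comm g (rowm n r c) = rowm n r' 0" "r' 0 = 0" "r' 1 = 0"
  using comm_rowm[of n r g c] assms by blast

lemma comm_colm_form:
  fixes g :: "'a::field mat"
  assumes "4 \<le> n" "s (n - 1) = 0" "g \<in> UT n"
  obtains s' where "comm g (colm n s d) = colm n s' 0" "s' (n - 1) = 0" "s' (n - 2) = 0"
  using comm_colm[of n s g d] assms by blast

lemma K1_D:
  fixes x :: "'a::field mat"
  assumes n: "4 \<le> n" and "x \<in> K1 n"
  shows "x \<in> UT n" "x $$ (0, 1) \<noteq> 0" "x $$ (n - 2, n - 1) = 0" "conj_commuting n x"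
proof -
  obtain r c where r: "x = rowm n r c" "r 0 = 0" "r 1 \<noteq> 0" using assms by (auto simp: K1_def)
  show x: "x \<in> UT n" "x $$ (0, 1) \<noteq> 0" "x $$ (n - 2, n - 1) = 0"
    using r n by (auto simp: rowm_UT rowm_entry)
  show "conj_commuting n x"
    unfolding conj_commuting_def
  proof
    fix g :: "'a mat" assume g: "g \<in> UT n"
    obtain r' where r': "comm g x = rowm n r' 0" "r' 0 = 0" "r' 1 = 0"
      using comm_rowm_form[of n r g c, OF n r(2) g] r(1) by blast
    show "comm x (comm g x) = 1\<^sub>m n"
      using comm_eq_one_iff[OF x(1) comm_UT[OF g x(1)]] rowm_commute[of n r r' c] n r r' by simp
  qed
qed

lemma K2_D:
  fixes x :: "'a::field mat"
  assumes n: "4 \<le> n" and "x \<in> K2 n"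
  shows "x \<in> UT n" "x $$ (n - 2, n - 1) \<noteq> 0" "x $$ (0, 1) = 0" "conj_commuting n x"
proof -
  obtain s d where s: "x = colm n s d" "s (n - 1) = 0" "s (n - 2) \<noteq> 0" using assms by (auto simp: K2_def)
  show x: "x \<in> UT n" "x $$ (n - 2, n - 1) \<noteq> 0" "x $$ (0, 1) = 0"
    using s n by (auto simp: colm_UT colm_entry)
  show "conj_commuting n x"
    unfolding conj_commuting_def
  proof
    fix g :: "'a mat" assume g: "g \<in> UT n"
    obtain s' where s': "comm g x = colm n s' 0" "s' (n - 1) = 0" "s' (n - 2) = 0"
      using comm_colm_form[of n s g d, OF n s(2) g] s(1) by blast
    show "comm x (comm g x) = 1\<^sub>m n"
      using comm_eq_one_iff[OF x(1) comm_UT[OF g x(1)]] colm_commute[of n s s' d] n s s' by simp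
  qed
qed

section \<open>The centre and the second centre\<close>

lemma central_form:
  fixes z :: "'a::field mat"
  assumes n: "4 \<le> n" and z: "z \<in> UT n" and "\<And>h. h \<in> UT n \<Longrightarrow> comm h z = 1\<^sub>m n"
  shows "\<exists>a. z = tv n 0 (n - 1) a"
proof -
  note zc = UT_carrier[OF z]
  \<comment> \<open>Entrywise form of commuting with the matrix unit at (p, q).\<close>
  have e: "(if j = q then z $$ (i, p) else 0) = (if i = p then z $$ (q, j) else 0)"
    if "p < q" "q < n" "i < n" "j < n" for p q i j
  proof -
    have pn: "p < n" using that by simp
    have "tv n p q 1 * z = z * tv n p q 1"
      using assms(3) comm_eq_one_iff[OF tv_UT[OF that(1)] z] tv_UT[OF that(1)] by blast
    then have "(tv n p q 1 * z) $$ (i, j) = (z * tv n p q 1) $$ (i, j)" by simp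
    then show ?thesis
      unfolding tv_mult_left[OF zc that(3,4,2)] tv_mult_right[OF zc that(3,4) pn] by auto
  qed
  have "z = tv n 0 (n - 1) (z $$ (0, n - 1))"
  proof (rule mat_eqI[OF zc tv_carrier])
    fix i j assume ij: "i < n" "j < n"
    show "z $$ (i, j) = tv n 0 (n - 1) (z $$ (0, n - 1)) $$ (i, j)"
    proof (cases "i = j \<or> (i = 0 \<and> j = n - 1)")
      case True then show ?thesis using UT_diag[OF z, of i] ij n by (auto simp: tv_entry)
    next
      case False
      then have "z $$ (i, j) = 0"
        using e[of j "n - 1" i "n - 1"] e[of 0 i 0 j] ij by (cases "j = n - 1") auto
      then show ?thesis using False ij by (auto simp: tv_entry)
    qed
  qed
  then show ?thesis by blast
qed

text \<open>Since \<open>comm g u\<close> is a corner element, \<open>g * u\<close> and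
  \<open>u * g\<close> agree off the corner. So the relations found for the centre hold there as
  well, and they leave only (0, n - 2), (1, n - 1) and the corner free.\<close>

lemma second_central_form:
  fixes u :: "'a::field mat"
  assumes n: "4 \<le> n" and u: "u \<in> UT n" and "second_central n u"
  shows "\<exists>a b d. u = colm n (\<lambda>i. if i = 0 then a else if i = 1 then b else 0) d"
proof -
  note uc = UT_carrier[OF u]
  have e: "(if j = q then u $$ (i, p) else 0) = (if i = p then u $$ (q, j) else 0)"
    if "p < q" "q < n" "i < n" "j < n" and ne: "\<not> (i = 0 \<and> j = n - 1)" for p q i j
  proof -
    let ?g = "tv n p q 1 :: 'a mat"
    have pn: "p < n" using that by simp
    have g: "?g \<in> UT n" by (rule tv_UT[OF that(1)])
    obtain a where a: "comm ?g u = tv n 0 (n - 1) a"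
      using central_form[OF n comm_UT[OF g u]] assms(3) g by (auto simp: second_central_def)
    note ug = UT_mult[OF u g]
    have "(?g * u) $$ (i, j) = (tv n 0 (n - 1) a * (u * ?g)) $$ (i, j)"
      using comm_mult[OF g u] a by simp
    \<comment> \<open>A corner factor on the left adds a multiple of row n - 1 to row 0, which
      changes only the corner.\<close>
    also have "\<dots> = (u * ?g) $$ (i, j)"
    proof -
      have "(u * ?g) $$ (n - 1, j) = 0" if "i = 0"
        using UT_lower[OF ug, of j "n - 1"] that ne \<open>j < n\<close> n by linarith
      then show ?thesis
        using tv_mult_left[OF UT_carrier[OF ug] that(3,4), of "n - 1" 0 a] n by (auto simp del: index_mult_mat)
    qed
    finally show ?thesis
      unfolding tv_mult_left[OF uc that(3,4,2)] tv_mult_right[OF uc that(3,4) pn] by auto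
  qed
  let ?v = "colm n (\<lambda>i. if i = 0 then u $$ (0, n - 1) else if i = 1 then u $$ (1, n - 1) else 0) (u $$ (0, n - 2))"
  have "u = ?v"
  proof (rule mat_eqI[OF uc colm_carrier])
    fix i j assume ij: "i < n" "j < n"
    show "u $$ (i, j) = ?v $$ (i, j)"
    proof (cases "i = j \<or> (i = 0 \<and> j = n - 1) \<or> (i = 0 \<and> j = n - 2) \<or> (i = 1 \<and> j = n - 1)")
      case True then show ?thesis using UT_diag[OF u, of i] ij n by (auto simp: colm_entry)
    next
      case False
      consider "j < i" | "i = 0" "0 < j" "j < n - 2" | "1 \<le> i" "i \<noteq> j" "j < n - 1" | "2 \<le> i" "i \<noteq> j"
        using ij False by linarith
      then have "u $$ (i, j) = 0"
      proof cases
        case 1 then show ?thesis using UT_lower[OF u] ij by blast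
      next
        case 2 then show ?thesis using e[of j "n - 2" 0 "n - 2"] ij n by auto
      next
        case 3 then show ?thesis using e[of j "n - 1" i "n - 1"] ij n by auto
      next
        case 4 then show ?thesis using e[of 1 i 1 j] ij n by auto
      qed
      then show ?thesis using False ij n by (auto simp: colm_entry)
    qed
  qed
  then show ?thesis by blast
qed

text \<open>Modulo the centre, the second centre has coordinates \<open>b\<close> and
  \<open>d\<close>, and \<open>g\<close> meets them only through its first and last superdiagonal
  entries. Hence centralising the second centre means that both of these vanish.\<close>

lemma comm_second_central:
  fixes g :: "'a::field mat"
  assumes n: "4 \<le> n" and g: "g \<in> UT n"
  shows "comm g (colm n (\<lambda>i. if i = 0 then a else if i = 1 then b else 0) d)
    = tv n 0 (n - 1) (g $$ (0, 1) * b - d * g $$ (n - 2, n - 1))"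
proof -
  let ?s = "\<lambda>i::nat. if i = 0 then a else if i = 1 then b else 0"
  have s: "?s (n - 1) = 0" using n by auto
  have "(\<Sum>k<n. g $$ (i, k) * ?s k) = (if i = 0 then a + g $$ (0, 1) * b else if i = 1 then b else 0)"
    if "i < n" for i
  proof -
    have "(\<Sum>k<n. g $$ (i, k) * ?s k) = (\<Sum>k<n. g $$ (i, k) * (if k = 0 then a else 0)
      + g $$ (i, k) * (if k = 1 then b else 0))"
      by (intro sum.cong) auto
    also have "\<dots> = g $$ (i, 0) * a + g $$ (i, 1) * b"
      using n by (simp only: sum.distrib sum_delta_mult) simp
    finally show ?thesis
      using that n UT_lower[OF g, of 0 i] UT_lower[OF g, of 1 i] UT_diag[OF g, of 0] UT_diag[OF g, of 1]
      by auto
  qed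
  then show ?thesis
    unfolding comm_colm(1)[of n ?s, OF n s g] colm_eq_tv[OF n, symmetric] by (intro colm_eqI) auto
qed

lemma tv_eq_one_iff:
  assumes "p < q" "q < n"
  shows "tv n p q a = 1\<^sub>m n \<longleftrightarrow> a = 0"
proof
  show "a = 0" if "tv n p q a = 1\<^sub>m n"
    using arg_cong[OF that, of "\<lambda>m. m $$ (p, q)"] assms by (simp add: tv_entry)
  show "tv n p q a = 1\<^sub>m n" if "a = 0"
    using that assms by (intro mat_eqI[of _ n]) (auto simp: tv_entry)
qed

lemma comm_second_central_one:
  fixes g :: "'a::field mat"
  assumes n: "4 \<le> n" and g: "g \<in> UT n"
  shows "comm g (colm n (\<lambda>i. if i = 0 then a else if i = 1 then b else 0) d) = 1\<^sub>m n
    \<longleftrightarrow> g $$ (0, 1) * b - d * g $$ (n - 2, n - 1) = 0"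
  unfolding comm_second_central[OF n g] using n by (intro tv_eq_one_iff) auto

lemma comm_corner_one:
  fixes h :: "'a::field mat"
  assumes "4 \<le> n" "h \<in> UT n"
  shows "comm h (tv n 0 (n - 1) a) = 1\<^sub>m n"
proof -
  have "tv n 0 (n - 1) a = colm n (\<lambda>i. if i = 0 then a else if i = 1 then 0 else 0) 0"
    unfolding colm_eq_tv[OF assms(1), symmetric] by (intro colm_eqI) auto
  then show ?thesis
    using comm_second_central[OF assms, of a 0 0] tv_eq_one_iff[of 0 "n - 1" n 0] assms by simp
qed

lemma second_central_colm:
  fixes a b d :: "'a::field"
  assumes "4 \<le> n"
  shows "second_central n (colm n (\<lambda>i. if i = 0 then a else if i = 1 then b else 0) d)"
  unfolding second_central_def
proof (intro ballI)
  fix g h :: "'a mat" assume "g \<in> UT n" "h \<in> UT n"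
  then show "comm h (comm g (colm n (\<lambda>i. if i = 0 then a else if i = 1 then b else 0) d)) = 1\<^sub>m n"
    unfolding comm_second_central[OF assms \<open>g \<in> UT n\<close>] by (intro comm_corner_one[OF assms])
qed

section \<open>Transport of good elements by a PC-map\<close>

lemma PC_map_conj_commuting:
  fixes \<phi> :: "'a::field mat \<Rightarrow> 'a mat"
  assumes "PC_map n \<phi>" "x \<in> UT n" "conj_commuting n x"
  shows "conj_commuting n (\<phi> x)"
  unfolding conj_commuting_def
proof
  fix g :: "'a mat" assume "g \<in> UT n"
  note D = PC_mapD[OF assms(1)]
  obtain h where h: "h \<in> UT n" "\<phi> h = g" using D(4) \<open>g \<in> UT n\<close> by blast
  have "comm x (comm h x) = 1\<^sub>m n" using assms h by (auto simp: conj_commuting_def)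
  then show "comm (\<phi> x) (comm g (\<phi> x)) = 1\<^sub>m n"
    using h D(2)[OF h(1) assms(2)] PC_map_comm_one_iff[OF assms(1,2) comm_UT[OF h(1) assms(2)]] by simp
qed

lemma PC_map_second_central:
  fixes u :: "'a::field mat"
  assumes "PC_map n \<phi>" "u \<in> UT n"
  shows "second_central n (\<phi> u) \<longleftrightarrow> second_central n u"
proof -
  note D = PC_mapD[OF assms(1)]
  have c: "comm (\<phi> h) (comm (\<phi> g) (\<phi> u)) = 1\<^sub>m n \<longleftrightarrow> comm h (comm g u) = 1\<^sub>m n"
    if "g \<in> UT n" "h \<in> UT n" for g h
    using PC_map_comm_one_iff[OF assms(1) that(2) comm_UT[OF that(1) assms(2)]] D(2)[OF that(1) assms(2)] by simp
  have "second_central n (\<phi> u) \<longleftrightarrow> (\<forall>g\<in>UT n. \<forall>h\<in>UT n. comm (\<phi> h) (comm (\<phi> g) (\<phi> u)) = 1\<^sub>m n)"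
    unfolding second_central_def by (metis D(1,4))
  then show ?thesis using c by (simp add: second_central_def)
qed

text \<open>On good elements this relation has the two classes \<open>K1\<close> and
  \<open>K2\<close>, so a PC-map may exchange them but cannot mix them.\<close>

definition same_Z2_centralizer :: "nat \<Rightarrow> 'a::field mat \<Rightarrow> 'a mat \<Rightarrow> bool" where
  "same_Z2_centralizer n x y \<longleftrightarrow>
     (\<forall>u\<in>UT n. second_central n u \<longrightarrow> (comm x u = 1\<^sub>m n \<longleftrightarrow> comm y u = 1\<^sub>m n))"

lemma PC_map_same_Z2_centralizer:
  fixes x :: "'a::field mat"
  assumes "PC_map n \<phi>" "x \<in> UT n" "y \<in> UT n"
  shows "same_Z2_centralizer n (\<phi> x) (\<phi> y) \<longleftrightarrow> same_Z2_centralizer n x y"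
proof -
  note D = PC_mapD[OF assms(1)]
  have "same_Z2_centralizer n (\<phi> x) (\<phi> y) \<longleftrightarrow> (\<forall>u\<in>UT n. second_central n (\<phi> u) \<longrightarrow>
      (comm (\<phi> x) (\<phi> u) = 1\<^sub>m n \<longleftrightarrow> comm (\<phi> y) (\<phi> u) = 1\<^sub>m n))"
    unfolding same_Z2_centralizer_def by (metis D(1,4))
  also have "\<dots> \<longleftrightarrow> same_Z2_centralizer n x y"
    unfolding same_Z2_centralizer_def
    using PC_map_comm_one_iff[OF assms(1)] PC_map_second_central[OF assms(1)] assms(2,3) by simp
  finally show ?thesis .
qed

text \<open>An element of \<open>K1\<close> centralises a second central element exactly when
  \<open>b = 0\<close>, one of \<open>K2\<close> exactly when \<open>d = 0\<close>.\<close>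

lemma same_Z2_centralizer_K:
  fixes x y :: "'a::field mat"
  assumes n: "4 \<le> n"
  shows "x \<in> K1 n \<Longrightarrow> y \<in> K1 n \<Longrightarrow> same_Z2_centralizer n x y"
    and "x \<in> K2 n \<Longrightarrow> y \<in> K2 n \<Longrightarrow> same_Z2_centralizer n x y"
    and "x \<in> K1 n \<Longrightarrow> y \<in> K2 n \<Longrightarrow> \<not> same_Z2_centralizer n x y"
proof -
  note K1D = K1_D[OF n] and K2D = K2_D[OF n]
  note one = comm_second_central_one[OF n]
  show "same_Z2_centralizer n x y" if "x \<in> K1 n" "y \<in> K1 n"
    unfolding same_Z2_centralizer_def
  proof (intro ballI impI)
    fix u :: "'a mat" assume "u \<in> UT n" "second_central n u"
    then obtain a b d where "u = colm n (\<lambda>i. if i = 0 then a else if i = 1 then b else 0) d"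
      using second_central_form[OF n] by blast
    then show "comm x u = 1\<^sub>m n \<longleftrightarrow> comm y u = 1\<^sub>m n"
      using that K1D[of x] K1D[of y] one[of x] one[of y] by simp
  qed
  show "same_Z2_centralizer n x y" if "x \<in> K2 n" "y \<in> K2 n"
    unfolding same_Z2_centralizer_def
  proof (intro ballI impI)
    fix u :: "'a mat" assume "u \<in> UT n" "second_central n u"
    then obtain a b d where "u = colm n (\<lambda>i. if i = 0 then a else if i = 1 then b else 0) d"
      using second_central_form[OF n] by blast
    then show "comm x u = 1\<^sub>m n \<longleftrightarrow> comm y u = 1\<^sub>m n"
      using that K2D[of x] K2D[of y] one[of x] one[of y] by simp
  qed
  show "\<not> same_Z2_centralizer n x y" if "x \<in> K1 n" "y \<in> K2 n"
  proof
    let ?u = "colm n (\<lambda>i. if i = 0 then 0 else if i = 1 then 1 else 0) 0 :: 'a mat"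
    have u: "?u \<in> UT n" using n by (intro colm_UT) auto
    assume "same_Z2_centralizer n x y"
    then have "comm x ?u = 1\<^sub>m n \<longleftrightarrow> comm y ?u = 1\<^sub>m n"
      using u second_central_colm[OF n, of 0 1 0] unfolding same_Z2_centralizer_def by blast
    then show False
      using that K1D[of x] K2D[of y] one[of x 0 1 0] one[of y 0 1 0] by simp
  qed
qed

lemma PC_map_K1_Un_K2:
  fixes \<phi> :: "'a::field mat \<Rightarrow> 'a mat"
  assumes n: "4 \<le> n" and two: "(2::'a) \<noteq> 0" and \<phi>: "PC_map n \<phi>" and x: "x \<in> K1 n \<union> K2 n"
  shows "\<phi> x \<in> K1 n \<union> K2 n"
proof -
  note D = PC_mapD[OF \<phi>]
  have xU: "x \<in> UT n" and a: "conj_commuting n x"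
    and ne: "x $$ (0, 1) \<noteq> 0 \<or> x $$ (n - 2, n - 1) \<noteq> 0"
    using x K1_D[OF n, of x] K2_D[OF n, of x] by auto
  note one = comm_second_central_one[OF n]
  obtain u where u: "u \<in> UT n" "second_central n u" "comm x u \<noteq> 1\<^sub>m n"
  proof -
    \<comment> \<open>The two coordinate directions of the second centre detect the first and the
      last superdiagonal entry of \<open>x\<close>.\<close>
    let ?u = "\<lambda>b d. colm n (\<lambda>i. if i = 0 then 0 else if i = 1 then b else 0) d :: 'a mat"
    have "?u b d \<in> UT n" "second_central n (?u b d)" for b d
      using n second_central_colm[OF n, of 0 b d] by (auto intro!: colm_UT)
    moreover have "comm x (?u 1 0) \<noteq> 1\<^sub>m n \<or> comm x (?u 0 1) \<noteq> 1\<^sub>m n"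
      using one[OF xU, of 0 1 0] one[OF xU, of 0 0 1] ne by auto
    ultimately show ?thesis using that by blast
  qed
  have "comm (\<phi> x) (\<phi> u) \<noteq> 1\<^sub>m n" "second_central n (\<phi> u)" "\<phi> u \<in> UT n"
    using u PC_map_comm_one_iff[OF \<phi> xU u(1)] PC_map_second_central[OF \<phi> u(1)] D(1) by auto
  then have "\<phi> x $$ (0, 1) \<noteq> 0 \<or> \<phi> x $$ (n - 2, n - 1) \<noteq> 0"
    using second_central_form[OF n, of "\<phi> u"] one[OF D(1)[OF xU]] by auto
  then show ?thesis
    using conj_commuting_K1[OF n two] conj_commuting_K2[OF n two]
      D(1)[OF xU] PC_map_conj_commuting[OF \<phi> xU a] by blast
qed

lemma PC_map_K1_K2_cases:
  fixes \<phi> :: "'a::field mat \<Rightarrow> 'a mat"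
  assumes n: "4 \<le> n" and two: "(2::'a) \<noteq> 0" and \<phi>: "PC_map n \<phi>"
  shows "(\<phi> ` K1 n \<subseteq> K1 n \<and> \<phi> ` K2 n \<subseteq> K2 n) \<or> (\<phi> ` K1 n \<subseteq> K2 n \<and> \<phi> ` K2 n \<subseteq> K1 n)"
proof -
  note same = same_Z2_centralizer_K[OF n] and img = PC_map_K1_Un_K2[OF n two \<phi>]
    and pres = PC_map_same_Z2_centralizer[OF \<phi>]
  have U: "x \<in> K1 n \<union> K2 n \<Longrightarrow> x \<in> UT n" for x :: "'a mat" using K1_D[OF n] K2_D[OF n] by blast
  have sym: "same_Z2_centralizer n x y \<longleftrightarrow> same_Z2_centralizer n y x" for x y :: "'a mat"
    unfolding same_Z2_centralizer_def by auto
  \<comment> \<open>One test element decides the case: the class of its image determines the classes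
    of all other images.\<close>
  let ?x = "rowm n (\<lambda>j. if j = 1 then 1 else 0) 0 :: 'a mat"
  have x: "?x \<in> K1 n" by (rule K1_I) auto
  have k1: "same_Z2_centralizer n (\<phi> ?x) (\<phi> y)" if "y \<in> K1 n" for y
    using same(1)[OF x that] pres U x that by blast
  have k2: "\<not> same_Z2_centralizer n (\<phi> ?x) (\<phi> y)" if "y \<in> K2 n" for y
    using same(3)[OF x that] pres U x that by blast
  consider "\<phi> ?x \<in> K1 n" | "\<phi> ?x \<in> K2 n" using img x by blast
  then show ?thesis
  proof cases
    case 1
    have "\<phi> y \<in> K1 n" if "y \<in> K1 n" for y using img[of y] k1[OF that] same(3)[OF 1] that by blast
    moreover have "\<phi> y \<in> K2 n" if "y \<in> K2 n" for y using img[of y] k2[OF that] same(1)[OF 1] that by blast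
    ultimately show ?thesis by blast
  next
    case 2
    have "\<phi> y \<in> K2 n" if "y \<in> K1 n" for y using img[of y] k1[OF that] same(3)[OF _ 2] that sym by blast
    moreover have "\<phi> y \<in> K1 n" if "y \<in> K2 n" for y using img[of y] k2[OF that] same(2)[OF 2] that by blast
    ultimately show ?thesis by blast
  qed
qed

section \<open>The graph automorphism, as inversion followed by reflection in the
  anti-diagonal\<close>

definition flip :: "nat \<Rightarrow> 'a mat \<Rightarrow> 'a mat" where
  "flip n a = mat n n (\<lambda>(i, j). a $$ (n - 1 - j, n - 1 - i))"

lemma flip_carrier [simp]: "flip n a \<in> carrier_mat n n"
  by (simp add: flip_def)

lemma flip_entry: "i < n \<Longrightarrow> j < n \<Longrightarrow> flip n a $$ (i, j) = a $$ (n - 1 - j, n - 1 - i)"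
  by (simp add: flip_def)

lemma flip_mult:
  fixes a b :: "'a::field mat"
  assumes "a \<in> carrier_mat n n" "b \<in> carrier_mat n n"
  shows "flip n (a * b) = flip n b * flip n a"
proof (rule mat_eqI)
  fix i j assume ij: "i < n" "j < n"
  have ij': "n - 1 - j < n" "n - 1 - i < n" using ij by auto
  have "(\<Sum>k<n. a $$ (n - 1 - j, k) * b $$ (k, n - 1 - i))
      = (\<Sum>k<n. a $$ (n - 1 - j, n - Suc k) * b $$ (n - Suc k, n - 1 - i))"
    by (rule sum.nat_diff_reindex[symmetric])
  also have "\<dots> = (\<Sum>k<n. flip n b $$ (i, k) * flip n a $$ (k, j))"
    using ij by (intro sum.cong refl) (simp add: flip_entry mult.commute)
  finally show "flip n (a * b) $$ (i, j) = (flip n b * flip n a) $$ (i, j)"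
    unfolding flip_entry[OF ij] mat_mult_entry[OF assms ij'] mat_mult_entry[OF flip_carrier flip_carrier ij] .
qed (auto intro: sq_mult_carrier)

lemma flip_UT: "a \<in> UT n \<Longrightarrow> flip n a \<in> UT n"
  by (rule UT_I) (auto simp: flip_entry UT_diag UT_lower)

lemma flip_flip: "a \<in> carrier_mat n n \<Longrightarrow> flip n (flip n a) = a"
  by (rule mat_eqI[of _ n]) (auto simp: flip_entry)

lemma flip_minv:
  fixes a :: "'a::field mat"
  assumes a: "a \<in> UT n"
  shows "minv (flip n a) = flip n (minv a)"
proof (rule minv_unique)
  have "flip n (1\<^sub>m n) = (1\<^sub>m n :: 'a mat)"
    by (rule mat_eqI[of _ n]) (auto simp: flip_entry)
  then show "flip n a * flip n (minv a) = 1\<^sub>m n"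
    using flip_mult[of "minv a" n a] UT_minv[OF a] a by (auto simp: UT_carrier)
qed auto

lemma UT_minv_mult:
  fixes a b :: "'a::field mat"
  assumes a: "a \<in> UT n" and b: "b \<in> UT n"
  shows "minv (a * b) = minv b * minv a"
proof (rule minv_unique)
  note c = UT_carrier[OF a] UT_carrier[OF b] UT_carrier[OF UT_minv(1)[OF a]] UT_carrier[OF UT_minv(1)[OF b]]
  show "a * b \<in> carrier_mat n n" "minv b * minv a \<in> carrier_mat n n" using c by (auto intro: sq_mult_carrier)
  have "a * b * (minv b * minv a) = a * ((b * minv b) * minv a)"
    using c by (simp add: assoc_mult_mat[of _ n n _ n _ n])
  then show "a * b * (minv b * minv a) = 1\<^sub>m n"
    using c UT_minv[OF a] UT_minv[OF b] by simp
qed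

text \<open>Inversion and reflection both reverse products, so their composite preserves them; since
  the two commute, it is an involution.\<close>

lemma graph_PC: "PC_map n (\<lambda>a :: 'a::field mat. flip n (minv a))"
  and graph_involution: "\<And>a :: 'a mat. a \<in> UT n \<Longrightarrow> flip n (minv (flip n (minv a))) = a"
proof -
  show inv: "flip n (minv (flip n (minv a))) = a" if "a \<in> UT n" for a :: "'a mat"
    using that by (simp add: flip_minv UT_minv(1) flip_flip UT_carrier minv_minv[OF UT_subset_TT])
  show "PC_map n (\<lambda>a :: 'a::field mat. flip n (minv a))"
    by (rule automorphism_PC[where k = "\<lambda>a. flip n (minv a)"])
      (simp_all add: flip_UT UT_minv(1) inv UT_minv_mult flip_mult UT_carrier)
qed

text \<open>Multiplication by the anti-diagonal matrix reverses rows from the left and columns from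
  the right, and that matrix is its own inverse.\<close>

lemma graph_aut_flip: "graph_aut n (\<lambda>a :: 'a::field mat. flip n (minv a))"
  unfolding graph_aut_def
proof (intro disjI2 ballI)
  fix a :: "'a mat" assume a: "a \<in> UT n"
  let ?w = "antidiag n :: 'a mat" and ?b = "(minv a)\<^sup>T"
  note ac = UT_carrier[OF a] and bc = UT_carrier[OF UT_minv(1)[OF a]]
  have wc: "?w \<in> carrier_mat n n" by (simp add: antidiag_def)
  have we: "?w $$ (i, j) = (if j = n - 1 - i then 1 else 0)" "?w $$ (i, j) = (if i = n - 1 - j then 1 else 0)"
    if "i < n" "j < n" for i j
    using that by (auto simp: antidiag_def)
  have tc: "?b \<in> carrier_mat n n" using bc by simp
  have L: "(?w * m) $$ (i, j) = m $$ (n - 1 - i, j)" if "m \<in> carrier_mat n n" "i < n" "j < n" for m i j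
  proof -
    have "(?w * m) $$ (i, j) = (\<Sum>k<n. (if k = n - 1 - i then 1 else 0) * m $$ (k, j))"
      unfolding mat_mult_entry[OF wc that] using that by (intro sum.cong refl) (simp add: we(1))
    then show ?thesis using that by (simp only: sum_delta_mult) simp
  qed
  have R: "(m * ?w) $$ (i, j) = m $$ (i, n - 1 - j)" if "m \<in> carrier_mat n n" "i < n" "j < n" for m i j
  proof -
    have "(m * ?w) $$ (i, j) = (\<Sum>k<n. m $$ (i, k) * (if k = n - 1 - j then 1 else 0))"
      unfolding mat_mult_entry[OF that(1) wc that(2,3)] using that by (intro sum.cong refl) (simp add: we(2))
    then show ?thesis using that by (simp only: sum_delta_mult) simp
  qed
  have "?w * ?w = 1\<^sub>m n"
    using wc by (intro mat_eqI[of _ n]) (auto simp: L[OF wc] we(1) simp del: index_mult_mat)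
  then have w: "minv ?w = ?w" by (rule minv_unique[OF wc wc])
  have "a\<^sup>T * ?b = 1\<^sub>m n"
    using transpose_mult[OF bc ac] UT_minv(3)[OF a] by simp
  then have t: "minv a\<^sup>T = ?b" using minv_unique[of "a\<^sup>T" n ?b] ac tc by simp
  have wb: "?w * ?b \<in> carrier_mat n n" using wc tc by (rule mult_carrier_mat)
  show "flip n (minv a) = ?w * minv a\<^sup>T * minv ?w"
    unfolding t w
  proof (rule mat_eqI[OF flip_carrier mult_carrier_mat[OF wb wc]])
    fix i j assume ij: "i < n" "j < n"
    then show "flip n (minv a) $$ (i, j) = (?w * ?b * ?w) $$ (i, j)"
      using R[OF wb ij] L[OF tc ij(1), of "n - 1 - j"] bc by (simp add: flip_entry)
  qed
qed

lemma minv_superdiag: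
  fixes a :: "'a::field mat"
  assumes a: "a \<in> UT n" and i: "Suc i < n"
  shows "minv a $$ (i, Suc i) = - a $$ (i, Suc i)"
proof -
  let ?m = "minv a"
  note m = UT_minv(1)[OF a] and i' = Suc_lessD[OF i]
  have "(\<Sum>k<n. a $$ (i, k) * ?m $$ (k, Suc i)) = (\<Sum>k<n. (if k = i then ?m $$ (i, Suc i) else 0)
      + (if k = Suc i then a $$ (i, Suc i) else 0))"
  proof (rule sum.cong[OF refl])
    fix k assume k: "k \<in> {..<n}"
    consider "k < i" | "k = i" | "k = Suc i" | "Suc i < k" by linarith
    then show "a $$ (i, k) * ?m $$ (k, Suc i) = (if k = i then ?m $$ (i, Suc i) else 0)
      + (if k = Suc i then a $$ (i, Suc i) else 0)"
      using k i i' UT_lower[OF a, of k i] UT_diag[OF a, of i] UT_lower[OF m, of "Suc i" k] UT_diag[OF m, of "Suc i"]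
      by cases auto
  qed
  then have "(a * ?m) $$ (i, Suc i) = ?m $$ (i, Suc i) + a $$ (i, Suc i)"
    unfolding mat_mult_entry[OF UT_carrier[OF a] UT_carrier[OF m] i' i] using i by (simp add: sum.distrib)
  then show ?thesis using UT_minv(2)[OF a] i by (simp add: eq_neg_iff_add_eq_0)
qed

text \<open>The classification of good elements saves computing the inverse: goodness is
  transported, and one superdiagonal entry of the image tells its kind.\<close>

lemma graph_K:
  fixes x :: "'a::field mat"
  assumes n: "4 \<le> n" and two: "(2::'a) \<noteq> 0"
  shows "x \<in> K1 n \<Longrightarrow> flip n (minv x) \<in> K2 n" "x \<in> K2 n \<Longrightarrow> flip n (minv x) \<in> K1 n"
proof -
  have s: "Suc (n - 2) = n - 1" "n - 1 - (n - 1) = 0" "n - 1 - (n - 2) = 1" "n - 1 - 0 = n - 1" "n - 1 - 1 = n - 2"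
    using n by auto
  show "flip n (minv x) \<in> K2 n" if "x \<in> K1 n"
  proof (rule conj_commuting_K2[OF n two])
    note x = K1_D[OF n that]
    show "flip n (minv x) \<in> UT n" "conj_commuting n (flip n (minv x))"
      using x PC_mapD(1)[OF graph_PC x(1)] PC_map_conj_commuting[OF graph_PC x(1,4)] by auto
    show "flip n (minv x) $$ (n - 2, n - 1) \<noteq> 0"
      using flip_entry[of "n - 2" n "n - 1" "minv x"] minv_superdiag[OF x(1), of 0] x(2) n s by simp
  qed
  show "flip n (minv x) \<in> K1 n" if "x \<in> K2 n"
  proof (rule conj_commuting_K1[OF n two])
    note x = K2_D[OF n that]
    show "flip n (minv x) \<in> UT n" "conj_commuting n (flip n (minv x))"
      using x PC_mapD(1)[OF graph_PC x(1)] PC_map_conj_commuting[OF graph_PC x(1,4)] by auto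
    show "flip n (minv x) $$ (0, 1) \<noteq> 0"
      using flip_entry[of 0 n 1 "minv x"] minv_superdiag[OF x(1), of "n - 2"] x(2) n s by simp
  qed
qed

section \<open>The pairing of rows and columns\<close>

text \<open>A bijection \<open>\<zeta>\<close> carrying a perfect pairing in dimension at least two to itself is a field
  automorphism up to a scalar. Choosing \<open>X i\<close>, \<open>Y i\<close> whose images are the standard basis vectors gives
  \<open>\<zeta> \<langle>x, y\<rangle> = (\<Sum>i. \<zeta> \<langle>x, Y i\<rangle> * \<zeta> \<langle>X i, y\<rangle>)\<close>; with two nonzero summands this yields
  additivity, with one it yields multiplicativity.\<close>

lemma pairing_semilinear:
  fixes \<zeta> :: "'a::field \<Rightarrow> 'a" and p :: "'x \<Rightarrow> nat \<Rightarrow> 'a" and q :: "'y \<Rightarrow> nat \<Rightarrow> 'a"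
  assumes I: "finite I" "i1 \<in> I" "i2 \<in> I" "i1 \<noteq> i2"
    and p: "\<And>v. \<exists>x\<in>D. \<forall>i\<in>I. p x i = v i" and p': "\<And>v. \<exists>x\<in>D. \<forall>i\<in>I. p (\<phi> x) i = v i"
    and q: "\<And>v. \<exists>y\<in>E. \<forall>i\<in>I. q y i = v i" and q': "\<And>v. \<exists>y\<in>E. \<forall>i\<in>I. q (\<phi>' y) i = v i"
    and bij: "bij \<zeta>"
    and pair: "\<And>x y. x \<in> D \<Longrightarrow> y \<in> E \<Longrightarrow> (\<Sum>i\<in>I. p (\<phi> x) i * q (\<phi>' y) i) = \<zeta> (\<Sum>i\<in>I. p x i * q y i)"
  obtains \<theta> \<kappa> T T' where "field_automorphism \<theta>" "\<kappa> \<noteq> 0"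
    "\<And>x i. x \<in> D \<Longrightarrow> i \<in> I \<Longrightarrow> p (\<phi> x) i = (\<Sum>j\<in>I. \<theta> (p x j) * T j i)"
    "\<And>y i. y \<in> E \<Longrightarrow> i \<in> I \<Longrightarrow> q (\<phi>' y) i = (\<Sum>j\<in>I. T' i j * \<theta> (q y j))"
    "\<And>i j. i \<in> I \<Longrightarrow> j \<in> I \<Longrightarrow> (\<Sum>k\<in>I. T i k * T' k j) = (if i = j then \<kappa> else 0)"
proof -
  let ?e = "\<lambda>i j. if j = i then 1 else 0 :: 'a"
  let ?B = "\<lambda>x y. \<Sum>i\<in>I. p x i * q y i"
  have delta: "(\<Sum>j\<in>I. ?e i j * f j) = f i" "(\<Sum>j\<in>I. f j * ?e i j) = f i" if "i \<in> I" for f i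
    using that I by (simp_all add: if_distrib[of "\<lambda>x. x * _"] if_distrib[of "\<lambda>x. _ * x"] cong: if_cong)
  \<comment> \<open>Preimages of the standard bases: pairing with \<open>Y i\<close> reads
    coordinate i of an image row, pairing with \<open>X i\<close> that of an image column.\<close>
  obtain X where X: "\<And>i. X i \<in> D" "\<And>i j. j \<in> I \<Longrightarrow> p (\<phi> (X i)) j = ?e i j"
    using p'[of "?e _"] by metis
  obtain Y where Y: "\<And>i. Y i \<in> E" "\<And>i j. j \<in> I \<Longrightarrow> q (\<phi>' (Y i)) j = ?e i j"
    using q'[of "?e _"] by metis
  have px: "p (\<phi> x) i = \<zeta> (?B x (Y i))" if "x \<in> D" "i \<in> I" for x i
  proof -
    have "(\<Sum>j\<in>I. p (\<phi> x) j * q (\<phi>' (Y i)) j) = (\<Sum>j\<in>I. p (\<phi> x) j * ?e i j)"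
      using Y(2) by (intro sum.cong) auto
    then show ?thesis using pair[OF that(1) Y(1)] delta(2)[OF that(2)] by simp
  qed
  have qy: "q (\<phi>' y) i = \<zeta> (?B (X i) y)" if "y \<in> E" "i \<in> I" for y i
  proof -
    have "(\<Sum>j\<in>I. p (\<phi> (X i)) j * q (\<phi>' y) j) = (\<Sum>j\<in>I. ?e i j * q (\<phi>' y) j)"
      using X(2) by (intro sum.cong) auto
    then show ?thesis using pair[OF X(1) that(1)] delta(1)[OF that(2)] by simp
  qed
  have expand: "\<zeta> (?B x y) = (\<Sum>i\<in>I. \<zeta> (?B x (Y i)) * \<zeta> (?B (X i) y))" if "x \<in> D" "y \<in> E" for x y
    using pair[OF that] px[OF that(1)] qy[OF that(2)] by simp
  have z0: "\<zeta> 0 = 0"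
  proof -
    obtain x where x: "x \<in> D" "\<forall>i\<in>I. p (\<phi> x) i = 0" using p'[of "\<lambda>_. 0"] by blast
    obtain y where y: "y \<in> E" "\<forall>i\<in>I. q y i = 0" using q[of "\<lambda>_. 0"] by blast
    show ?thesis using pair[OF x(1) y(1)] x y by simp
  qed
  \<comment> \<open>The families \<open>X\<close> and \<open>Y\<close> will turn out to be dual
    bases up to this scalar.\<close>
  obtain \<omega> where \<omega>: "\<zeta> \<omega> = 1" using bij by (metis bij_pointE)
  have \<omega>0: "\<omega> \<noteq> 0" using z0 \<omega> by auto
  have inj: "\<zeta> a = \<zeta> b \<longleftrightarrow> a = b" for a b using bij by (metis bij_pointE)
  have XY: "?B (X i) (Y j) = (if i = j then \<omega> else 0)" if "i \<in> I" "j \<in> I" for i j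
  proof -
    have "\<zeta> (?B (X i) (Y j)) = ?e i j" using px[OF X(1) that(2), of i] X(2)[OF that(2)] by simp
    then have "\<zeta> (?B (X i) (Y j)) = \<zeta> (if i = j then \<omega> else 0)" using \<omega> z0 by auto
    then show ?thesis using inj by simp
  qed
  \<comment> \<open>Dividing the test row by \<open>\<omega>\<close> makes its pairings with
    \<open>Y i1\<close> and \<open>Y i2\<close> equal to \<open>a\<close> and \<open>a'\<close>, and
    with the other \<open>Y i\<close> equal to 0; the test column is built likewise from
    \<open>b\<close> and \<open>b'\<close>.\<close>
  have two: "\<zeta> ((a * b + a' * b') / \<omega>) = \<zeta> a * \<zeta> b + \<zeta> a' * \<zeta> b'" for a b a' b'
  proof -
    obtain x where x: "x \<in> D" "\<And>i. i \<in> I \<Longrightarrow> p x i = (a * p (X i1) i + a' * p (X i2) i) / \<omega>"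
      using p[of "\<lambda>i. (a * p (X i1) i + a' * p (X i2) i) / \<omega>"] by blast
    obtain y where y: "y \<in> E" "\<And>i. i \<in> I \<Longrightarrow> q y i = (b * q (Y i1) i + b' * q (Y i2) i) / \<omega>"
      using q[of "\<lambda>i. (b * q (Y i1) i + b' * q (Y i2) i) / \<omega>"] by blast
    have Bx: "?B x z = (a * ?B (X i1) z + a' * ?B (X i2) z) / \<omega>" for z
    proof -
      have "?B x z = (\<Sum>i\<in>I. (a * (p (X i1) i * q z i) + a' * (p (X i2) i * q z i)) / \<omega>)"
        using x(2) by (intro sum.cong) (auto simp: algebra_simps)
      then show ?thesis by (simp add: sum_divide_distrib[symmetric] sum.distrib sum_distrib_left)
    qed
    have By: "?B z y = (b * ?B z (Y i1) + b' * ?B z (Y i2)) / \<omega>" for z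
    proof -
      have "?B z y = (\<Sum>i\<in>I. (b * (p z i * q (Y i1) i) + b' * (p z i * q (Y i2) i)) / \<omega>)"
        using y(2) by (intro sum.cong) (auto simp: algebra_simps)
      then show ?thesis by (simp add: sum_divide_distrib[symmetric] sum.distrib sum_distrib_left)
    qed
    have xY: "?B x (Y i) = (if i = i1 then a else if i = i2 then a' else 0)" if "i \<in> I" for i
      unfolding Bx using that I \<omega>0 by (auto simp: XY)
    have Xy: "?B (X i) y = (if i = i1 then b else if i = i2 then b' else 0)" if "i \<in> I" for i
      unfolding By using that I \<omega>0 by (auto simp: XY)
    have xy: "?B x y = (a * b + a' * b') / \<omega>"
      unfolding Bx using Xy[OF I(2)] Xy[OF I(3)] I(4) by simp
    have "(\<Sum>i\<in>I. \<zeta> (?B x (Y i)) * \<zeta> (?B (X i) y))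
        = (\<Sum>i\<in>I. (if i = i1 then \<zeta> a * \<zeta> b else 0) + (if i = i2 then \<zeta> a' * \<zeta> b' else 0))"
      using I(4) by (intro sum.cong) (auto simp: xY Xy z0)
    also have "\<dots> = \<zeta> a * \<zeta> b + \<zeta> a' * \<zeta> b'"
      using I by (simp add: sum.distrib)
    finally show ?thesis using expand[OF x(1) y(1)] xy by simp
  qed
  \<comment> \<open>Rescaling the argument gives \<open>\<theta> 1 = 1\<close>. Multiplicativity is
    \<open>two\<close> with one summand, additivity is \<open>two\<close> with
    \<open>b = b' = \<omega>\<close>, where \<open>\<zeta>\<close> takes the value 1.\<close>
  define \<theta> where "\<theta> a = \<zeta> (a * \<omega>)" for a
  have mult: "\<theta> (a * b) = \<theta> a * \<theta> b" for a b
    using two[of "a * \<omega>" "b * \<omega>" 0 0] \<omega>0 z0 by (simp add: \<theta>_def mult.assoc mult.left_commute)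
  have add: "\<theta> (a + b) = \<theta> a + \<theta> b" for a b
    using two[of "a * \<omega>" \<omega> "b * \<omega>" \<omega>] \<omega>0 \<omega> by (simp add: \<theta>_def add_divide_distrib distrib_right)
  have "bij (\<lambda>a. a * \<omega>)"
    using \<omega>0 by (intro bij_betw_byWitness[where f' = "\<lambda>a. a / \<omega>"]) auto
  then have "bij \<theta>"
    using bij_comp[of "\<lambda>a. a * \<omega>" \<zeta>] bij by (simp add: \<theta>_def[abs_def] comp_def)
  moreover have "\<theta> 1 = 1" using \<omega> by (simp add: \<theta>_def)
  ultimately have \<theta>: "field_automorphism \<theta>"
    using mult add by (simp add: field_automorphism_def)
  note \<theta>s = field_aut_simps[OF \<theta>]
  define \<kappa> where "\<kappa> = \<zeta> 1"
  have \<kappa>0: "\<kappa> \<noteq> 0" using inj[of 1 0] z0 by (simp add: \<kappa>_def)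
  have \<zeta>: "\<zeta> a = \<kappa> * \<theta> a" for a
    using mult[of "1 / \<omega>" a] \<omega>0 by (simp add: \<theta>_def \<kappa>_def)
  define T where "T j i = \<kappa> * \<theta> (q (Y i) j)" for j i
  define T' where "T' i j = \<kappa> * \<theta> (p (X i) j)" for i j
  have P: "p (\<phi> x) i = (\<Sum>j\<in>I. \<theta> (p x j) * T j i)" if "x \<in> D" "i \<in> I" for x i
    using px[OF that] by (simp add: \<zeta> \<theta>s(4,7) T_def sum_distrib_left mult.left_commute)
  have Q: "q (\<phi>' y) i = (\<Sum>j\<in>I. T' i j * \<theta> (q y j))" if "y \<in> E" "i \<in> I" for y i
    using qy[OF that] by (simp add: \<zeta> \<theta>s(4,7) T'_def sum_distrib_left mult.assoc)
  \<comment> \<open>Invariance of the pairing, tested on unit vectors.\<close>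
  have TT: "(\<Sum>k\<in>I. T i k * T' k j) = (if i = j then \<kappa> else 0)" if ij: "i \<in> I" "j \<in> I" for i j
  proof -
    obtain x where x: "x \<in> D" "\<And>k. k \<in> I \<Longrightarrow> p x k = ?e i k" using p[of "?e i"] by blast
    obtain y where y: "y \<in> E" "\<And>k. k \<in> I \<Longrightarrow> q y k = ?e j k" using q[of "?e j"] by blast
    have "p (\<phi> x) k = T i k" if "k \<in> I" for k
    proof -
      have "(\<Sum>l\<in>I. \<theta> (p x l) * T l k) = (\<Sum>l\<in>I. ?e i l * T l k)"
        using x(2) \<theta>s(1,2) by (intro sum.cong) auto
      then show ?thesis using P[OF x(1) that] delta(1)[OF ij(1)] by simp
    qed
    moreover have "q (\<phi>' y) k = T' k j" if "k \<in> I" for k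
    proof -
      have "(\<Sum>l\<in>I. T' k l * \<theta> (q y l)) = (\<Sum>l\<in>I. T' k l * ?e j l)"
        using y(2) \<theta>s(1,2) by (intro sum.cong) auto
      then show ?thesis using Q[OF y(1) that] delta(2)[OF ij(2)] by simp
    qed
    moreover have "?B x y = (if i = j then 1 else 0)"
    proof -
      have "?B x y = (\<Sum>k\<in>I. ?e i k * q y k)" using x(2) by (intro sum.cong) auto
      then show ?thesis using delta(1)[OF ij(1)] y(2)[OF ij(1)] by simp
    qed
    ultimately show ?thesis using pair[OF x(1) y(1)] z0 by (simp add: \<kappa>_def)
  qed
  show thesis by (rule that[OF \<theta> \<kappa>0 P Q TT])
qed

section \<open>Domains of the pairing\<close>

definition D1 :: "nat \<Rightarrow> 'a::field mat set" where
  "D1 n = {rowm n r c | r c. r 0 = 0 \<and> (r 1 = 0 \<longrightarrow> c = 0)}"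

definition D2 :: "nat \<Rightarrow> 'a::field mat set" where
  "D2 n = {colm n s d | s d. s (n - 1) = 0 \<and> (s (n - 2) = 0 \<longrightarrow> d = 0)}"

definition R1 :: "nat \<Rightarrow> 'a::field mat set" where
  "R1 n = {rowm n r 0 | r. r 0 = 0 \<and> r 1 = 0}"

definition R2 :: "nat \<Rightarrow> 'a::field mat set" where
  "R2 n = {colm n s 0 | s. s (n - 1) = 0 \<and> s (n - 2) = 0}"

text \<open>\<open>D1\<close> realises every first row and is still described by commutators, since
  \<open>R1\<close> is a centraliser. Row elements with \<open>r 1 = 0\<close> and nonzero hidden
  entry are excluded: they are neither good nor in \<open>R1\<close>.\<close>

lemma D1_eq: "D1 n = K1 n \<union> R1 n"
  by (auto simp: D1_def K1_def R1_def)

lemma D2_eq: "D2 n = K2 n \<union> R2 n"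
  by (auto simp: D2_def K2_def R2_def)

lemma D1_I: "r 0 = 0 \<Longrightarrow> (r 1 = 0 \<longrightarrow> c = 0) \<Longrightarrow> rowm n r c \<in> D1 n"
  by (auto simp: D1_def)

lemma D2_I: "s (n - 1) = 0 \<Longrightarrow> (s (n - 2) = 0 \<longrightarrow> d = 0) \<Longrightarrow> colm n s d \<in> D2 n"
  by (auto simp: D2_def)

lemma R1_I: "r 0 = 0 \<Longrightarrow> r 1 = 0 \<Longrightarrow> rowm n r 0 \<in> R1 n"
  by (auto simp: R1_def)

lemma R2_I: "s (n - 1) = 0 \<Longrightarrow> s (n - 2) = 0 \<Longrightarrow> colm n s 0 \<in> R2 n"
  by (auto simp: R2_def)

lemma D1_D:
  assumes "4 \<le> n" "x \<in> D1 n"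
  shows "x \<in> UT n" "x $$ (0, 1) = 0 \<Longrightarrow> x $$ (1, n - 1) = 0"
  using assms by (auto simp: D1_def rowm_UT rowm_entry)

lemma D2_D:
  assumes "4 \<le> n" "x \<in> D2 n"
  shows "x \<in> UT n" "x $$ (n - 2, n - 1) = 0 \<Longrightarrow> x $$ (0, n - 2) = 0"
proof -
  have e: "n - 2 \<noteq> n - 1" "n - 2 < n" "n - 1 < n" "0 < n" "0 \<noteq> n - 2" "0 \<noteq> n - 1" using assms by auto
  obtain s d where s: "x = colm n s d" "s (n - 1) = 0" "s (n - 2) = 0 \<longrightarrow> d = 0"
    using assms by (auto simp: D2_def)
  show "x \<in> UT n" using s assms by (simp add: colm_UT)
  show "x $$ (n - 2, n - 1) = 0 \<Longrightarrow> x $$ (0, n - 2) = 0"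
    using s colm_entry[OF e(2,3), of s d] colm_entry[OF e(4,2), of s d] e by (auto split: if_splits)
qed

lemma sum_inner:
  fixes f :: "nat \<Rightarrow> 'a::comm_monoid_add"
  assumes "f 0 = 0" "f (n - 1) = 0"
  shows "(\<Sum>k<n. f k) = (\<Sum>k\<in>{1..<n - 1}. f k)"
proof (rule sum.mono_neutral_right)
  show "\<forall>i\<in>{..<n} - {1..<n - 1}. f i = 0"
  proof
    fix i assume "i \<in> {..<n} - {1..<n - 1}"
    then have "i = 0 \<or> i = n - 1" by auto
    then show "f i = 0" using assms by auto
  qed
qed auto

text \<open>The pairing lives on the n - 2 inner coordinates, because the outer summands contain
  \<open>r 0 = 0\<close> or \<open>s (n - 1) = 0\<close>.\<close>

lemma comm_D1_D2:
  fixes x y :: "'a::field mat"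
  assumes n: "4 \<le> n" and "x \<in> D1 n" "y \<in> D2 n"
  shows "comm x y = tv n 0 (n - 1) (\<Sum>k\<in>{1..<n - 1}. x $$ (0, k) * y $$ (k, n - 1))"
proof -
  obtain r c where r: "x = rowm n r c" "r 0 = 0" using assms by (auto simp: D1_def)
  obtain s d where s: "y = colm n s d" "s (n - 1) = 0" using assms by (auto simp: D2_def)
  have "(\<Sum>k<n. r k * s k) = (\<Sum>k\<in>{1..<n - 1}. r k * s k)"
    using r(2) s(2) by (intro sum_inner) auto
  also have "\<dots> = (\<Sum>k\<in>{1..<n - 1}. x $$ (0, k) * y $$ (k, n - 1))"
    using r(1) s(1) by (intro sum.cong) (auto simp: rowm_entry colm_entry)
  finally show ?thesis using comm_rowm_colm[of n r s c d, OF n r(2) s(2)] r(1) s(1) by simp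
qed

text \<open>A row element probes the inverse of \<open>g\<close>. In the corner the last entry of
  \<open>x\<close> cancels, as the inverse has 1 at (n - 1, n - 1), and the hidden entry of
  \<open>x\<close> appears with weight \<open>g $$ (0, 1)\<close>.\<close>

lemma comm_D1:
  fixes g x :: "'a::field mat"
  assumes n: "4 \<le> n" and g: "g \<in> UT n" and x: "x \<in> D1 n"
  shows "comm g x \<in> R1 n"
    and "k \<in> {1..<n - 1} \<Longrightarrow>
      comm g x $$ (0, k) = (\<Sum>l\<in>{1..<n - 1}. x $$ (0, l) * minv g $$ (l, k)) - x $$ (0, k)"
    and "comm g x $$ (0, n - 1) =
      (\<Sum>l\<in>{1..<n - 1}. x $$ (0, l) * minv g $$ (l, n - 1)) + x $$ (1, n - 1) * g $$ (0, 1)"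
proof -
  obtain r c where r: "x = rowm n r c" "r 0 = 0" using x by (auto simp: D1_def)
  note h = UT_minv(1)[OF g]
  note cr = comm_rowm[of n r g c, OF n r(2) g]
  show "comm g x \<in> R1 n"
    using comm_rowm_form[of n r g c, OF n r(2) g] R1_I r(1) by metis
  have e: "x $$ (0, l) = r l" if "l \<in> {1..<n - 1}" for l
    using that r by (auto simp: rowm_entry)
  show "comm g x $$ (0, k) = (\<Sum>l\<in>{1..<n - 1}. x $$ (0, l) * minv g $$ (l, k)) - x $$ (0, k)"
    if k: "k \<in> {1..<n - 1}"
  proof -
    have "(\<Sum>l<n. r l * minv g $$ (l, k)) = (\<Sum>l\<in>{1..<n - 1}. r l * minv g $$ (l, k))"
      using r(2) UT_lower[OF h, of k "n - 1"] k by (intro sum_inner) auto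
    also have "\<dots> = (\<Sum>l\<in>{1..<n - 1}. x $$ (0, l) * minv g $$ (l, k))"
      using e by (intro sum.cong) auto
    finally have "(\<Sum>l<n. r l * minv g $$ (l, k)) = (\<Sum>l\<in>{1..<n - 1}. x $$ (0, l) * minv g $$ (l, k))" .
    moreover have "comm g x $$ (0, k) = (\<Sum>l<n. r l * minv g $$ (l, k)) - r k"
      unfolding r(1) cr(1) using k by (auto simp: rowm_entry)
    ultimately show ?thesis using e[OF k] by simp
  qed
  have "(\<Sum>l<n. r l * minv g $$ (l, n - 1)) = (\<Sum>l<n. (if l = n - 1 then 0 else r l * minv g $$ (l, n - 1))
      + (if l = n - 1 then r (n - 1) else 0))"
    using UT_diag[OF h, of "n - 1"] by (intro sum.cong) auto
  also have "\<dots> = (\<Sum>l<n. if l = n - 1 then 0 else r l * minv g $$ (l, n - 1)) + r (n - 1)"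
    using n by (simp add: sum.distrib)
  also have "(\<Sum>l<n. if l = n - 1 then 0 else r l * minv g $$ (l, n - 1))
      = (\<Sum>l\<in>{1..<n - 1}. if l = n - 1 then 0 else r l * minv g $$ (l, n - 1))"
    using r(2) by (intro sum_inner) auto
  also have "\<dots> = (\<Sum>l\<in>{1..<n - 1}. x $$ (0, l) * minv g $$ (l, n - 1))"
    using e by (intro sum.cong) auto
  finally have S: "(\<Sum>l<n. r l * minv g $$ (l, n - 1))
    = (\<Sum>l\<in>{1..<n - 1}. x $$ (0, l) * minv g $$ (l, n - 1)) + r (n - 1)" .
  have "x $$ (1, n - 1) = c" using r n by (simp add: rowm_entry)
  moreover have "comm g x $$ (0, n - 1) = (\<Sum>l<n. r l * minv g $$ (l, n - 1)) - r (n - 1) + c * g $$ (0, 1)"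
    unfolding r(1) cr(1) using n by (simp add: rowm_entry)
  ultimately show "comm g x $$ (0, n - 1) =
      (\<Sum>l\<in>{1..<n - 1}. x $$ (0, l) * minv g $$ (l, n - 1)) + x $$ (1, n - 1) * g $$ (0, 1)"
    unfolding S by simp
qed

text \<open>A column element probes \<open>g\<close> itself; the hidden entry appears with the
  opposite sign.\<close>

lemma comm_D2:
  fixes g y :: "'a::field mat"
  assumes n: "4 \<le> n" and g: "g \<in> UT n" and y: "y \<in> D2 n"
  shows "comm g y \<in> R2 n"
    and "k \<in> {1..<n - 1} \<Longrightarrow>
      comm g y $$ (k, n - 1) = (\<Sum>l\<in>{1..<n - 1}. g $$ (k, l) * y $$ (l, n - 1)) - y $$ (k, n - 1)"
    and "comm g y $$ (0, n - 1) =
      (\<Sum>l\<in>{1..<n - 1}. g $$ (0, l) * y $$ (l, n - 1)) - y $$ (0, n - 2) * g $$ (n - 2, n - 1)"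
proof -
  obtain s d where s: "y = colm n s d" "s (n - 1) = 0" using y by (auto simp: D2_def)
  note cs = comm_colm[of n s g d, OF n s(2) g]
  show "comm g y \<in> R2 n"
    using comm_colm_form[of n s g d, OF n s(2) g] R2_I s(1) by metis
  have e: "y $$ (l, n - 1) = s l" if "l \<in> {1..<n - 1}" for l
    using that s by (auto simp: colm_entry)
  show "comm g y $$ (k, n - 1) = (\<Sum>l\<in>{1..<n - 1}. g $$ (k, l) * y $$ (l, n - 1)) - y $$ (k, n - 1)"
    if k: "k \<in> {1..<n - 1}"
  proof -
    have "(\<Sum>l<n. g $$ (k, l) * s l) = (\<Sum>l\<in>{1..<n - 1}. g $$ (k, l) * s l)"
      using s(2) UT_lower[OF g, of 0 k] k by (intro sum_inner) auto
    also have "\<dots> = (\<Sum>l\<in>{1..<n - 1}. g $$ (k, l) * y $$ (l, n - 1))"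
      using e by (intro sum.cong) auto
    finally have "(\<Sum>l<n. g $$ (k, l) * s l) = (\<Sum>l\<in>{1..<n - 1}. g $$ (k, l) * y $$ (l, n - 1))" .
    moreover have "comm g y $$ (k, n - 1) = (\<Sum>l<n. g $$ (k, l) * s l) - s k"
      unfolding s(1) cs(1) using k by (auto simp: colm_entry)
    ultimately show ?thesis using e[OF k] by simp
  qed
  have "(\<Sum>l<n. g $$ (0, l) * s l) = (\<Sum>l<n. (if l = 0 then 0 else g $$ (0, l) * s l) + (if l = 0 then s 0 else 0))"
    using UT_diag[OF g, of 0] n by (intro sum.cong) auto
  also have "\<dots> = (\<Sum>l<n. if l = 0 then 0 else g $$ (0, l) * s l) + s 0"
    using n by (simp add: sum.distrib)
  also have "(\<Sum>l<n. if l = 0 then 0 else g $$ (0, l) * s l)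
      = (\<Sum>l\<in>{1..<n - 1}. if l = 0 then 0 else g $$ (0, l) * s l)"
    using s(2) by (intro sum_inner) auto
  also have "\<dots> = (\<Sum>l\<in>{1..<n - 1}. g $$ (0, l) * y $$ (l, n - 1))"
    using e by (intro sum.cong) auto
  finally have S: "(\<Sum>l<n. g $$ (0, l) * s l) = (\<Sum>l\<in>{1..<n - 1}. g $$ (0, l) * y $$ (l, n - 1)) + s 0" .
  have "0 \<noteq> n - 2" "n - 2 \<noteq> n - 1" using n by auto
  then have "y $$ (0, n - 2) = d" using s n colm_entry[of 0 n "n - 2" s d] by simp
  moreover have "comm g y $$ (0, n - 1) = (\<Sum>l<n. g $$ (0, l) * s l) - s 0 - d * g $$ (n - 2, n - 1)"
    unfolding s(1) cs(1) using n by (simp add: colm_entry)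
  ultimately show "comm g y $$ (0, n - 1) =
      (\<Sum>l\<in>{1..<n - 1}. g $$ (0, l) * y $$ (l, n - 1)) - y $$ (0, n - 2) * g $$ (n - 2, n - 1)"
    unfolding S by simp
qed

section \<open>Row and column elements under a PC-map\<close>

lemma R1_subset: "R1 n \<subseteq> D1 n" and R2_subset: "R2 n \<subseteq> D2 n"
  by (auto simp: D1_eq D2_eq)

text \<open>This makes \<open>R1\<close> recognisable: its elements centralise the second centre,
  hence are not good, and can only be reached through the good elements they commute with.\<close>

lemma centralizer_K1:
  fixes x :: "'a::field mat"
  assumes n: "4 \<le> n" and x: "x \<in> UT n"
  shows "x \<in> R1 n \<longleftrightarrow> (\<forall>k\<in>K1 n. comm k x = 1\<^sub>m n)"
proof
  assume "x \<in> R1 n"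
  then obtain r where r: "x = rowm n r 0" "r 0 = 0" "r 1 = 0" by (auto simp: R1_def)
  show "\<forall>k\<in>K1 n. comm k x = 1\<^sub>m n"
  proof
    fix k :: "'a mat" assume k: "k \<in> K1 n"
    then obtain r' c where "k = rowm n r' c" "r' 0 = 0" by (auto simp: K1_def)
    then show "comm k x = 1\<^sub>m n"
      using comm_eq_one_iff[OF K1_D(1)[OF n k] x] rowm_commute[of n r' r c] n r by simp
  qed
next
  assume c: "\<forall>k\<in>K1 n. comm k x = 1\<^sub>m n"
  note xc = UT_carrier[OF x]
  have e: "(if i = 0 then \<Sum>k<n. r k * x $$ (k, j) else 0) + (if i = 1 then c * x $$ (n - 1, j) else 0)
      = x $$ (i, 0) * r j + (if j = n - 1 then x $$ (i, 1) * c else 0)"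
    if "r 0 = 0" "r 1 \<noteq> 0" "i < n" "j < n" for r c i j
  proof -
    have k: "rowm n r c \<in> K1 n" using that by (intro K1_I)
    then have "rowm n r c * x = x * rowm n r c"
      using c comm_eq_one_iff[OF K1_D(1)[OF n k] x] by blast
    then have "(rowm n r c * x) $$ (i, j) = (x * rowm n r c) $$ (i, j)" by simp
    then show ?thesis
      unfolding rowm_mult_left[OF xc n that(3,4)] rowm_mult_right[OF xc n that(3,4)] by (simp add: add.assoc)
  qed
  have x00: "x $$ (0, 0) = 1" using UT_diag[OF x] n by simp
  have row1: "x $$ (1, j) = (if j = 1 then 1 else 0)" if "j < n" for j
  proof -
    have "(\<Sum>k<n. (if k = 1 then 1 else 0) * x $$ (k, j)) = x $$ (1, j)"
      using n by (simp only: sum_delta_mult) simp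
    then show ?thesis using e[of "\<lambda>k. if k = 1 then 1 else 0" 0 j 0] that n x00 by simp
  qed
  \<comment> \<open>\<open>K1\<close> demands \<open>r 1 \<noteq> 0\<close>, so unit row q is tested
    in its sum with unit row 1, whose contribution is already known.\<close>
  have rows: "x $$ (q, j) = (if j = q then 1 else 0)" if "j < n" "2 \<le> q" "q < n" for q j
  proof -
    have "(\<Sum>k<n. ((if k = 1 then 1 else 0) + (if k = q then 1 else 0)) * x $$ (k, j)) = x $$ (1, j) + x $$ (q, j)"
      using n that by (simp only: sum_delta_mult distrib_right sum.distrib) simp
    then show ?thesis
      using e[of "\<lambda>k. (if k = 1 then 1 else 0) + (if k = q then 1 else 0)" 0 j 0] that n x00 row1[OF that(1)] by auto
  qed
  \<comment> \<open>The (0, 1) entry of \<open>x\<close> is detected by a test element with hidden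
    entry 1.\<close>
  have "(\<Sum>k<n. (if k = 1 then 1 else 0) * x $$ (k, n - 1)) = x $$ (1, n - 1)"
    using n by (simp only: sum_delta_mult) simp
  then have x01: "x $$ (0, 1) = 0"
    using e[of "\<lambda>k. if k = 1 then 1 else 0" 0 "n - 1" 1] row1[of "n - 1"] n x00 by simp
  let ?r = "\<lambda>j. if j = 0 then 0 else x $$ (0, j)"
  have "x = rowm n ?r 0"
  proof (rule mat_eqI[OF xc rowm_carrier])
    fix i j assume ij: "i < n" "j < n"
    consider "i = 0" | "i = 1" | "2 \<le> i" by linarith
    then show "x $$ (i, j) = rowm n ?r 0 $$ (i, j)"
      using ij row1[of j] rows[of j i] x00 by cases (auto simp: rowm_entry)
  qed
  moreover have "rowm n ?r 0 \<in> R1 n" using x01 by (intro R1_I) auto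
  ultimately show "x \<in> R1 n" by simp
qed

lemma centralizer_K2:
  fixes x :: "'a::field mat"
  assumes n: "4 \<le> n" and x: "x \<in> UT n"
  shows "x \<in> R2 n \<longleftrightarrow> (\<forall>k\<in>K2 n. comm k x = 1\<^sub>m n)"
proof
  assume "x \<in> R2 n"
  then obtain s where s: "x = colm n s 0" "s (n - 1) = 0" "s (n - 2) = 0" by (auto simp: R2_def)
  show "\<forall>k\<in>K2 n. comm k x = 1\<^sub>m n"
  proof
    fix k :: "'a mat" assume k: "k \<in> K2 n"
    then obtain s' d where "k = colm n s' d" "s' (n - 1) = 0" by (auto simp: K2_def)
    then show "comm k x = 1\<^sub>m n"
      using comm_eq_one_iff[OF K2_D(1)[OF n k] x] colm_commute[of n s' s d] n s by simp
  qed
next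
  assume c: "\<forall>k\<in>K2 n. comm k x = 1\<^sub>m n"
  note xc = UT_carrier[OF x]
  have N: "n - 2 < n" "n - 1 < n" "0 < n" "n - 2 \<noteq> n - 1" "n - 2 \<noteq> 0" "n - 1 \<noteq> 0" using n by auto
  have e: "s i * x $$ (n - 1, j) + (if i = 0 then d * x $$ (n - 2, j) else 0)
      = (if j = n - 1 then \<Sum>k<n. x $$ (i, k) * s k else 0) + (if j = n - 2 then x $$ (i, 0) * d else 0)"
    if "s (n - 1) = 0" "s (n - 2) \<noteq> 0" "i < n" "j < n" for s d i j
  proof -
    have k: "colm n s d \<in> K2 n" using that by (intro K2_I)
    then have "colm n s d * x = x * colm n s d"
      using c comm_eq_one_iff[OF K2_D(1)[OF n k] x] by blast
    then have "(colm n s d * x) $$ (i, j) = (x * colm n s d) $$ (i, j)" by simp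
    then show ?thesis
      unfolding colm_mult_left[OF xc n that(3,4)] colm_mult_right[OF xc n that(3,4)] by (simp add: add.assoc)
  qed
  have xNN: "x $$ (n - 1, n - 1) = 1" using UT_diag[OF x N(2)] .
  have colM: "x $$ (i, n - 2) = (if i = n - 2 then 1 else 0)" if "i < n" for i
  proof -
    have "(\<Sum>k<n. x $$ (i, k) * (if k = n - 2 then 1 else 0)) = x $$ (i, n - 2)"
      using n by (simp only: sum_delta_mult) simp
    then show ?thesis using e[of "\<lambda>k. if k = n - 2 then 1 else 0" i "n - 1" 0] that N xNN by (auto split: if_splits)
  qed
  have cols: "x $$ (i, q) = (if i = q then 1 else 0)" if "i < n" "q < n - 2" for q i
  proof -
    have "(\<Sum>k<n. x $$ (i, k) * ((if k = n - 2 then 1 else 0) + (if k = q then 1 else 0)))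
        = x $$ (i, n - 2) + x $$ (i, q)"
      using n that by (simp only: sum_delta_mult distrib_left sum.distrib) simp
    then show ?thesis
      using e[of "\<lambda>k. (if k = n - 2 then 1 else 0) + (if k = q then 1 else 0)" i "n - 1" 0] that N xNN colM[OF that(1)]
      by auto
  qed
  have "(\<Sum>k<n. x $$ (0, k) * (if k = n - 2 then 1 else 0)) = x $$ (0, n - 2)"
    using n by (simp only: sum_delta_mult) simp
  then have xM: "x $$ (n - 2, n - 1) = 0"
    using e[of "\<lambda>k. if k = n - 2 then 1 else 0" 0 "n - 1" 1] colM[of 0] N by simp
  let ?s = "\<lambda>i. if i = n - 1 then 0 else x $$ (i, n - 1)"
  have "x = colm n ?s 0"
  proof (rule mat_eqI[OF xc colm_carrier])
    fix i j assume ij: "i < n" "j < n"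
    consider "j = n - 1" | "j = n - 2" | "j < n - 2" using ij by linarith
    then show "x $$ (i, j) = colm n ?s 0 $$ (i, j)"
      using ij N colM[of i] cols[of i j] xNN colm_entry[OF ij, of ?s 0] by cases auto
  qed
  moreover have "colm n ?s 0 \<in> R2 n" using xM by (intro R2_I) auto
  ultimately show "x \<in> R2 n" by simp
qed

lemma PC_map_inv:
  assumes "PC_map n \<phi>"
  shows "PC_map n (inv_into (UT n) \<phi>)"
proof (rule PC_map_factor[OF assms, of "\<lambda>a. a"])
  note D = PC_mapD[OF assms]
  have "\<phi> ` UT n = UT n" using assms by (auto simp: PC_map_def bij_betw_def)
  then show "inv_into (UT n) \<phi> a \<in> UT n" "\<phi> (inv_into (UT n) \<phi> a) = a" if "a \<in> UT n" for a
    using that by (auto intro: inv_into_into f_inv_into_f)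
  show "PC_map n (\<lambda>a. a)" by (simp add: PC_map_def bij_betw_def inj_on_def)
qed

text \<open>Inclusions become equalities by applying the classification to the inverse PC-map and
  using that \<open>K1\<close> and \<open>K2\<close> are disjoint; centralisers then follow.\<close>

lemma PC_map_K_images:
  fixes \<phi> :: "'a::field mat \<Rightarrow> 'a mat"
  assumes n: "4 \<le> n" and two: "(2::'a) \<noteq> 0" and \<phi>: "PC_map n \<phi>"
    and K: "\<phi> ` K1 n \<subseteq> K1 n" "\<phi> ` K2 n \<subseteq> K2 n"
  shows "\<phi> ` K1 n = K1 n" "\<phi> ` K2 n = K2 n" "\<phi> ` R1 n = R1 n" "\<phi> ` R2 n = R2 n"
    "\<phi> ` D1 n = D1 n" "\<phi> ` D2 n = D2 n"
proof -
  note D = PC_mapD[OF \<phi>]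
  have disj: "x \<in> K1 n \<Longrightarrow> x \<notin> K2 n" for x :: "'a mat" using K1_D(2)[OF n] K2_D(3)[OF n] by blast
  have U: "K1 n \<subseteq> UT n" "K2 n \<subseteq> UT n" "R1 n \<subseteq> UT n" "R2 n \<subseteq> UT n"
    using K1_D(1)[OF n] K2_D(1)[OF n] D1_D(1)[OF n] D2_D(1)[OF n] R1_subset R2_subset by fast+
  have pre: "\<exists>x\<in>K1 n \<union> K2 n. \<phi> x = y" if "y \<in> K1 n \<union> K2 n" for y
  proof -
    have "y \<in> UT n" using that U by blast
    then have "y \<in> \<phi> ` UT n" using D(4) by blast
    then show ?thesis
      using PC_map_K1_Un_K2[OF n two PC_map_inv[OF \<phi>] that] f_inv_into_f by metis
  qed
  show k1: "\<phi> ` K1 n = K1 n"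
  proof (intro subset_antisym K subsetI)
    fix y :: "'a mat" assume y: "y \<in> K1 n"
    then obtain x where "x \<in> K1 n \<union> K2 n" "\<phi> x = y" using pre by blast
    then show "y \<in> \<phi> ` K1 n" using y K disj by blast
  qed
  show k2: "\<phi> ` K2 n = K2 n"
  proof (intro subset_antisym K subsetI)
    fix y :: "'a mat" assume y: "y \<in> K2 n"
    then obtain x where "x \<in> K1 n \<union> K2 n" "\<phi> x = y" using pre by blast
    then show "y \<in> \<phi> ` K2 n" using y K disj by blast
  qed
  have r: "\<phi> ` R = R" if R: "R \<subseteq> UT n" "\<And>x. x \<in> UT n \<Longrightarrow> x \<in> R \<longleftrightarrow> (\<forall>k\<in>K. comm k x = 1\<^sub>m n)"
    and K: "\<phi> ` K = K" "K \<subseteq> UT n" for R K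
  proof -
    have iff: "\<phi> x \<in> R \<longleftrightarrow> x \<in> R" if "x \<in> UT n" for x
    proof -
      have "\<phi> x \<in> R \<longleftrightarrow> (\<forall>k\<in>\<phi> ` K. comm k (\<phi> x) = 1\<^sub>m n)" using R(2)[OF D(1)[OF that]] K(1) by simp
      also have "\<dots> \<longleftrightarrow> (\<forall>k\<in>K. comm k x = 1\<^sub>m n)"
        using PC_map_comm_one_iff[OF \<phi> _ that] K(2) by (auto simp: subset_iff)
      finally show ?thesis using R(2)[OF that] by simp
    qed
    show ?thesis
    proof (intro subset_antisym subsetI)
      show "y \<in> R" if "y \<in> \<phi> ` R" for y using that iff R(1) by auto
      show "y \<in> \<phi> ` R" if "y \<in> R" for y using that iff R(1) D(4)[of y] by blast
    qed
  qed
  show r1: "\<phi> ` R1 n = R1 n" by (rule r[OF U(3) centralizer_K1[OF n] k1 U(1)])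
  show r2: "\<phi> ` R2 n = R2 n" by (rule r[OF U(4) centralizer_K2[OF n] k2 U(2)])
  show "\<phi> ` D1 n = D1 n" "\<phi> ` D2 n = D2 n"
    by (simp_all add: D1_eq D2_eq image_Un k1 k2 r1 r2)
qed

text \<open>The corner elements form the centre, which a PC-map permutes. That the induced bijection
  respects the field structure up to a scalar emerges only from the pairing.\<close>

lemma PC_map_corner:
  fixes \<phi> :: "'a::field mat \<Rightarrow> 'a mat"
  assumes n: "4 \<le> n" and \<phi>: "PC_map n \<phi>"
  obtains \<zeta> where "bij \<zeta>" "\<And>a. \<phi> (tv n 0 (n - 1) a) = tv n 0 (n - 1) (\<zeta> a)"
proof -
  note D = PC_mapD[OF \<phi>]
  have t: "tv n 0 (n - 1) a \<in> UT n" for a :: 'a using n by (intro tv_UT) auto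
  have te: "tv n 0 (n - 1) a $$ (0, n - 1) = a" for a :: 'a using n by (simp add: tv_entry)
  have "\<exists>b. \<phi> (tv n 0 (n - 1) a) = tv n 0 (n - 1) b" for a
  proof (rule central_form[OF n D(1)[OF t]])
    fix h :: "'a mat" assume "h \<in> UT n"
    then obtain g where g: "g \<in> UT n" "\<phi> g = h" using D(4) by blast
    show "comm h (\<phi> (tv n 0 (n - 1) a)) = 1\<^sub>m n"
      using comm_corner_one[OF n g(1), of a] PC_map_comm_one_iff[OF \<phi> g(1) t] g(2) by simp
  qed
  then obtain \<zeta> where \<zeta>: "\<And>a. \<phi> (tv n 0 (n - 1) a) = tv n 0 (n - 1) (\<zeta> a)" by metis
  have "inj \<zeta>"
  proof (rule injI)
    fix a b assume "\<zeta> a = \<zeta> b"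
    then have "tv n 0 (n - 1) a = tv n 0 (n - 1) b" using \<zeta> D(3)[OF t t] by metis
    then show "a = b" using te by metis
  qed
  moreover have "surj \<zeta>"
    unfolding surj_def
  proof
    fix b
    obtain x where x: "x \<in> UT n" "\<phi> x = tv n 0 (n - 1) b" using D(4)[OF t] by blast
    have "\<exists>a. x = tv n 0 (n - 1) a"
    proof (rule central_form[OF n x(1)])
      fix h :: "'a mat" assume "h \<in> UT n"
      then show "comm h x = 1\<^sub>m n"
        using comm_corner_one[OF n D(1), of h b] PC_map_comm_one_iff[OF \<phi> _ x(1)] x(2) by metis
    qed
    then obtain a where "x = tv n 0 (n - 1) a" by blast
    then have "b = \<zeta> a" using x(2) \<zeta> te by metis
    then show "\<exists>a. b = \<zeta> a" by blast
  qed
  ultimately show thesis using that[of \<zeta>] \<zeta> by (auto simp: bij_def)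
qed

section \<open>Reduction to maps fixing the inner entries of rows and columns\<close>

definition normalized :: "nat \<Rightarrow> ('a::field mat \<Rightarrow> 'a mat) \<Rightarrow> bool" where
  "normalized n \<psi> \<longleftrightarrow> PC_map n \<psi> \<and>
     (\<forall>x\<in>D1 n. \<psi> x \<in> D1 n \<and> (\<forall>k\<in>{1..<n - 1}. \<psi> x $$ (0, k) = x $$ (0, k))) \<and>
     (\<forall>y\<in>D2 n. \<psi> y \<in> D2 n \<and> (\<forall>k\<in>{1..<n - 1}. \<psi> y $$ (k, n - 1) = y $$ (k, n - 1)))"

text \<open>The block diagonal matrix diag(1, \<open>T\<close>, \<open>\<kappa>\<close>). The last
  entry absorbs the scalar of the pairing: conjugation multiplies rows by the inverse of
  \<open>T\<close> and columns by \<open>T / \<kappa>\<close>, which is the inverse of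
  \<open>T'\<close>.\<close>

definition blockm :: "nat \<Rightarrow> (nat \<Rightarrow> nat \<Rightarrow> 'a::field) \<Rightarrow> 'a \<Rightarrow> 'a mat" where
  "blockm n T \<kappa> = mat n n (\<lambda>(i, j). if i = 0 then (if j = 0 then 1 else 0)
     else if i = n - 1 then (if j = n - 1 then \<kappa> else 0)
     else if j \<in> {1..<n - 1} then T i j else 0)"

lemma blockm_carrier [simp]: "blockm n T \<kappa> \<in> carrier_mat n n"
  by (simp add: blockm_def)

lemma blockm_entry:
  assumes "i < n" "j < n"
  shows "blockm n T \<kappa> $$ (i, j) = (if i = 0 then (if j = 0 then 1 else 0)
     else if i = n - 1 then (if j = n - 1 then \<kappa> else 0)
     else if j \<in> {1..<n - 1} then T i j else 0)"
  using assms by (simp add: blockm_def)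

lemma blockm_inverse:
  fixes T T' :: "nat \<Rightarrow> nat \<Rightarrow> 'a::field"
  assumes n: "4 \<le> n" and \<kappa>: "\<kappa> \<noteq> 0"
    and T: "\<And>i j. i \<in> {1..<n - 1} \<Longrightarrow> j \<in> {1..<n - 1} \<Longrightarrow> (\<Sum>k\<in>{1..<n - 1}. T i k * T' k j) = (if i = j then \<kappa> else 0)"
  shows "blockm n T \<kappa> * blockm n (\<lambda>i j. T' i j / \<kappa>) (1 / \<kappa>) = 1\<^sub>m n" (is "?t * ?s = _")
proof (rule mat_eqI)
  fix i j assume ij: "i < n" "j < n"
  consider "i = 0" | "i = n - 1" | "i \<in> {1..<n - 1}" using ij by force
  then have "(\<Sum>k<n. ?t $$ (i, k) * ?s $$ (k, j)) = (if i = j then 1 else 0)"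
  proof cases
    case 1
    then have "(\<Sum>k<n. ?t $$ (i, k) * ?s $$ (k, j)) = (\<Sum>k<n. (if k = 0 then 1 else 0) * ?s $$ (k, j))"
      using n by (intro sum.cong) (auto simp: blockm_entry)
    also have "\<dots> = ?s $$ (0, j)" using n by (simp only: sum_delta_mult) simp
    finally show ?thesis using 1 ij by (simp add: blockm_entry)
  next
    case 2
    then have "(\<Sum>k<n. ?t $$ (i, k) * ?s $$ (k, j)) = (\<Sum>k<n. (if k = n - 1 then \<kappa> else 0) * ?s $$ (k, j))"
      using n by (intro sum.cong) (auto simp: blockm_entry)
    also have "\<dots> = \<kappa> * ?s $$ (n - 1, j)" using n by (simp only: sum_delta_mult) simp
    finally show ?thesis using 2 ij n \<kappa> by (auto simp: blockm_entry)
  next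
    case 3
    have "(\<Sum>k<n. ?t $$ (i, k) * ?s $$ (k, j)) = (\<Sum>k\<in>{1..<n - 1}. ?t $$ (i, k) * ?s $$ (k, j))"
      using 3 n ij by (intro sum_inner) (auto simp: blockm_entry)
    also have "\<dots> = (\<Sum>k\<in>{1..<n - 1}. T i k * (if j \<in> {1..<n - 1} then T' k j else 0)) / \<kappa>"
      unfolding sum_divide_distrib using 3 ij by (intro sum.cong) (auto simp: blockm_entry)
    also have "\<dots> = (if i = j then 1 else 0)"
      using T[OF 3, of j] 3 \<kappa> by (cases "j \<in> {1..<n - 1}") auto
    finally show ?thesis .
  qed
  then show "(?t * ?s) $$ (i, j) = 1\<^sub>m n $$ (i, j)"
    using ij by (simp add: mat_mult_entry[OF blockm_carrier blockm_carrier ij] del: index_mult_mat)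
qed (auto intro: sq_mult_carrier)

lemma map_mat_rowm:
  assumes "field_automorphism \<theta>"
  shows "map_mat \<theta> (rowm n r c) = rowm n (\<lambda>j. \<theta> (r j)) (\<theta> c)"
  by (rule mat_eqI[of _ n]) (auto simp: rowm_def field_aut_simps[OF assms])

lemma map_mat_colm:
  assumes "field_automorphism \<theta>"
  shows "map_mat \<theta> (colm n s d) = colm n (\<lambda>j. \<theta> (s j)) (\<theta> d)"
  by (rule mat_eqI[of _ n]) (auto simp: colm_def field_aut_simps[OF assms])

text \<open>Unit row m + 1 is the commutator of an elementary matrix with unit row m. Its image is
  row m of \<open>T\<close> times a unitriangular matrix, minus row m of \<open>T\<close>; so if row
  m of \<open>T\<close> starts at position m or later, the next row starts strictly later.\<close>

lemma PC_map_triangular: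
  fixes \<phi> :: "'a::field mat \<Rightarrow> 'a mat"
  assumes n: "4 \<le> n" and \<phi>: "PC_map n \<phi>" and D1: "\<phi> ` D1 n = D1 n" and \<theta>: "field_automorphism \<theta>"
    and T: "\<And>x i. x \<in> D1 n \<Longrightarrow> i \<in> {1..<n - 1} \<Longrightarrow> \<phi> x $$ (0, i) = (\<Sum>j\<in>{1..<n - 1}. \<theta> (x $$ (0, j)) * T j i)"
  shows "j \<in> {1..<n - 1} \<Longrightarrow> k \<in> {1..<n - 1} \<Longrightarrow> k < j \<Longrightarrow> T j k = 0"
proof (induction j arbitrary: k)
  case 0 then show ?case by simp
next
  case (Suc m)
  let ?I = "{1..<n - 1}"
  note \<theta>s = field_aut_simps[OF \<theta>] and D = PC_mapD[OF \<phi>]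
  have m: "m \<in> ?I" and k: "k \<in> ?I" "k \<le> m" using Suc.prems by auto
  have unit: "\<phi> x $$ (0, i) = T j i"
    if "x \<in> D1 n" "i \<in> ?I" "j \<in> ?I" "\<And>l. l \<in> ?I \<Longrightarrow> x $$ (0, l) = (if l = j then 1 else 0)" for x i j
  proof -
    have "\<phi> x $$ (0, i) = (\<Sum>l\<in>?I. if l = j then T l i else 0)"
      unfolding T[OF that(1,2)] using that(4) \<theta>s(1,2) by (intro sum.cong) auto
    then show ?thesis using that(3) by simp
  qed
  let ?x = "rowm n (\<lambda>l. if l = m then 1 else 0) 0 :: 'a mat"
  \<comment> \<open>The sign compensates the inverse occurring in \<open>comm_D1\<close>.\<close>
  let ?g = "tv n m (Suc m) (- 1) :: 'a mat"
  have x: "?x \<in> D1 n" using m by (intro D1_I) auto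
  have xe: "?x $$ (0, l) = (if l = m then 1 else 0)" if "l \<in> ?I" for l
    using that by (auto simp: rowm_entry)
  have g: "?g \<in> UT n" by (rule tv_UT) simp
  have gi: "minv ?g = tv n m (Suc m) 1" using tv_minv[of m "Suc m" n "- 1 :: 'a"] m by auto
  have z: "comm ?g ?x \<in> D1 n" using comm_D1(1)[OF n g x] R1_subset by blast
  have ze: "comm ?g ?x $$ (0, l) = (if l = Suc m then 1 else 0)" if l: "l \<in> ?I" for l
  proof -
    have "(\<Sum>i\<in>?I. ?x $$ (0, i) * minv ?g $$ (i, l)) = (\<Sum>i\<in>?I. if i = m then minv ?g $$ (m, l) else 0)"
      using xe by (intro sum.cong) auto
    then have "comm ?g ?x $$ (0, l) = minv ?g $$ (m, l) - ?x $$ (0, l)"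
      using comm_D1(2)[OF n g x l] m by simp
    then show ?thesis using l m xe[OF l] unfolding gi by (auto simp: tv_entry)
  qed
  have fx: "\<phi> ?x \<in> D1 n" using x D1 by blast
  let ?H = "minv (\<phi> ?g)"
  have H: "?H \<in> UT n" by (rule UT_minv(1)[OF D(1)[OF g]])
  have "T (Suc m) k = \<phi> (comm ?g ?x) $$ (0, k)"
    using unit[OF z k(1) Suc.prems(1) ze] by simp
  also have "\<dots> = comm (\<phi> ?g) (\<phi> ?x) $$ (0, k)"
    using D(2)[OF g D1_D(1)[OF n x]] by simp
  also have "\<dots> = (\<Sum>l\<in>?I. \<phi> ?x $$ (0, l) * ?H $$ (l, k)) - \<phi> ?x $$ (0, k)"
    by (rule comm_D1(2)[OF n D(1)[OF g] fx k(1)])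
  also have "(\<Sum>l\<in>?I. \<phi> ?x $$ (0, l) * ?H $$ (l, k)) = (\<Sum>l\<in>?I. if l = k then T m k else 0)"
  proof (rule sum.cong[OF refl])
    fix l assume l: "l \<in> ?I"
    have e: "\<phi> ?x $$ (0, l) = T m l" by (rule unit[OF x l m xe])
    have "k < n" using k(1) by auto
    consider "l < k" | "l = k" | "k < l" by linarith
    then show "\<phi> ?x $$ (0, l) * ?H $$ (l, k) = (if l = k then T m k else 0)"
      unfolding e using Suc.IH[OF m l] k l \<open>k < n\<close> UT_diag[OF H, of k] UT_lower[OF H, of k l] by cases auto
  qed
  also have "\<dots> - \<phi> ?x $$ (0, k) = 0"
    using unit[OF x k(1) m xe] k(1) by simp
  finally show ?case .
qed

text \<open>Triangularity of \<open>T\<close> is what makes the block matrix an element of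
  \<open>TT\<close>. The \<open>t\<close> delivered here is the inverse of the block matrix, which
  \<open>\<psi>\<close> has conjugated by.\<close>

lemma PC_map_normalization:
  fixes \<phi> :: "'a::field mat \<Rightarrow> 'a mat"
  assumes n: "4 \<le> n" and two: "(2::'a) \<noteq> 0" and \<phi>: "PC_map n \<phi>"
    and K: "\<phi> ` K1 n \<subseteq> K1 n" "\<phi> ` K2 n \<subseteq> K2 n"
  obtains t \<theta> \<psi> where "t \<in> TT n" "field_automorphism \<theta>" "normalized n \<psi>"
    "\<And>a. a \<in> UT n \<Longrightarrow> \<phi> a = t * map_mat \<theta> (\<psi> a) * minv t"
proof -
  let ?I = "{1..<n - 1}"
  note D = PC_mapD[OF \<phi>] and img = PC_map_K_images[OF n two \<phi> K]
  obtain \<zeta> where \<zeta>: "bij \<zeta>" "\<And>a. \<phi> (tv n 0 (n - 1) a) = tv n 0 (n - 1) (\<zeta> a)"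
    using PC_map_corner[OF n \<phi>] by blast
  have surj1: "\<exists>x\<in>D1 n. \<forall>i\<in>?I. x $$ (0, i) = v i" for v :: "nat \<Rightarrow> 'a"
  proof (rule bexI)
    show "rowm n (\<lambda>j. if j = 0 then 0 else v j) 0 \<in> D1 n" by (rule D1_I) auto
    show "\<forall>i\<in>?I. rowm n (\<lambda>j. if j = 0 then 0 else v j) 0 $$ (0, i) = v i" by (auto simp: rowm_entry)
  qed
  have surj2: "\<exists>y\<in>D2 n. \<forall>i\<in>?I. y $$ (i, n - 1) = v i" for v :: "nat \<Rightarrow> 'a"
  proof (rule bexI)
    show "colm n (\<lambda>j. if j = n - 1 then 0 else v j) 0 \<in> D2 n" by (rule D2_I) auto
    show "\<forall>i\<in>?I. colm n (\<lambda>j. if j = n - 1 then 0 else v j) 0 $$ (i, n - 1) = v i" by (auto simp: colm_entry)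
  qed
  have surj1': "\<exists>x\<in>D1 n. \<forall>i\<in>?I. \<phi> x $$ (0, i) = v i" for v
  proof -
    obtain x where x: "x \<in> D1 n" "\<forall>i\<in>?I. x $$ (0, i) = v i" using surj1 by blast
    then obtain x' where "x' \<in> D1 n" "x = \<phi> x'" using img(5) by blast
    then show ?thesis using x(2) by blast
  qed
  have surj2': "\<exists>y\<in>D2 n. \<forall>i\<in>?I. \<phi> y $$ (i, n - 1) = v i" for v
  proof -
    obtain x where x: "x \<in> D2 n" "\<forall>i\<in>?I. x $$ (i, n - 1) = v i" using surj2 by blast
    then obtain x' where "x' \<in> D2 n" "x = \<phi> x'" using img(6) by blast
    then show ?thesis using x(2) by blast
  qed
  have pair: "(\<Sum>i\<in>?I. \<phi> x $$ (0, i) * \<phi> y $$ (i, n - 1)) = \<zeta> (\<Sum>i\<in>?I. x $$ (0, i) * y $$ (i, n - 1))"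
    if "x \<in> D1 n" "y \<in> D2 n" for x y
  proof -
    have "\<phi> x \<in> D1 n" "\<phi> y \<in> D2 n" 
      using imageI[OF that(1), of \<phi>] imageI[OF that(2), of \<phi>] img(5,6) by simp_all
    then have "tv n 0 (n - 1) (\<Sum>i\<in>?I. \<phi> x $$ (0, i) * \<phi> y $$ (i, n - 1)) = comm (\<phi> x) (\<phi> y)"
      by (intro comm_D1_D2[OF n, symmetric])
    also have "\<dots> = \<phi> (comm x y)"
      using D(2)[OF D1_D(1)[OF n that(1)] D2_D(1)[OF n that(2)]] by simp
    also have "\<dots> = tv n 0 (n - 1) (\<zeta> (\<Sum>i\<in>?I. x $$ (0, i) * y $$ (i, n - 1)))"
      unfolding comm_D1_D2[OF n that] \<zeta>(2) ..
    finally have "tv n 0 (n - 1) (\<Sum>i\<in>?I. \<phi> x $$ (0, i) * \<phi> y $$ (i, n - 1)) $$ (0, n - 1)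
        = tv n 0 (n - 1) (\<zeta> (\<Sum>i\<in>?I. x $$ (0, i) * y $$ (i, n - 1))) $$ (0, n - 1)" by simp
    then show ?thesis using n by (simp add: tv_entry)
  qed
  have I: "finite ?I" "1 \<in> ?I" "n - 2 \<in> ?I" "1 \<noteq> n - 2" using n by auto
  obtain \<theta> \<kappa> T T' where \<theta>: "field_automorphism \<theta>" and \<kappa>: "\<kappa> \<noteq> 0"
    and P: "\<And>x i. x \<in> D1 n \<Longrightarrow> i \<in> ?I \<Longrightarrow> \<phi> x $$ (0, i) = (\<Sum>j\<in>?I. \<theta> (x $$ (0, j)) * T j i)"
    and Q: "\<And>y i. y \<in> D2 n \<Longrightarrow> i \<in> ?I \<Longrightarrow> \<phi> y $$ (i, n - 1) = (\<Sum>j\<in>?I. T' i j * \<theta> (y $$ (j, n - 1)))"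
    and TT': "\<And>i j. i \<in> ?I \<Longrightarrow> j \<in> ?I \<Longrightarrow> (\<Sum>k\<in>?I. T i k * T' k j) = (if i = j then \<kappa> else 0)"
    by (rule pairing_semilinear[where p = "\<lambda>x i. x $$ (0, i)" and q = "\<lambda>y i. y $$ (i, n - 1)",
      OF I surj1 surj1' surj2 surj2' \<zeta>(1)]) (erule (1) pair, rule that)
  note \<theta>s = field_aut_simps[OF \<theta>]
  note tri = PC_map_triangular[OF n \<phi> img(5) \<theta> P]
  let ?t = "blockm n T \<kappa>" and ?s = "blockm n (\<lambda>i j. T' i j / \<kappa>) (1 / \<kappa>)"
  have ts: "?t * ?s = 1\<^sub>m n" by (rule blockm_inverse[OF n \<kappa> TT'])
  have ut: "upper_triangular ?t"
  proof (rule upper_triangularI)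
    fix i j assume ij: "j < i" "i < dim_row ?t"
    then have "i < n" "j < n" by (auto simp: blockm_def)
    then show "?t $$ (i, j) = 0" using ij tri[of i j] by (auto simp: blockm_entry)
  qed
  have t: "?t \<in> TT n" by (rule TT_I[OF blockm_carrier ut blockm_carrier ts])
  note tt = TT_facts[OF t]
  have mt: "minv ?t = ?s" by (rule minv_unique[OF blockm_carrier blockm_carrier ts])
  have st: "?s * ?t = 1\<^sub>m n" using tt(6) mt by simp
  let ?\<eta> = "inv_into UNIV \<theta>"
  define \<psi> where "\<psi> a = map_mat (?\<eta>) (?t * \<phi> a * minv ?t)" for a
  have PC: "PC_map n \<psi>"
    unfolding \<psi>_def
    by (intro PC_map_comp[OF field_aut_PC[OF field_aut_inv[OF \<theta>]]] PC_map_comp[OF conj_PC[OF t] \<phi>])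
  \<comment> \<open>Conjugates are identified through the intertwining relation, where no inverse
    occurs.\<close>
  have conj: "?t * X * minv ?t = Y" if "?t * X = Y * ?t" "Y \<in> carrier_mat n n" for X Y
  proof -
    have "?t * X * minv ?t = Y * (?t * minv ?t)" unfolding that(1) by (rule assoc_mult_mat[OF that(2) tt(1,4)])
    then show ?thesis using that(2) tt(5) by simp
  qed
  have rows: "\<psi> x \<in> D1 n \<and> (\<forall>k\<in>?I. \<psi> x $$ (0, k) = x $$ (0, k))" if x: "x \<in> D1 n" for x
  proof -
    obtain r c where r: "\<phi> x = rowm n r c" "r 0 = 0" "r 1 = 0 \<longrightarrow> c = 0"
      using imageI[OF x, of \<phi>] unfolding img(5) by (auto simp: D1_def)
    \<comment> \<open>The row of \<open>\<phi> x\<close> times the inverse block matrix. The hidden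
      entry is scaled by \<open>T 1 1 / \<kappa>\<close>, since triangularity makes column 1 of
      \<open>?t\<close> a multiple of a unit column.\<close>
    define \<rho> where "\<rho> j = (\<Sum>k<n. r k * ?s $$ (k, j))" for j
    let ?Y = "rowm n \<rho> (T 1 1 * c / \<kappa>)"
    have re: "r i = (\<Sum>j\<in>?I. \<theta> (x $$ (0, j)) * T j i)" if "i \<in> ?I" for i
      using P[OF x that] r(1) that by (auto simp: rowm_entry)
    have \<rho>0: "\<rho> 0 = 0"
      unfolding \<rho>_def using r(2) n by (intro sum.neutral) (auto simp: blockm_entry)
    have \<rho>I: "\<rho> j = \<theta> (x $$ (0, j))" if j: "j \<in> ?I" for j
    proof -
      have "\<rho> j = (\<Sum>k\<in>?I. r k * ?s $$ (k, j))"
        unfolding \<rho>_def using r(2) j n by (intro sum_inner) (auto simp: blockm_entry split: if_splits)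
      also have "\<dots> = (\<Sum>k\<in>?I. \<Sum>l\<in>?I. \<theta> (x $$ (0, l)) * (T l k * T' k j) / \<kappa>)"
        using j by (intro sum.cong refl) (auto simp: re blockm_entry sum_distrib_right sum_divide_distrib mult.assoc)
      also have "\<dots> = (\<Sum>l\<in>?I. \<Sum>k\<in>?I. \<theta> (x $$ (0, l)) * (T l k * T' k j) / \<kappa>)"
        by (rule sum.swap)
      also have "\<dots> = (\<Sum>l\<in>?I. \<theta> (x $$ (0, l)) * (\<Sum>k\<in>?I. T l k * T' k j) / \<kappa>)"
        by (simp only: sum_distrib_left sum_divide_distrib)
      also have "\<dots> = (\<Sum>l\<in>?I. if l = j then \<theta> (x $$ (0, j)) else 0)"
        using j \<kappa> by (intro sum.cong refl) (auto simp: TT'[unfolded One_nat_def])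
      also have "\<dots> = \<theta> (x $$ (0, j))" using j by simp
      finally show ?thesis .
    qed
    have "?t * \<phi> x = ?Y * ?t"
    proof (rule mat_eqI[OF sq_mult_carrier[OF blockm_carrier UT_carrier[OF D(1)[OF D1_D(1)[OF n x]]]]
          sq_mult_carrier[OF rowm_carrier blockm_carrier]])
      fix i j assume ij: "i < n" "j < n"
      have "(\<Sum>k<n. \<rho> k * ?t $$ (k, j)) = (\<Sum>k<n. \<Sum>l<n. r l * (?s $$ (l, k) * ?t $$ (k, j)))"
        by (simp add: \<rho>_def sum_distrib_right mult.assoc)
      also have "\<dots> = (\<Sum>l<n. \<Sum>k<n. r l * (?s $$ (l, k) * ?t $$ (k, j)))"
        by (rule sum.swap)
      also have "\<dots> = (\<Sum>l<n. r l * (?s * ?t) $$ (l, j))"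
        using ij by (intro sum.cong refl)
          (simp only: lessThan_iff mat_mult_entry[OF blockm_carrier blockm_carrier] sum_distrib_left)
      also have "\<dots> = (\<Sum>l<n. r l * (if l = j then 1 else 0))"
        unfolding st using ij by (intro sum.cong) auto
      also have "\<dots> = r j" using ij by (simp only: sum_delta_mult) simp
      finally have S: "(\<Sum>k<n. \<rho> k * ?t $$ (k, j)) = r j" .
      have "?t $$ (i, 0) = (if i = 0 then 1 else 0)" "?t $$ (i, 1) = (if i = 1 then T 1 1 else 0)"
        "?t $$ (n - 1, j) = (if j = n - 1 then \<kappa> else 0)"
        using ij n tri[of i 1] by (auto simp: blockm_entry)
      then show "(?t * \<phi> x) $$ (i, j) = (?Y * ?t) $$ (i, j)"
        unfolding r(1) rowm_mult_left[OF blockm_carrier n ij] rowm_mult_right[OF blockm_carrier n ij] S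
        using \<kappa> by auto
    qed
    then have "\<psi> x = rowm n (\<lambda>j. ?\<eta> (\<rho> j)) (?\<eta> (T 1 1 * c / \<kappa>))"
      unfolding \<psi>_def using conj[of "\<phi> x" ?Y] map_mat_rowm[OF field_aut_inv[OF \<theta>]] by simp
    moreover have "rowm n (\<lambda>j. ?\<eta> (\<rho> j)) (?\<eta> (T 1 1 * c / \<kappa>)) \<in> D1 n"
    proof (rule D1_I)
      note z = field_aut_simps(1,8)[OF field_aut_inv[OF \<theta>]]
      show "?\<eta> (\<rho> 0) = 0" using \<rho>0 z by simp
      show "?\<eta> (\<rho> 1) = 0 \<longrightarrow> ?\<eta> (T 1 1 * c / \<kappa>) = 0"
      proof
        \<comment> \<open>A vanishing (0, 1) entry puts \<open>x\<close> into \<open>R1\<close>,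
          hence also its image, and elements of \<open>R1\<close> have hidden entry zero.\<close>
        assume "?\<eta> (\<rho> 1) = 0"
        then have "x $$ (0, 1) = 0" using z \<rho>I[OF I(2)] \<theta>s(8) by simp
        then have "x \<notin> K1 n" using K1_D(2)[OF n] by blast
        then have "x \<in> R1 n" using x by (auto simp: D1_eq)
        then have "\<phi> x \<in> R1 n" using imageI[of x "R1 n" \<phi>] img(3) by simp
        then have "\<phi> x $$ (1, n - 1) = 0" using n by (auto simp: R1_def rowm_entry)
        then have "c = 0" using r(1) n by (simp add: rowm_entry split: if_splits)
        then show "?\<eta> (T 1 1 * c / \<kappa>) = 0" using z by simp
      qed
    qed
    ultimately show ?thesis using \<rho>I \<theta>s(10) by (auto simp: rowm_entry)
  qed
  have cols: "\<psi> y \<in> D2 n \<and> (\<forall>k\<in>?I. \<psi> y $$ (k, n - 1) = y $$ (k, n - 1))" if y: "y \<in> D2 n" for y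
  proof -
    obtain s d where s: "\<phi> y = colm n s d" "s (n - 1) = 0"
      using imageI[OF y, of \<phi>] unfolding img(6) by (auto simp: D2_def)
    \<comment> \<open>The column is multiplied by \<open>?t\<close> from the left and divided by the
      last diagonal entry of \<open>?t\<close>.\<close>
    define \<sigma> where "\<sigma> i = (\<Sum>k<n. ?t $$ (i, k) * s k) / \<kappa>" for i
    let ?M = "T (n - 2) (n - 2)"
    have N: "n - 2 < n" "n - 1 < n" "0 < n" "n - 2 \<noteq> n - 1" "n - 2 \<noteq> 0" "n - 1 \<noteq> 0" using n by auto
    have M: "?M \<noteq> 0" using tt(3)[OF N(1)] N by (simp add: blockm_entry split: if_splits)
    let ?Y = "colm n \<sigma> (d / ?M)"
    have se: "s i = (\<Sum>j\<in>?I. T' i j * \<theta> (y $$ (j, n - 1)))" if "i \<in> ?I" for i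
      using Q[OF y that] s(1) that by (auto simp: colm_entry)
    have \<sigma>N: "\<sigma> (n - 1) = 0"
      unfolding \<sigma>_def using s(2) N by (auto intro!: sum.neutral simp: blockm_entry)
    have \<sigma>I: "\<sigma> i = \<theta> (y $$ (i, n - 1))" if i: "i \<in> ?I" for i
    proof -
      have "(\<Sum>k<n. ?t $$ (i, k) * s k) = (\<Sum>k\<in>?I. ?t $$ (i, k) * s k)"
        using s(2) i by (intro sum_inner) (auto simp: blockm_entry)
      also have "\<dots> = (\<Sum>k\<in>?I. \<Sum>l\<in>?I. T i k * T' k l * \<theta> (y $$ (l, n - 1)))"
        using i by (intro sum.cong refl) (auto simp: se blockm_entry sum_distrib_left mult.assoc)
      also have "\<dots> = (\<Sum>l\<in>?I. \<Sum>k\<in>?I. T i k * T' k l * \<theta> (y $$ (l, n - 1)))"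
        by (rule sum.swap)
      also have "\<dots> = (\<Sum>l\<in>?I. (\<Sum>k\<in>?I. T i k * T' k l) * \<theta> (y $$ (l, n - 1)))"
        by (simp only: sum_distrib_right)
      also have "\<dots> = (\<Sum>l\<in>?I. if l = i then \<kappa> * \<theta> (y $$ (i, n - 1)) else 0)"
        using i by (intro sum.cong refl) (auto simp: TT'[unfolded One_nat_def])
      also have "\<dots> = \<kappa> * \<theta> (y $$ (i, n - 1))" using i by simp
      finally show ?thesis using \<kappa> by (simp add: \<sigma>_def)
    qed
    have "?t * \<phi> y = ?Y * ?t"
    proof (rule mat_eqI[OF sq_mult_carrier[OF blockm_carrier UT_carrier[OF D(1)[OF D2_D(1)[OF n y]]]]
          sq_mult_carrier[OF colm_carrier blockm_carrier]])
      fix i j assume ij: "i < n" "j < n"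
      have "?t $$ (i, 0) = (if i = 0 then 1 else 0)"
        using ij n by (auto simp: blockm_entry)
      \<comment> \<open>By triangularity the last block row reduces to its diagonal entry, which is
        why \<open>d\<close> is divided by \<open>?M\<close>.\<close>
      moreover have "?t $$ (n - 2, j) = (if j = n - 2 then ?M else 0)"
      proof (cases "j \<in> ?I")
        case True
        then have "j = n - 2 \<or> j < n - 2" by auto
        then show ?thesis using True ij N tri[of "n - 2" j] by (auto simp: blockm_entry)
      next
        case False
        then have "j \<noteq> n - 2" using I(3) by blast
        then show ?thesis using False ij N blockm_entry[OF N(1) ij(2), of T \<kappa>] by auto
      qed
      moreover have "?t $$ (n - 1, j) = (if j = n - 1 then \<kappa> else 0)"
        using ij N by (auto simp: blockm_entry)
      moreover have "\<sigma> i * \<kappa> = (\<Sum>k<n. ?t $$ (i, k) * s k)" using \<kappa> by (simp add: \<sigma>_def)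
      ultimately show "(?t * \<phi> y) $$ (i, j) = (?Y * ?t) $$ (i, j)"
        unfolding s(1) colm_mult_left[OF blockm_carrier n ij] colm_mult_right[OF blockm_carrier n ij]
        using M by auto
    qed
    then have e: "\<psi> y = colm n (\<lambda>j. ?\<eta> (\<sigma> j)) (?\<eta> (d / ?M))"
      unfolding \<psi>_def using conj[of "\<phi> y" ?Y] map_mat_colm[OF field_aut_inv[OF \<theta>]] by simp
    have "colm n (\<lambda>j. ?\<eta> (\<sigma> j)) (?\<eta> (d / ?M)) \<in> D2 n"
    proof (rule D2_I)
      note z = field_aut_simps(1,8)[OF field_aut_inv[OF \<theta>]]
      show "?\<eta> (\<sigma> (n - 1)) = 0" using \<sigma>N z by simp
      show "?\<eta> (\<sigma> (n - 2)) = 0 \<longrightarrow> ?\<eta> (d / ?M) = 0"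
      proof
        assume "?\<eta> (\<sigma> (n - 2)) = 0"
        then have "y $$ (n - 2, n - 1) = 0" using z \<sigma>I[OF I(3)] \<theta>s(8) by simp
        then have "y \<notin> K2 n" using K2_D(2)[OF n] by blast
        then have "y \<in> R2 n" using y by (auto simp: D2_eq)
        then have "\<phi> y \<in> R2 n" using imageI[of y "R2 n" \<phi>] img(4) by simp
        then obtain s' where "\<phi> y = colm n s' 0" by (auto simp: R2_def)
        then have "\<phi> y $$ (0, n - 2) = 0" using N colm_entry[OF N(3,1), of s' 0] by simp
        then have "d = 0" using s(1) N colm_entry[OF N(3,1), of s d] by simp
        then show "?\<eta> (d / ?M) = 0" using z by simp
      qed
    qed
    moreover have "colm n (\<lambda>j. ?\<eta> (\<sigma> j)) (?\<eta> (d / ?M)) $$ (k, n - 1) = y $$ (k, n - 1)"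
      if "k \<in> ?I" for k
    proof -
      have "k < n" "k \<noteq> n - 1" using that by auto
      then show ?thesis using N \<sigma>I[OF that] \<theta>s(10) by (simp add: colm_entry)
    qed
    ultimately show ?thesis unfolding e by blast
  qed
  have "normalized n \<psi>"
    unfolding normalized_def using PC rows cols by blast
  moreover have "\<phi> a = minv ?t * map_mat \<theta> (\<psi> a) * minv (minv ?t)" if "a \<in> UT n" for a
    unfolding \<psi>_def map_mat_inv_field_aut(1)[OF \<theta>] minv_minv[OF t]
    using conj_conj_minv(2)[OF t UT_carrier[OF D(1)[OF that]]] by simp
  ultimately show thesis using that[OF tt(8) \<theta>] by blast
qed

section \<open>Normalised PC-maps\<close>

text \<open>Commutators with such a matrix shift a column by one place, those with its inverse a
  row.\<close>

definition superdiag :: "nat \<Rightarrow> (nat \<Rightarrow> bool) \<Rightarrow> 'a::field mat" where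
  "superdiag n S = mat n n (\<lambda>(i, j). if i = j then 1 else if j = Suc i \<and> S i then 1 else 0)"

lemma superdiag_UT: "superdiag n S \<in> UT n"
  by (rule UT_I) (auto simp: superdiag_def)

lemma superdiag_entry:
  "i < n \<Longrightarrow> j < n \<Longrightarrow> superdiag n S $$ (i, j) = (if i = j then 1 else 0) + (if j = Suc i \<and> S i then 1 else 0)"
  by (simp add: superdiag_def)

lemma sum_unit:
  fixes f :: "nat \<Rightarrow> 'a::field"
  assumes "finite I" "k \<in> I"
  shows "(\<Sum>l\<in>I. f l * (if l = k then 1 else 0)) = f k" "(\<Sum>l\<in>I. (if l = k then 1 else 0) * f l) = f k"
  using assms by (simp_all add: if_distrib[of "\<lambda>x. x * _"] if_distrib[of "\<lambda>x. _ * x"] cong: if_cong)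

text \<open>The position (0, n - 2) has two roles: hidden entry of a column element and inner entry
  of a row element.\<close>

lemma tv_second_eq_rowm:
  "4 \<le> n \<Longrightarrow> colm n (\<lambda>i. if i = 0 then 0 else if i = 1 then 0 else 0) d = rowm n (\<lambda>l. if l = n - 2 then d else 0) 0"
  by (rule mat_eqI[of _ n]) (auto simp: colm_entry rowm_entry)

context
  fixes n :: nat and \<psi> :: "'a::field mat \<Rightarrow> 'a mat"
  assumes n: "4 \<le> n" and norm: "normalized n \<psi>"
begin

abbreviation (input) "I \<equiv> {1..<n - 1}"
abbreviation (input) "xk \<equiv> \<lambda>k. rowm n (\<lambda>l. if l = k then 1 else 0) 0 :: 'a mat"
abbreviation (input) "yk \<equiv> \<lambda>k. colm n (\<lambda>l. if l = k then 1 else 0) 0 :: 'a mat"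

text \<open>Normalisation leaves open the last entry of a row, the top entry of a column, and the
  hidden entries.\<close>

lemma norm_PC: "PC_map n \<psi>"
  and norm_D1: "x \<in> D1 n \<Longrightarrow> \<psi> x \<in> D1 n" "x \<in> D1 n \<Longrightarrow> k \<in> I \<Longrightarrow> \<psi> x $$ (0, k) = x $$ (0, k)"
  and norm_D2: "y \<in> D2 n \<Longrightarrow> \<psi> y \<in> D2 n" "y \<in> D2 n \<Longrightarrow> k \<in> I \<Longrightarrow> \<psi> y $$ (k, n - 1) = y $$ (k, n - 1)"
  using norm by (auto simp: normalized_def)

lemma norm_UT: "g \<in> UT n \<Longrightarrow> \<psi> g \<in> UT n"
  by (rule PC_mapD(1)[OF norm_PC])

lemma unit_row: "k \<in> I \<Longrightarrow> xk k \<in> D1 n" "k \<in> I \<Longrightarrow> l \<in> I \<Longrightarrow> xk k $$ (0, l) = (if l = k then 1 else 0)"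
    "k \<in> I \<Longrightarrow> xk k $$ (1, n - 1) = 0"
  using n by (auto simp: rowm_entry intro!: D1_I)

lemma unit_col: "k \<in> I \<Longrightarrow> yk k \<in> D2 n" "k \<in> I \<Longrightarrow> l \<in> I \<Longrightarrow> yk k $$ (l, n - 1) = (if l = k then 1 else 0)"
    "k \<in> I \<Longrightarrow> yk k $$ (0, n - 2) = 0"
proof -
  assume k: "k \<in> I"
  show "yk k \<in> D2 n" using k by (intro D2_I) auto
  show "yk k $$ (l, n - 1) = (if l = k then 1 else 0)" if "l \<in> I" using that by (auto simp: colm_entry)
  have "0 < n" "n - 2 < n" "0 \<noteq> n - 2" "n - 2 \<noteq> n - 1" using n by auto
  then show "yk k $$ (0, n - 2) = 0" by (simp add: colm_entry)
qed

text \<open>Every \<open>a\<close> is a value of the pairing, namely of \<open>a\<close> times unit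
  row 1 with unit column 1, and the pairing involves only entries fixed by
  \<open>\<psi>\<close>.\<close>

lemma norm_corner: "\<psi> (tv n 0 (n - 1) a) = tv n 0 (n - 1) a"
proof -
  let ?x = "rowm n (\<lambda>l. if l = 1 then a else 0) 0 :: 'a mat"
  have one: "1 \<in> I" using n by simp
  have x: "?x \<in> D1 n" by (rule D1_I) auto
  note y = unit_col(1)[OF one]
  have "(\<Sum>k\<in>I. ?x $$ (0, k) * yk 1 $$ (k, n - 1)) = (\<Sum>k\<in>I. ?x $$ (0, k) * (if k = 1 then 1 else 0))"
    using unit_col(2)[OF one] by (intro sum.cong) auto
  also have "\<dots> = ?x $$ (0, 1)" by (rule sum_unit(1)) (use one in auto)
  also have "\<dots> = a" using n by (simp add: rowm_entry)
  finally have S: "(\<Sum>k\<in>I. ?x $$ (0, k) * yk 1 $$ (k, n - 1)) = a" .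
  have "(\<Sum>k\<in>I. \<psi> ?x $$ (0, k) * \<psi> (yk 1) $$ (k, n - 1)) = (\<Sum>k\<in>I. ?x $$ (0, k) * yk 1 $$ (k, n - 1))"
    using norm_D1(2)[OF x] norm_D2(2)[OF y] by (intro sum.cong refl) simp
  then have "comm (\<psi> ?x) (\<psi> (yk 1)) = tv n 0 (n - 1) a"
    unfolding comm_D1_D2[OF n norm_D1(1)[OF x] norm_D2(1)[OF y]] S by simp
  then show ?thesis
    using PC_mapD(2)[OF norm_PC D1_D(1)[OF n x] D2_D(1)[OF n y]] comm_D1_D2[OF n x y] S by simp
qed

lemma norm_comm_D1:
  assumes g: "g \<in> UT n" and x: "x \<in> D1 n"
  shows "k \<in> I \<Longrightarrow> \<psi> (comm g x) $$ (0, k) = (\<Sum>l\<in>I. x $$ (0, l) * minv (\<psi> g) $$ (l, k)) - x $$ (0, k)"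
    "\<psi> (comm g x) $$ (0, n - 1) = (\<Sum>l\<in>I. x $$ (0, l) * minv (\<psi> g) $$ (l, n - 1)) + \<psi> x $$ (1, n - 1) * \<psi> g $$ (0, 1)"
proof -
  note c = comm_D1[OF n norm_UT[OF g] norm_D1(1)[OF x]]
  have e: "\<psi> (comm g x) = comm (\<psi> g) (\<psi> x)" by (rule PC_mapD(2)[OF norm_PC g D1_D(1)[OF n x]])
  have s: "(\<Sum>l\<in>I. \<psi> x $$ (0, l) * f l) = (\<Sum>l\<in>I. x $$ (0, l) * f l)" for f
    using norm_D1(2)[OF x] by (intro sum.cong) auto
  show "\<psi> (comm g x) $$ (0, k) = (\<Sum>l\<in>I. x $$ (0, l) * minv (\<psi> g) $$ (l, k)) - x $$ (0, k)" if "k \<in> I"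
    unfolding e c(2)[OF that] s norm_D1(2)[OF x that] ..
  show "\<psi> (comm g x) $$ (0, n - 1) = (\<Sum>l\<in>I. x $$ (0, l) * minv (\<psi> g) $$ (l, n - 1)) + \<psi> x $$ (1, n - 1) * \<psi> g $$ (0, 1)"
    unfolding e c(3) s ..
qed

lemma norm_comm_D2:
  assumes g: "g \<in> UT n" and y: "y \<in> D2 n"
  shows "k \<in> I \<Longrightarrow> \<psi> (comm g y) $$ (k, n - 1) = (\<Sum>l\<in>I. \<psi> g $$ (k, l) * y $$ (l, n - 1)) - y $$ (k, n - 1)"
    "\<psi> (comm g y) $$ (0, n - 1) = (\<Sum>l\<in>I. \<psi> g $$ (0, l) * y $$ (l, n - 1)) - \<psi> y $$ (0, n - 2) * \<psi> g $$ (n - 2, n - 1)"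
proof -
  note c = comm_D2[OF n norm_UT[OF g] norm_D2(1)[OF y]]
  have e: "\<psi> (comm g y) = comm (\<psi> g) (\<psi> y)" by (rule PC_mapD(2)[OF norm_PC g D2_D(1)[OF n y]])
  have s: "(\<Sum>l\<in>I. f l * \<psi> y $$ (l, n - 1)) = (\<Sum>l\<in>I. f l * y $$ (l, n - 1))" for f
    using norm_D2(2)[OF y] by (intro sum.cong) auto
  show "\<psi> (comm g y) $$ (k, n - 1) = (\<Sum>l\<in>I. \<psi> g $$ (k, l) * y $$ (l, n - 1)) - y $$ (k, n - 1)" if "k \<in> I"
    unfolding e c(2)[OF that] s norm_D2(2)[OF y that] ..
  show "\<psi> (comm g y) $$ (0, n - 1) = (\<Sum>l\<in>I. \<psi> g $$ (0, l) * y $$ (l, n - 1)) - \<psi> y $$ (0, n - 2) * \<psi> g $$ (n - 2, n - 1)"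
    unfolding e c(3) s ..
qed

lemma sum_unit_row: "k \<in> I \<Longrightarrow> (\<Sum>l\<in>I. xk k $$ (0, l) * f l) = f k"
proof -
  assume k: "k \<in> I"
  have "(\<Sum>l\<in>I. xk k $$ (0, l) * f l) = (\<Sum>l\<in>I. (if l = k then 1 else 0) * f l)"
    using unit_row(2)[OF k] by (intro sum.cong) auto
  then show ?thesis using sum_unit(2)[of I k f] k by simp
qed

lemma sum_unit_col: "k \<in> I \<Longrightarrow> (\<Sum>l\<in>I. f l * yk k $$ (l, n - 1)) = f k"
proof -
  assume k: "k \<in> I"
  have "(\<Sum>l\<in>I. f l * yk k $$ (l, n - 1)) = (\<Sum>l\<in>I. f l * (if l = k then 1 else 0))"
    using unit_col(2)[OF k] by (intro sum.cong) auto
  then show ?thesis using sum_unit(1)[of I k f] k by simp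
qed

text \<open>The commutator with unit column k has as inner entries those of column k of
  \<open>g\<close> minus the unit column, and \<open>\<psi>\<close> fixes them; unit rows give the
  same for the inverse.\<close>

lemma norm_middle:
  assumes g: "g \<in> UT n" and ik: "i \<in> I" "k \<in> I"
  shows "\<psi> g $$ (i, k) = g $$ (i, k)" "minv (\<psi> g) $$ (i, k) = minv g $$ (i, k)"
proof -
  note y = unit_col(1)[OF ik(2)] and x = unit_row(1)[OF ik(1)]
  have "comm g (yk k) \<in> D2 n" using comm_D2(1)[OF n g y] R2_subset by blast
  from norm_D2(2)[OF this ik(1)] show "\<psi> g $$ (i, k) = g $$ (i, k)"
    unfolding norm_comm_D2(1)[OF g y ik(1)] comm_D2(2)[OF n g y ik(1)]
      sum_unit_col[OF ik(2)] by simp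
  have "comm g (xk i) \<in> D1 n" using comm_D1(1)[OF n g x] R1_subset by blast
  from norm_D1(2)[OF this ik(2)] show "minv (\<psi> g) $$ (i, k) = minv g $$ (i, k)"
    unfolding norm_comm_D1(1)[OF g x ik(2)] comm_D1(2)[OF n g x ik(2)]
      sum_unit_row[OF ik(1)] by simp
qed

text \<open>Unit column 1 and unit row n - 2 are second central, so their commutators with
  \<open>g\<close> are corner elements, fixed by \<open>\<psi>\<close>. Their images have hidden
  entry zero because 1 and n - 2 differ.\<close>

lemma norm_ends:
  assumes g: "g \<in> UT n"
  shows "\<psi> g $$ (0, 1) = g $$ (0, 1)" "\<psi> g $$ (n - 2, n - 1) = g $$ (n - 2, n - 1)"
proof -
  have I: "1 \<in> I" "n - 2 \<in> I" "1 \<noteq> n - 2" using n by auto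
  have corner: "tv n 0 (n - 1) a $$ (0, n - 1) = a" for a :: 'a using n by (simp add: tv_entry)
  have "yk 1 = colm n (\<lambda>i. if i = 0 then 0 else if i = 1 then 1 else 0) 0" by (rule colm_eqI) auto
  then have "comm g (yk 1) = tv n 0 (n - 1) (g $$ (0, 1))"
    using comm_second_central[OF n g, of 0 1 0] by simp
  then have "\<psi> (comm g (yk 1)) $$ (0, n - 1) = g $$ (0, 1)" using norm_corner corner by simp
  moreover have "\<psi> (yk 1) $$ (0, n - 2) = 0"
    using D2_D(2)[OF n norm_D2(1)[OF unit_col(1)[OF I(1)]]] norm_D2(2)[OF unit_col(1)[OF I(1)] I(2)]
      unit_col(2)[OF I(1,2)] I(3) by simp
  ultimately show e: "\<psi> g $$ (0, 1) = g $$ (0, 1)"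
    using norm_comm_D2(2)[OF g unit_col(1)[OF I(1)]] sum_unit_col[OF I(1), of "\<lambda>l. \<psi> g $$ (0, l)"] by simp
  have "xk (n - 2) = colm n (\<lambda>i. if i = 0 then 0 else if i = 1 then 0 else 0) 1"
    unfolding tv_second_eq_rowm[OF n] ..
  then have "comm g (xk (n - 2)) = tv n 0 (n - 1) (- g $$ (n - 2, n - 1))"
    using comm_second_central[OF n g, of 0 0 1] by simp
  then have "\<psi> (comm g (xk (n - 2))) $$ (0, n - 1) = - g $$ (n - 2, n - 1)" using norm_corner corner by simp
  moreover have "\<psi> (xk (n - 2)) $$ (1, n - 1) = 0"
    using D1_D(2)[OF n norm_D1(1)[OF unit_row(1)[OF I(2)]]] norm_D1(2)[OF unit_row(1)[OF I(2)] I(1)]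
      unit_row(2)[OF I(2,1)] I(3) by simp
  ultimately have "minv (\<psi> g) $$ (n - 2, n - 1) = - g $$ (n - 2, n - 1)"
    using norm_comm_D1(2)[OF g unit_row(1)[OF I(2)]] sum_unit_row[OF I(2), of "\<lambda>l. minv (\<psi> g) $$ (l, n - 1)"] by simp
  moreover have "Suc (n - 2) = n - 1" using n by simp
  ultimately show "\<psi> g $$ (n - 2, n - 1) = g $$ (n - 2, n - 1)"
    using minv_superdiag[OF norm_UT[OF g], of "n - 2"] n by simp
qed

text \<open>On \<open>R2\<close> the map \<open>\<psi>\<close> changes only the corner entry, and it does so linearly, since every element of
  \<open>R2\<close> is a commutator with one fixed matrix. The coefficients are those of the inner automorphism
  that is still to be divided out.\<close>

lemma norm_R2_linear:
  obtains f where "f 0 = 0" "f (n - 1) = 0"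
    "\<And>z. z \<in> R2 n \<Longrightarrow> \<psi> z $$ (0, n - 1) = z $$ (0, n - 1) + (\<Sum>i\<in>I. f i * z $$ (i, n - 1))"
proof -
  \<comment> \<open>The last superdiagonal entry is kept at 0, so that the unknown hidden entry of
    the image is multiplied by 0 in the commutator formula.\<close>
  let ?J = "superdiag n (\<lambda>i. i < n - 2) :: 'a mat"
  define f where "f i = (if i \<in> {1..<n - 2} then \<psi> ?J $$ (0, Suc i) else 0)" for i
  have J: "?J \<in> UT n" by (rule superdiag_UT)
  have N: "n - 2 < n" "n - 1 < n" "0 < n" "n - 2 \<noteq> n - 1" using n by auto
  have "\<psi> z $$ (0, n - 1) = z $$ (0, n - 1) + (\<Sum>i\<in>I. f i * z $$ (i, n - 1))" if z: "z \<in> R2 n" for z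
  proof -
    obtain v where v: "z = colm n v 0" "v (n - 1) = 0" "v (n - 2) = 0" using z by (auto simp: R2_def)
    \<comment> \<open>The commutator with \<open>?J\<close> moves \<open>s\<close> up one place and
      so returns \<open>v\<close>, whose entry at n - 2 is zero in \<open>R2\<close>.\<close>
    define s where "s k = (if k \<in> I then v (k - 1) else 0)" for k
    have s: "s (n - 1) = 0" by (simp add: s_def)
    have y: "colm n s 0 \<in> D2 n" using s by (intro D2_I) auto
    have "comm ?J (colm n s 0) = z"
      unfolding comm_colm(1)[of n s, OF n s J] v(1)
    proof (rule colm_eqI)
      fix i assume i: "i < n"
      have "(\<Sum>k<n. ?J $$ (i, k) * s k) = (\<Sum>k<n. (if i = k then 1 else 0) * s k
          + (if k = Suc i then (if i < n - 2 then 1 else 0) else 0) * s k)"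
        using i by (intro sum.cong refl) (auto simp: superdiag_entry)
      also have "\<dots> = s i + (if i < n - 2 then s (Suc i) else 0)"
        using i by (simp only: sum.distrib sum_delta_mult) auto
      finally show "(\<Sum>k<n. ?J $$ (i, k) * s k) - s i - (if i = 0 then 0 * ?J $$ (n - 2, n - 1) else 0) = v i"
        using i v(2,3) by (cases "i < n - 2"; cases "i = n - 2"; cases "i = n - 1") (auto simp: s_def)
    qed simp
    then have "\<psi> z $$ (0, n - 1) = (\<Sum>l\<in>I. \<psi> ?J $$ (0, l) * colm n s 0 $$ (l, n - 1))"
      using norm_comm_D2(2)[OF J y] norm_ends(2)[OF J] N by (simp add: superdiag_entry)
    also have "\<dots> = (\<Sum>l\<in>I. \<psi> ?J $$ (0, l) * v (l - 1))"
      by (intro sum.cong refl) (auto simp: colm_entry s_def)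
    \<comment> \<open>The summand at 1 is the corner entry of \<open>z\<close>, with coefficient 1;
      the rest is the linear part.\<close>
    also have "I = insert 1 {Suc 1..<Suc (n - 2)}" using n by auto
    also have "(\<Sum>l\<in>insert 1 {Suc 1..<Suc (n - 2)}. \<psi> ?J $$ (0, l) * v (l - 1))
        = \<psi> ?J $$ (0, 1) * v 0 + (\<Sum>l\<in>{Suc 1..<Suc (n - 2)}. \<psi> ?J $$ (0, l) * v (l - 1))"
      by simp
    also have "\<psi> ?J $$ (0, 1) = 1" using norm_ends(1)[OF J] n by (simp add: superdiag_entry)
    also have "(\<Sum>l\<in>{Suc 1..<Suc (n - 2)}. \<psi> ?J $$ (0, l) * v (l - 1)) = (\<Sum>i\<in>{1..<n - 2}. f i * v i)"
      unfolding sum.shift_bounds_Suc_ivl by (intro sum.cong) (auto simp: f_def)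
    also have "\<dots> = (\<Sum>i\<in>I. f i * v i)"
      by (rule sum.mono_neutral_left) (auto simp: f_def)
    also have "\<dots> = (\<Sum>i\<in>I. f i * z $$ (i, n - 1))"
      using v(1) by (intro sum.cong) (auto simp: colm_entry)
    finally show ?thesis using v(1) n by (simp add: colm_entry)
  qed
  moreover have "f 0 = 0" "f (n - 1) = 0" by (auto simp: f_def)
  ultimately show thesis by (intro that[of f])
qed

text \<open>Row version. Rows see the inverse, so the fixed matrix is the inverse of a superdiagonal
  one; its zero at (0, 1) again suppresses the unknown hidden entry.\<close>

lemma norm_R1_linear:
  obtains f where "f 0 = 0" "f (n - 1) = 0"
    "\<And>z. z \<in> R1 n \<Longrightarrow> \<psi> z $$ (0, n - 1) = z $$ (0, n - 1) + (\<Sum>j\<in>I. z $$ (0, j) * f j)"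
proof -
  let ?J = "superdiag n (\<lambda>i. 0 < i) :: 'a mat"
  let ?g = "minv ?J" and ?h = "minv (\<psi> (minv ?J))"
  define f where "f j = (if j \<in> {2..<n - 1} then ?h $$ (j - 1, n - 1) else 0)" for j
  have J: "?J \<in> UT n" by (rule superdiag_UT)
  have g: "?g \<in> UT n" by (rule UT_minv(1)[OF J])
  have gJ: "minv ?g = ?J" by (rule minv_minv[OF UT_subset_TT[OF J]])
  have N: "n - 2 < n" "n - 1 < n" "0 < n" "n - 2 \<noteq> n - 1" "Suc (n - 2) = n - 1" using n by auto
  have g01: "?g $$ (0, 1) = 0" using minv_superdiag[OF J, of 0] n by (simp add: superdiag_entry)
  have gN: "?g $$ (n - 2, n - 1) = - 1"
    using minv_superdiag[OF J, of "n - 2"] n N by (simp add: superdiag_entry)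
  have hN: "?h $$ (n - 2, n - 1) = 1"
    using minv_superdiag[OF norm_UT[OF g], of "n - 2"] norm_ends(2)[OF g] gN N by simp
  have "\<psi> z $$ (0, n - 1) = z $$ (0, n - 1) + (\<Sum>j\<in>I. z $$ (0, j) * f j)" if z: "z \<in> R1 n" for z
  proof -
    obtain v where v: "z = rowm n v 0" "v 0 = 0" "v 1 = 0" using z by (auto simp: R1_def)
    define s where "s k = (if k \<in> I then v (Suc k) else 0)" for k
    have s: "s 0 = 0" by (simp add: s_def)
    have x: "rowm n s 0 \<in> D1 n" using s by (intro D1_I) auto
    have "comm ?g (rowm n s 0) = z"
      unfolding comm_rowm(1)[of n s, OF n s g] v(1) gJ
    proof (rule rowm_eqI)
      fix j assume j: "j < n"
      have "(\<Sum>k<n. s k * ?J $$ (k, j)) = (\<Sum>k<n. s k * (if k = j then 1 else 0)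
          + s k * (if k = j - 1 then (if 1 < j then 1 else 0) else 0))"
        using j by (intro sum.cong refl) (auto simp: superdiag_entry)
      also have "\<dots> = s j + (if 1 < j then s (j - 1) else 0)"
        using j by (simp only: sum.distrib sum_delta_mult) auto
      finally have "(\<Sum>k<n. s k * ?J $$ (k, j)) = s j + (if 1 < j then s (j - 1) else 0)" .
      show "(\<Sum>k<n. s k * ?J $$ (k, j)) - s j + (if j = n - 1 then 0 * ?g $$ (0, 1) else 0) = v j"
      proof -
        consider "j = 0" | "j = 1" | "1 < j" "j - 1 \<in> I" "Suc (j - 1) = j" using j by force
        then have "(if 1 < j then s (j - 1) else 0) = v j" using v(2,3) by cases (auto simp: s_def)
        moreover have "(if j = n - 1 then 0 * ?g $$ (0, 1) else 0) = 0" by simp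
        ultimately show ?thesis
          using \<open>(\<Sum>k<n. s k * ?J $$ (k, j)) = s j + (if 1 < j then s (j - 1) else 0)\<close>
          by (simp only: add_diff_cancel_left' add_0_right)
      qed
    qed simp
    then have "\<psi> z $$ (0, n - 1) = (\<Sum>l\<in>I. rowm n s 0 $$ (0, l) * ?h $$ (l, n - 1))"
      using norm_comm_D1(2)[OF g x] norm_ends(1)[OF g] g01 by simp
    also have "\<dots> = (\<Sum>l\<in>I. v (Suc l) * ?h $$ (l, n - 1))"
      by (intro sum.cong refl) (auto simp: rowm_entry s_def)
    \<comment> \<open>Here it is the last summand that yields the corner entry of
      \<open>z\<close>.\<close>
    also have "I = insert (n - 2) {1..<n - 2}" using n by auto
    also have "(\<Sum>l\<in>insert (n - 2) {1..<n - 2}. v (Suc l) * ?h $$ (l, n - 1))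
        = v (n - 1) + (\<Sum>l\<in>{1..<n - 2}. v (Suc l) * ?h $$ (l, n - 1))"
      using hN N(5) by simp
    also have "(\<Sum>l\<in>{1..<n - 2}. v (Suc l) * ?h $$ (l, n - 1)) = (\<Sum>l\<in>{1..<n - 2}. v (Suc l) * f (Suc l))"
      by (intro sum.cong) (auto simp: f_def)
    also have "\<dots> = (\<Sum>j\<in>{Suc 1..<Suc (n - 2)}. v j * f j)"
      by (rule sum.shift_bounds_Suc_ivl[symmetric])
    also have "\<dots> = (\<Sum>j\<in>I. v j * f j)"
      using N(5) by (intro sum.mono_neutral_left) (auto simp: f_def)
    also have "\<dots> = (\<Sum>j\<in>I. z $$ (0, j) * f j)"
      using v(1) by (intro sum.cong) (auto simp: rowm_entry)
    finally show ?thesis using v(1) n by (simp add: rowm_entry)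
  qed
  moreover have "f 0 = 0" "f (n - 1) = 0" by (auto simp: f_def)
  ultimately show thesis by (intro that[of f])
qed

text \<open>Entry k of the first row of \<open>g\<close> is the corner of its commutator with unit
  column k. That commutator lies in \<open>R2\<close>, where \<open>\<psi>\<close> is known up to
  the linear form \<open>f\<close>. The scalar \<open>\<beta>\<close> is the hidden entry of the
  image of unit column n - 2; the other unit columns have images with hidden entry zero.\<close>

lemma norm_first_row:
  obtains f \<beta> where "f 0 = 0" "f (n - 1) = 0"
    "\<And>g k. g \<in> UT n \<Longrightarrow> k \<in> I \<Longrightarrow> \<psi> g $$ (0, k) = g $$ (0, k)
       + (\<Sum>i\<in>I. f i * g $$ (i, k)) - f k + (if k = n - 2 then \<beta> * g $$ (n - 2, n - 1) else 0)"
proof -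
  obtain f where f: "f 0 = 0" "f (n - 1) = 0"
    "\<And>z. z \<in> R2 n \<Longrightarrow> \<psi> z $$ (0, n - 1) = z $$ (0, n - 1) + (\<Sum>i\<in>I. f i * z $$ (i, n - 1))"
    by (rule norm_R2_linear) (rule that)
  let ?\<beta> = "\<psi> (yk (n - 2)) $$ (0, n - 2)"
  have M: "n - 2 \<in> I" using n by auto
  have "\<psi> g $$ (0, k) = g $$ (0, k)
       + (\<Sum>i\<in>I. f i * g $$ (i, k)) - f k + (if k = n - 2 then ?\<beta> * g $$ (n - 2, n - 1) else 0)"
    if g: "g \<in> UT n" and k: "k \<in> I" for g k
  proof -
    note y = unit_col(1)[OF k]
    have z: "comm g (yk k) $$ (i, n - 1) = g $$ (i, k) - (if i = k then 1 else 0)" if "i \<in> I" for i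
      unfolding comm_D2(2)[OF n g y that] sum_unit_col[OF k] unit_col(2)[OF k that] ..
    have z0: "comm g (yk k) $$ (0, n - 1) = g $$ (0, k)"
      unfolding comm_D2(3)[OF n g y] sum_unit_col[OF k] unit_col(3)[OF k] by simp
    have "(\<Sum>i\<in>I. f i * comm g (yk k) $$ (i, n - 1)) = (\<Sum>i\<in>I. f i * g $$ (i, k) - f i * (if i = k then 1 else 0))"
      using z by (intro sum.cong) (auto simp: right_diff_distrib)
    also have "\<dots> = (\<Sum>i\<in>I. f i * g $$ (i, k)) - f k"
      using sum_unit(1)[of I k f] k by (simp add: sum_subtractf)
    finally have "\<psi> (comm g (yk k)) $$ (0, n - 1) = g $$ (0, k) + (\<Sum>i\<in>I. f i * g $$ (i, k)) - f k"
      using f(3)[OF comm_D2(1)[OF n g y]] z0 by simp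
    moreover have "\<psi> (yk k) $$ (0, n - 2) = (if k = n - 2 then ?\<beta> else 0)"
      using D2_D(2)[OF n norm_D2(1)[OF y]] norm_D2(2)[OF y M] unit_col(2)[OF k M] by auto
    ultimately show ?thesis
      using norm_comm_D2(2)[OF g y] sum_unit_col[OF k, of "\<lambda>l. \<psi> g $$ (0, l)"] norm_ends(2)[OF g] by auto
  qed
  then show thesis by (rule that[OF f(1,2)])
qed

text \<open>Reflected version, about inverses because rows see the inverse; \<open>\<alpha>\<close>
  is the hidden entry of the image of unit row 1.\<close>

lemma norm_last_col:
  obtains f \<alpha> where "f 0 = 0" "f (n - 1) = 0"
    "\<And>g k. g \<in> UT n \<Longrightarrow> k \<in> I \<Longrightarrow> minv (\<psi> g) $$ (k, n - 1) = minv g $$ (k, n - 1)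
       + (\<Sum>j\<in>I. minv g $$ (k, j) * f j) - f k - (if k = 1 then \<alpha> * g $$ (0, 1) else 0)"
proof -
  obtain f where f: "f 0 = 0" "f (n - 1) = 0"
    "\<And>z. z \<in> R1 n \<Longrightarrow> \<psi> z $$ (0, n - 1) = z $$ (0, n - 1) + (\<Sum>j\<in>I. z $$ (0, j) * f j)"
    by (rule norm_R1_linear) (rule that)
  let ?\<alpha> = "\<psi> (xk 1) $$ (1, n - 1)"
  have M: "1 \<in> I" using n by simp
  have "minv (\<psi> g) $$ (k, n - 1) = minv g $$ (k, n - 1)
       + (\<Sum>j\<in>I. minv g $$ (k, j) * f j) - f k - (if k = 1 then ?\<alpha> * g $$ (0, 1) else 0)"
    if g: "g \<in> UT n" and k: "k \<in> I" for g k
  proof -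
    note x = unit_row(1)[OF k]
    have z: "comm g (xk k) $$ (0, j) = minv g $$ (k, j) - (if j = k then 1 else 0)" if "j \<in> I" for j
      unfolding comm_D1(2)[OF n g x that] sum_unit_row[OF k] unit_row(2)[OF k that] ..
    have z0: "comm g (xk k) $$ (0, n - 1) = minv g $$ (k, n - 1)"
      unfolding comm_D1(3)[OF n g x] sum_unit_row[OF k] unit_row(3)[OF k] by simp
    have "(\<Sum>j\<in>I. comm g (xk k) $$ (0, j) * f j) = (\<Sum>j\<in>I. minv g $$ (k, j) * f j - (if j = k then 1 else 0) * f j)"
      using z by (intro sum.cong) (auto simp: left_diff_distrib)
    also have "\<dots> = (\<Sum>j\<in>I. minv g $$ (k, j) * f j) - f k"
      using sum_unit(2)[of I k f] k by (simp add: sum_subtractf)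
    finally have "\<psi> (comm g (xk k)) $$ (0, n - 1) = minv g $$ (k, n - 1) + (\<Sum>j\<in>I. minv g $$ (k, j) * f j) - f k"
      using f(3)[OF comm_D1(1)[OF n g x]] z0 by simp
    moreover have "\<psi> (xk k) $$ (1, n - 1) = (if k = 1 then ?\<alpha> else 0)"
      using D1_D(2)[OF n norm_D1(1)[OF x]] norm_D1(2)[OF x M] unit_row(2)[OF k M] by auto
    ultimately have "minv (\<psi> g) $$ (k, n - 1) + (if k = 1 then ?\<alpha> else 0) * g $$ (0, 1)
        = minv g $$ (k, n - 1) + (\<Sum>j\<in>I. minv g $$ (k, j) * f j) - f k"
      using norm_comm_D1(2)[OF g x] unfolding sum_unit_row[OF k] norm_ends(1)[OF g] by simp
    then show ?thesis by (cases "k = 1") (simp_all add: eq_diff_eq)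
  qed
  then show thesis by (rule that[OF f(1,2)])
qed

end

section \<open>Dividing out the inner automorphism\<close>

lemma rowm_minv:
  fixes f :: "nat \<Rightarrow> 'a::field"
  assumes n: "4 \<le> n" and f: "f 0 = 0"
  shows "minv (rowm n (\<lambda>j. - f j) 0) = rowm n f 0"
proof (rule minv_unique[OF rowm_carrier rowm_carrier], rule mat_eqI[OF sq_mult_carrier[OF rowm_carrier rowm_carrier]])
  fix i j assume ij: "i < n" "j < n"
  have "(\<Sum>k<n. - f k * rowm n f 0 $$ (k, j)) = (\<Sum>k<n. - f k * (if k = j then 1 else 0))"
    using ij f by (intro sum.cong) (auto simp: rowm_entry)
  also have "\<dots> = - f j" using ij by (simp only: sum_delta_mult) simp
  finally show "(rowm n (\<lambda>j. - f j) 0 * rowm n f 0) $$ (i, j) = 1\<^sub>m n $$ (i, j)"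
    unfolding rowm_mult_left[OF rowm_carrier n ij] using ij by (auto simp: rowm_entry)
qed auto

lemma colm_minv:
  fixes f :: "nat \<Rightarrow> 'a::field"
  assumes n: "4 \<le> n" and f: "f (n - 1) = 0"
  shows "minv (colm n f 0) = colm n (\<lambda>j. - f j) 0"
proof (rule minv_unique[OF colm_carrier colm_carrier], rule mat_eqI[OF sq_mult_carrier[OF colm_carrier colm_carrier]])
  fix i j assume ij: "i < n" "j < n"
  have "colm n (\<lambda>j. - f j) 0 $$ (n - 1, j) = (if j = n - 1 then 1 else 0)"
    using ij f n by (auto simp: colm_entry)
  then show "(colm n f 0 * colm n (\<lambda>j. - f j) 0) $$ (i, j) = 1\<^sub>m n $$ (i, j)"
    unfolding colm_mult_left[OF colm_carrier n ij] using ij by (auto simp: colm_entry)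
qed auto

lemma conj_rowm:
  fixes A :: "'a::field mat"
  assumes n: "4 \<le> n" and f: "f 0 = 0" and A: "A \<in> UT n" and ij: "i < n" "j < n"
  shows "(rowm n (\<lambda>j. - f j) 0 * A * rowm n f 0) $$ (i, j)
    = A $$ (i, j) + (if i = 0 then f j - (\<Sum>k<n. f k * A $$ (k, j)) else 0)"
proof -
  note Ac = UT_carrier[OF A]
  let ?B = "rowm n (\<lambda>j. - f j) 0 * A"
  have Bc: "?B \<in> carrier_mat n n" by (rule sq_mult_carrier[OF rowm_carrier Ac])
  have B: "?B \<in> UT n" by (rule UT_mult[OF rowm_UT[OF n] A]) (simp add: f)
  have "?B $$ (i, 0) = (if i = 0 then 1 else 0)"
    using UT_diag[OF B, of 0] UT_lower[OF B, of 0 i] ij n by auto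
  moreover have "?B $$ (i, j) = A $$ (i, j) - (if i = 0 then \<Sum>k<n. f k * A $$ (k, j) else 0)"
    unfolding rowm_mult_left[OF Ac n ij] by (auto simp: sum_negf)
  ultimately show ?thesis
    unfolding rowm_mult_right[OF Bc n ij] by auto
qed

lemma conj_colm:
  fixes A :: "'a::field mat"
  assumes n: "4 \<le> n" and f: "f (n - 1) = 0" and A: "A \<in> UT n" and ij: "i < n" "j < n"
  shows "(colm n f 0 * A * colm n (\<lambda>j. - f j) 0) $$ (i, j)
    = A $$ (i, j) + (if j = n - 1 then f i - (\<Sum>k<n. A $$ (i, k) * f k) else 0)"
proof -
  note Ac = UT_carrier[OF A]
  let ?B = "colm n f 0 * A"
  have Bc: "?B \<in> carrier_mat n n" by (rule sq_mult_carrier[OF colm_carrier Ac])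
  have AN: "A $$ (n - 1, k) = (if k = n - 1 then 1 else 0)" if "k < n" for k
    using UT_lower[OF A, of k "n - 1"] UT_diag[OF A, of "n - 1"] that by auto
  have B: "?B $$ (i, k) = A $$ (i, k) + (if k = n - 1 then f i else 0)" if "k < n" for k
    unfolding colm_mult_left[OF Ac n ij(1) that] AN[OF that] by auto
  have "(\<Sum>k<n. ?B $$ (i, k) * - f k) = - (\<Sum>k<n. A $$ (i, k) * f k)"
    unfolding sum_negf[symmetric] using f by (intro sum.cong) (auto simp: B simp del: index_mult_mat)
  then show ?thesis
    unfolding colm_mult_right[OF Bc n ij] B[OF ij(2)] by auto
qed

lemma sum_inner_last:
  fixes f :: "nat \<Rightarrow> 'a::comm_monoid_add"
  assumes "2 \<le> n" "f 0 = 0"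
  shows "(\<Sum>k<n. f k) = (\<Sum>k\<in>{1..<n - 1}. f k) + f (n - 1)"
proof -
  have "{..<n} = insert (n - 1) (insert 0 {1..<n - 1})" using assms by auto
  then show ?thesis using assms by (simp add: add.commute)
qed

text \<open>The linear forms \<open>f\<close> and \<open>f'\<close> are corrections of the kind
  produced by conjugating with a row and a column element, so conjugation by \<open>W\<close>
  removes them. The two terms caused by hidden entries remain.\<close>

lemma normalized_form:
  fixes \<psi> :: "'a::field mat \<Rightarrow> 'a mat"
  assumes n: "4 \<le> n" and norm: "normalized n \<psi>"
  obtains W \<alpha> \<beta> where "W \<in> UT n"
    "\<And>g i j. g \<in> UT n \<Longrightarrow> i < n \<Longrightarrow> j < n \<Longrightarrow> \<not> (i = 0 \<and> j = n - 1) \<Longrightarrow>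
      (W * \<psi> g * minv W) $$ (i, j) = g $$ (i, j) + (if i = 1 \<and> j = n - 1 then \<alpha> * g $$ (0, 1) else 0)
        + (if i = 0 \<and> j = n - 2 then \<beta> * g $$ (n - 2, n - 1) else 0)"
proof -
  let ?I = "{1..<n - 1}"
  obtain f \<beta> where f: "f 0 = 0" "f (n - 1) = 0"
    "\<And>g k. g \<in> UT n \<Longrightarrow> k \<in> ?I \<Longrightarrow> \<psi> g $$ (0, k) = g $$ (0, k)
       + (\<Sum>i\<in>?I. f i * g $$ (i, k)) - f k + (if k = n - 2 then \<beta> * g $$ (n - 2, n - 1) else 0)"
    by (rule norm_first_row[OF n norm]) (rule that)
  obtain f' \<alpha> where f': "f' 0 = 0" "f' (n - 1) = 0"
    "\<And>g k. g \<in> UT n \<Longrightarrow> k \<in> ?I \<Longrightarrow> minv (\<psi> g) $$ (k, n - 1) = minv g $$ (k, n - 1)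
       + (\<Sum>j\<in>?I. minv g $$ (k, j) * f' j) - f' k - (if k = 1 then \<alpha> * g $$ (0, 1) else 0)"
    by (rule norm_last_col[OF n norm]) (rule that)
  let ?u = "rowm n f 0" and ?u' = "rowm n (\<lambda>j. - f j) 0" and ?V = "colm n f' 0" and ?V' = "colm n (\<lambda>j. - f' j) 0"
  \<comment> \<open>The row factor alters only row 0, so off the corner the column factor acts on
    original entries and the two corrections do not interfere.\<close>
  let ?W = "?V * ?u'"
  have V: "?V \<in> UT n" by (rule colm_UT[of n f', OF n f'(2)])
  have u': "?u' \<in> UT n" by (rule rowm_UT[OF n]) (simp add: f)
  have u: "?u \<in> UT n" by (rule rowm_UT[of n f, OF n f(1)])
  have W: "?W \<in> UT n" by (rule UT_mult[OF V u'])
  have mW: "minv ?W = ?u * ?V'"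
    unfolding UT_minv_mult[OF V u'] rowm_minv[of n f, OF n f(1)] colm_minv[of n f', OF n f'(2)] ..
  have entries: "(?W * X * minv ?W) $$ (i, j) = X $$ (i, j)
      + (if i = 0 then f j - (\<Sum>k\<in>?I. f k * X $$ (k, j)) else 0)
      + (if j = n - 1 then f' i - (\<Sum>k\<in>?I. X $$ (i, k) * f' k) else 0)"
    if X: "X \<in> UT n" and ij: "i < n" "j < n" "\<not> (i = 0 \<and> j = n - 1)" for X i j
  proof -
    let ?Y = "?u' * X * ?u"
    note Xc = UT_carrier[OF X]
    have Y: "?Y \<in> UT n" using X u u' by (intro UT_mult)
    have "?W * X * minv ?W = ?V * ?Y * ?V'"
      unfolding mW
      using Xc UT_carrier[OF u] UT_carrier[OF u'] UT_carrier[OF V] colm_carrier[of n "\<lambda>j. - f' j" 0]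
      by (simp add: assoc_mult_mat[of _ n n _ n _ n] del: rowm_carrier colm_carrier)
    then have "(?W * X * minv ?W) $$ (i, j) = ?Y $$ (i, j)
        + (if j = n - 1 then f' i - (\<Sum>k<n. ?Y $$ (i, k) * f' k) else 0)"
      using conj_colm[of n f', OF n f'(2) Y ij(1,2)] by simp
    moreover have "(\<Sum>k<n. ?Y $$ (i, k) * f' k) = (\<Sum>k\<in>?I. ?Y $$ (i, k) * f' k)"
      using f' by (intro sum_inner) auto
    moreover have "(\<Sum>k\<in>?I. ?Y $$ (i, k) * f' k) = (\<Sum>k\<in>?I. X $$ (i, k) * f' k)" if "i \<noteq> 0"
      using that ij conj_rowm[of n f, OF n f(1) X ij(1)] by (intro sum.cong) (auto simp del: index_mult_mat)
    moreover have "(\<Sum>k<n. f k * X $$ (k, j)) = (\<Sum>k\<in>?I. f k * X $$ (k, j))"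
      using f by (intro sum_inner) auto
    ultimately show ?thesis
      using conj_rowm[of n f, OF n f(1) X ij(1,2)] ij(3) by auto
  qed
  have main: "(?W * \<psi> g * minv ?W) $$ (i, j) = g $$ (i, j) + (if i = 1 \<and> j = n - 1 then \<alpha> * g $$ (0, 1) else 0)
        + (if i = 0 \<and> j = n - 2 then \<beta> * g $$ (n - 2, n - 1) else 0)"
    if g: "g \<in> UT n" and ij: "i < n" "j < n" "\<not> (i = 0 \<and> j = n - 1)" for g i j
  proof -
    let ?A = "\<psi> g" and ?H = "minv (\<psi> g)" and ?h = "minv g"
    have A: "?A \<in> UT n" by (rule norm_UT[OF n norm g])
    have H: "?H \<in> UT n" by (rule UT_minv(1)[OF A])
    have h: "?h \<in> UT n" by (rule UT_minv(1)[OF g])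
    note mid = norm_middle[OF n norm g]
    \<comment> \<open>\<open>?P\<close> is the inverse of \<open>?O\<close>, and it is the last
      column of \<open>?P\<close> that is under control.\<close>
    let ?O = "?W * ?A * minv ?W" and ?P = "?W * ?H * minv ?W"
    note WT = UT_subset_TT[OF W]
    have O: "?O \<in> UT n" and P: "?P \<in> UT n" using conj_UT[OF WT] A H by auto
    have OP: "?O * ?P = 1\<^sub>m n"
      using conj_mult[OF WT UT_carrier[OF A] UT_carrier[OF H]]
      unfolding UT_minv(2)[OF A] right_mult_one_mat[OF TT_facts(1)[OF WT]] TT_facts(5)[OF WT] by (rule sym)
    have Omid: "?O $$ (k, l) = g $$ (k, l)" if "k \<in> ?I" "l \<in> ?I" for k l
      using entries[OF A, of k l] mid(1)[OF that] that by auto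
    have PN: "?P $$ (l, n - 1) = ?h $$ (l, n - 1) - (if l = 1 then \<alpha> * g $$ (0, 1) else 0)" if "l \<in> ?I" for l
    proof -
      have "(\<Sum>k\<in>?I. ?H $$ (l, k) * f' k) = (\<Sum>k\<in>?I. ?h $$ (l, k) * f' k)"
        using mid(2)[OF that] by (intro sum.cong) auto
      then show ?thesis using entries[OF H, of l "n - 1"] f'(3)[OF g that] that n by auto
    qed
    consider "j < i" | "i = j" | "i = 0" "j \<in> ?I" | "i \<in> ?I" "j \<in> ?I" "i < j" | "i \<in> ?I" "j = n - 1"
      using ij by force
    then show ?thesis
    proof cases
      case 1
      then show ?thesis using UT_lower[OF O, of j i] UT_lower[OF g, of j i] ij by auto
    next
      case 2
      then show ?thesis using UT_diag[OF O, of i] UT_diag[OF g, of i] ij n by auto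
    next
      case 3
      have "(\<Sum>k\<in>?I. f k * ?A $$ (k, j)) = (\<Sum>k\<in>?I. f k * g $$ (k, j))"
        using mid(1)[OF _ 3(2)] by (intro sum.cong) auto
      then show ?thesis
        using entries[OF A ij] f(3)[OF g 3(2)] 3 by auto
    next
      case 4
      then show ?thesis using Omid[of i j] by auto
    next
      case 5
      have iN: "i < n" "n - 1 < n" "0 < i" "i \<noteq> n - 1" using 5 n by auto
      \<comment> \<open>The last column of \<open>?O\<close> is recovered by comparing the (i, n -
        1) entries of \<open>?O * ?P\<close> and \<open>g * ?h\<close>, both of which are the
        identity.\<close>
      have "(\<Sum>l<n. ?O $$ (i, l) * ?P $$ (l, n - 1)) = 0"
        using arg_cong[OF OP, of "\<lambda>m. m $$ (i, n - 1)"] iN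
        unfolding mat_mult_entry[OF UT_carrier[OF O] UT_carrier[OF P] iN(1,2)] by simp
      also have "(\<Sum>l<n. ?O $$ (i, l) * ?P $$ (l, n - 1))
          = (\<Sum>l\<in>?I. ?O $$ (i, l) * ?P $$ (l, n - 1)) + ?O $$ (i, n - 1)"
        using sum_inner_last[of n "\<lambda>l. ?O $$ (i, l) * ?P $$ (l, n - 1)"] UT_lower[OF O iN(3,1)] UT_diag[OF P iN(2)] n
        by simp
      also have "(\<Sum>l\<in>?I. ?O $$ (i, l) * ?P $$ (l, n - 1))
          = (\<Sum>l\<in>?I. g $$ (i, l) * ?h $$ (l, n - 1) - (if l = 1 then g $$ (i, 1) * (\<alpha> * g $$ (0, 1)) else 0))"
        by (rule sum.cong[OF refl]) (simp add: Omid[OF 5(1)] PN right_diff_distrib del: index_mult_mat One_nat_def)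
      also have "\<dots> = (\<Sum>l\<in>?I. g $$ (i, l) * ?h $$ (l, n - 1)) - g $$ (i, 1) * (\<alpha> * g $$ (0, 1))"
        using n by (simp add: sum_subtractf)
      finally have e: "(\<Sum>l\<in>?I. g $$ (i, l) * ?h $$ (l, n - 1)) - g $$ (i, 1) * (\<alpha> * g $$ (0, 1)) + ?O $$ (i, n - 1) = 0" .
      have "(\<Sum>l<n. g $$ (i, l) * ?h $$ (l, n - 1)) = 0"
        using arg_cong[OF UT_minv(2)[OF g], of "\<lambda>m. m $$ (i, n - 1)"] iN
        unfolding mat_mult_entry[OF UT_carrier[OF g] UT_carrier[OF h] iN(1,2)] by simp
      also have "(\<Sum>l<n. g $$ (i, l) * ?h $$ (l, n - 1)) = (\<Sum>l\<in>?I. g $$ (i, l) * ?h $$ (l, n - 1)) + g $$ (i, n - 1)"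
        using sum_inner_last[of n "\<lambda>l. g $$ (i, l) * ?h $$ (l, n - 1)"] UT_lower[OF g iN(3,1)] UT_diag[OF h iN(2)] n
        by simp
      finally have "?O $$ (i, n - 1) = g $$ (i, n - 1) + g $$ (i, 1) * (\<alpha> * g $$ (0, 1))"
        using e by (simp add: add_eq_0_iff)
      moreover have "g $$ (i, 1) = (if i = 1 then 1 else 0)"
        using UT_diag[OF g, of 1] UT_lower[OF g, of 1 i] iN n by auto
      ultimately show ?thesis using 5 iN by simp
    qed
  qed
  show thesis by (rule that[OF W main])
qed

section \<open>Superdiagonals and standard subcentral maps\<close>

lemma triangular_mult_superdiag:
  fixes A B :: "'a::field mat"
  assumes A: "A \<in> carrier_mat n n" "upper_triangular A"
    and B: "B \<in> carrier_mat n n" "upper_triangular B" and i: "Suc i < n"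
  shows "(A * B) $$ (i, Suc i) = A $$ (i, i) * B $$ (i, Suc i) + A $$ (i, Suc i) * B $$ (Suc i, Suc i)"
proof -
  have i': "i < n" using i by simp
  have "(A * B) $$ (i, Suc i) = (\<Sum>k<n. (if k = i then A $$ (i, i) * B $$ (i, Suc i) else 0)
    + (if k = Suc i then A $$ (i, Suc i) * B $$ (Suc i, Suc i) else 0))"
    unfolding mat_mult_entry[OF A(1) B(1) i' i]
  proof (rule sum.cong[OF refl])
    fix k assume k: "k \<in> {..<n}"
    consider "k < i" | "k = i" | "k = Suc i" | "Suc i < k" by linarith
    then show "A $$ (i, k) * B $$ (k, Suc i) = (if k = i then A $$ (i, i) * B $$ (i, Suc i) else 0)
      + (if k = Suc i then A $$ (i, Suc i) * B $$ (Suc i, Suc i) else 0)"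
      using upper_triangularD[OF A(2), of k i] upper_triangularD[OF B(2), of "Suc i" k] A(1) B(1) k i
      by cases auto
  qed
  then show ?thesis using i by (simp add: sum.distrib)
qed

lemma UT_upper: "A \<in> UT n \<Longrightarrow> upper_triangular A"
  by (simp add: UT_def)

lemma UT_mult_superdiag:
  fixes A B :: "'a::field mat"
  assumes "A \<in> UT n" "B \<in> UT n" "Suc i < n"
  shows "(A * B) $$ (i, Suc i) = A $$ (i, Suc i) + B $$ (i, Suc i)"
  using triangular_mult_superdiag[of A n B i] assms UT_diag[of A n i] UT_diag[of B n "Suc i"]
  by (simp add: UT_carrier UT_upper add.commute)

text \<open>Superdiagonal entries are additive on products, so they cancel.\<close>

lemma comm_superdiag:
  fixes x y :: "'a::field mat"
  assumes x: "x \<in> UT n" and y: "y \<in> UT n" and i: "Suc i < n"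
  shows "comm x y $$ (i, Suc i) = 0"
proof -
  have "(comm x y * (y * x)) $$ (i, Suc i) = (x * y) $$ (i, Suc i)"
    using comm_mult[OF x y] by simp
  then show ?thesis
    using UT_mult_superdiag[OF comm_UT[OF x y] UT_mult[OF y x] i]
      UT_mult_superdiag[OF x y i] UT_mult_superdiag[OF y x i] by simp
qed

lemma conj_superdiag:
  fixes t a :: "'a::field mat"
  assumes t: "t \<in> TT n" and a: "a \<in> UT n" and i: "Suc i < n"
  shows "(t * a * minv t) $$ (i, Suc i) = t $$ (i, i) * a $$ (i, Suc i) * minv t $$ (Suc i, Suc i)"
proof -
  note tt = TT_facts[OF t] and ac = UT_carrier[OF a] UT_upper[OF a]
  have tac: "t * a \<in> carrier_mat n n" "upper_triangular (t * a)"
    using tt ac upper_triangular_mult by auto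
  have i': "i < n" using i by simp
  have "t $$ (i, i) * minv t $$ (i, Suc i) + t $$ (i, Suc i) * minv t $$ (Suc i, Suc i) = 0"
    using triangular_mult_superdiag[OF tt(1,2) tt(4,7) i] tt(5) i by simp
  then show ?thesis
    using triangular_mult_superdiag[OF tac tt(4,7) i] triangular_mult_superdiag[OF tt(1,2) ac i]
      triangular_mult_entries(2)[OF tt(1,2) ac i'] UT_diag[OF a i'] UT_diag[OF a i]
    by (simp add: algebra_simps del: index_mult_mat)
qed

definition subcentral :: "nat \<Rightarrow> 'a::field \<Rightarrow> 'a \<Rightarrow> 'a mat \<Rightarrow> 'a mat" where
  "subcentral n \<alpha> \<beta> a =
     tv n 1 (n - 1) (\<alpha> * a $$ (0, 1)) * a * tv n 0 (n - 2) (\<beta> * a $$ (n - 2, n - 1))"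

lemma subcentral_UT:
  assumes n: "4 \<le> n" and a: "a \<in> UT n"
  shows "subcentral n \<alpha> \<beta> a \<in> UT n"
  unfolding subcentral_def using n a by (intro UT_mult tv_UT) auto

lemma subcentral_entry:
  fixes a :: "'a::field mat"
  assumes n: "4 \<le> n" and a: "a \<in> UT n" and ij: "i < n" "j < n"
  shows "subcentral n \<alpha> \<beta> a $$ (i, j) = a $$ (i, j)
    + (if i = 1 \<and> j = n - 1 then \<alpha> * a $$ (0, 1) else 0)
    + (if i = 0 \<and> j = n - 2 then \<beta> * a $$ (n - 2, n - 1) else 0)"
proof -
  let ?B = "tv n 1 (n - 1) (\<alpha> * a $$ (0, 1)) * a"
  note ac = UT_carrier[OF a]
  have Bc: "?B \<in> carrier_mat n n" by (rule sq_mult_carrier[OF tv_carrier ac])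
  have N: "n - 1 < n" "0 < n" using n by auto
  have B: "?B $$ (i, l) = a $$ (i, l) + (if i = 1 \<and> l = n - 1 then \<alpha> * a $$ (0, 1) else 0)" if "l < n" for l
    using tv_mult_left[OF ac ij(1) that N(1), of 1 "\<alpha> * a $$ (0, 1)"] UT_lower[OF a, of l "n - 1"]
      UT_diag[OF a N(1)] that by (cases "l = n - 1") auto
  have ai0: "a $$ (i, 0) = (if i = 0 then 1 else 0)"
    using UT_lower[OF a, of 0 i] UT_diag[OF a N(2)] ij by auto
  show ?thesis
    unfolding subcentral_def tv_mult_right[OF Bc ij N(2)] B[OF ij(2)] B[OF N(2)] ai0 using n by auto
qed

text \<open>The point is that the difference from \<open>x * y\<close> is symmetric in
  \<open>x\<close> and \<open>y\<close>. Its corner term is what prevents the map from being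
  multiplicative in general.\<close>

lemma subcentral_mult_entry:
  fixes x y :: "'a::field mat"
  assumes n: "4 \<le> n" and x: "x \<in> UT n" and y: "y \<in> UT n" and ij: "i < n" "j < n"
  shows "(subcentral n \<alpha> \<beta> x * subcentral n \<alpha> \<beta> y) $$ (i, j) = (x * y) $$ (i, j)
    + (if i = 1 \<and> j = n - 1 then \<alpha> * (x $$ (0, 1) + y $$ (0, 1)) else 0)
    + (if i = 0 \<and> j = n - 2 then \<beta> * (x $$ (n - 2, n - 1) + y $$ (n - 2, n - 1)) else 0)
    + (if i = 0 \<and> j = n - 1 then \<alpha> * x $$ (0, 1) * y $$ (0, 1) + \<beta> * x $$ (n - 2, n - 1) * y $$ (n - 2, n - 1) else 0)"
proof -
  let ?x = "subcentral n \<alpha> \<beta> x" and ?y = "subcentral n \<alpha> \<beta> y"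
  let ?a = "\<alpha> * x $$ (0, 1)" and ?b = "\<beta> * x $$ (n - 2, n - 1)"
  let ?a' = "\<alpha> * y $$ (0, 1)" and ?b' = "\<beta> * y $$ (n - 2, n - 1)"
  note xU = subcentral_UT[OF n x, of \<alpha> \<beta>] and yU = subcentral_UT[OF n y, of \<alpha> \<beta>]
  have N: "n - 1 < n" "n - 2 < n" "0 < n" "1 < n" "n - 2 \<noteq> n - 1" "n - 2 \<noteq> 0" "n - 2 \<noteq> 1" "n - 1 \<noteq> 0" "n - 1 \<noteq> 1"
    using n by auto
  have yN: "?y $$ (n - 1, j) = (if j = n - 1 then 1 else 0)"
    using UT_lower[OF yU, of j "n - 1"] UT_diag[OF yU N(1)] ij by auto
  have yM: "?y $$ (n - 2, j) = (if j = n - 2 then 1 else if j = n - 1 then y $$ (n - 2, n - 1) else 0)"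
  proof -
    consider "j < n - 2" | "j = n - 2" | "j = n - 1" using ij by linarith
    then show ?thesis
      using UT_lower[OF yU, of j "n - 2"] UT_diag[OF yU N(2)] subcentral_entry[OF n y N(2,1), of \<alpha> \<beta>] N
      by cases auto
  qed
  have xi0: "x $$ (i, 0) = (if i = 0 then 1 else 0)"
    using UT_lower[OF x, of 0 i] UT_diag[OF x N(3)] ij by auto
  have xi1: "x $$ (i, 1) = (if i = 1 then 1 else if i = 0 then x $$ (0, 1) else 0)"
    using UT_lower[OF x, of 1 i] UT_diag[OF x N(4)] ij by auto
  have "(?x * ?y) $$ (i, j) = (\<Sum>k<n. x $$ (i, k) * ?y $$ (k, j)
      + (if k = n - 1 then (if i = 1 then ?a else 0) else 0) * ?y $$ (k, j)
      + (if k = n - 2 then (if i = 0 then ?b else 0) else 0) * ?y $$ (k, j))"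
    unfolding mat_mult_entry[OF UT_carrier[OF xU] UT_carrier[OF yU] ij]
    by (rule sum.cong[OF refl]) (simp add: subcentral_entry[OF n x ij(1)] distrib_right)
  also have "\<dots> = (\<Sum>k<n. x $$ (i, k) * ?y $$ (k, j))
      + (if i = 1 then ?a else 0) * ?y $$ (n - 1, j) + (if i = 0 then ?b else 0) * ?y $$ (n - 2, j)"
    using N by (simp only: sum.distrib sum_delta_mult) simp
  also have "(\<Sum>k<n. x $$ (i, k) * ?y $$ (k, j)) = (\<Sum>k<n. x $$ (i, k) * y $$ (k, j)
      + x $$ (i, k) * (if k = 1 then (if j = n - 1 then ?a' else 0) else 0)
      + x $$ (i, k) * (if k = 0 then (if j = n - 2 then ?b' else 0) else 0))"
    by (rule sum.cong[OF refl]) (simp add: subcentral_entry[OF n y _ ij(2)] distrib_left)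
  also have "\<dots> = (x * y) $$ (i, j) + x $$ (i, 1) * (if j = n - 1 then ?a' else 0)
      + x $$ (i, 0) * (if j = n - 2 then ?b' else 0)"
    unfolding mat_mult_entry[OF UT_carrier[OF x] UT_carrier[OF y] ij]
    using N by (simp only: sum.distrib sum_delta_mult) simp
  finally show ?thesis
    unfolding yN yM xi0 xi1 using N by (auto simp: algebra_simps simp del: index_mult_mat)
qed

text \<open>Commutators have zero superdiagonal, so the map fixes them, and it remains to see that
  images have the same commutator as the originals. Both \<open>?x * ?y\<close> and
  \<open>?y * ?x\<close> differ from the original products by the same \<open>w\<close>, and left
  multiplication by the commutator fixes \<open>w\<close>.\<close>

lemma subcentral_PC:
  fixes \<alpha> \<beta> :: "'a::field"
  assumes n: "4 \<le> n"
  shows "PC_map n (subcentral n \<alpha> \<beta>)"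
  unfolding PC_map_def
proof (intro conjI ballI)
  have N: "n - 1 < n" "n - 2 < n" "0 < n" "1 < n" "n - 2 \<noteq> n - 1" "n - 2 \<noteq> 0" "n - 2 \<noteq> 1" "n - 1 \<noteq> 0" "n - 1 \<noteq> 1" "Suc (n - 2) = n - 1"
    using n by auto
  have inv: "subcentral n (- \<gamma>) (- \<delta>) (subcentral n \<gamma> \<delta> a) = a" if a: "a \<in> UT n" for a :: "'a mat" and \<gamma> \<delta>
  proof (rule mat_eqI)
    note b = subcentral_UT[OF n a, of \<gamma> \<delta>]
    show "subcentral n (- \<gamma>) (- \<delta>) (subcentral n \<gamma> \<delta> a) \<in> carrier_mat n n" "a \<in> carrier_mat n n"
      using subcentral_UT[OF n b] a by (auto intro: UT_carrier)
    fix i j assume ij: "i < n" "j < n"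
    show "subcentral n (- \<gamma>) (- \<delta>) (subcentral n \<gamma> \<delta> a) $$ (i, j) = a $$ (i, j)"
      unfolding subcentral_entry[OF n b ij] subcentral_entry[OF n a ij]
        subcentral_entry[OF n a N(3,4)] subcentral_entry[OF n a N(2,1)]
      using N(5-9) by (simp split: if_split)
  qed
  show "bij_betw (subcentral n \<alpha> \<beta>) (UT n) (UT n)"
  proof (rule bij_betw_byWitness[where f' = "subcentral n (- \<alpha>) (- \<beta>)"])
    show "\<forall>a\<in>UT n. subcentral n (- \<alpha>) (- \<beta>) (subcentral n \<alpha> \<beta> a) = a" using inv by blast
    show "\<forall>a\<in>UT n. subcentral n \<alpha> \<beta> (subcentral n (- \<alpha>) (- \<beta>) a) = a" using inv[of _ "- \<alpha>" "- \<beta>"] by simp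
  qed (auto intro: subcentral_UT[OF n])
  fix x y :: "'a mat" assume x: "x \<in> UT n" and y: "y \<in> UT n"
  let ?x = "subcentral n \<alpha> \<beta> x" and ?y = "subcentral n \<alpha> \<beta> y" and ?c = "comm x y"
  have c: "?c \<in> UT n" by (rule comm_UT[OF x y])
  have c0: "?c $$ (0, 1) = 0" "?c $$ (n - 2, n - 1) = 0"
    using comm_superdiag[OF x y, of 0] comm_superdiag[OF x y, of "n - 2"] N by auto
  have sx: "?x \<in> UT n" and sy: "?y \<in> UT n" using subcentral_UT[OF n] x y by auto
  have "subcentral n \<alpha> \<beta> ?c = ?c"
    by (rule mat_eqI[OF UT_carrier[OF subcentral_UT[OF n c]] UT_carrier[OF c]])
      (simp add: subcentral_entry[OF n c] c0[unfolded One_nat_def])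
  moreover have "comm ?x ?y = ?c"
  proof (rule comm_eqI[OF sx sy UT_carrier[OF c]])
    have yxU: "?y * ?x \<in> UT n" "?x * ?y \<in> UT n" "y * x \<in> UT n" using sx sy x y by (auto intro: UT_mult)
    define w where "w i j = (if i = 1 \<and> j = n - 1 then \<alpha> * (x $$ (0, 1) + y $$ (0, 1)) else 0)
      + (if i = 0 \<and> j = n - 2 then \<beta> * (x $$ (n - 2, n - 1) + y $$ (n - 2, n - 1)) else 0)
      + (if i = 0 \<and> j = n - 1 then \<alpha> * x $$ (0, 1) * y $$ (0, 1) + \<beta> * x $$ (n - 2, n - 1) * y $$ (n - 2, n - 1) else 0)"
      for i j :: nat
    have e: "(?x * ?y) $$ (i, j) = (x * y) $$ (i, j) + w i j" "(?y * ?x) $$ (i, j) = (y * x) $$ (i, j) + w i j"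
      if "i < n" "j < n" for i j
      unfolding subcentral_mult_entry[OF n x y that] subcentral_mult_entry[OF n y x that]
      by (simp_all add: w_def ac_simps del: index_mult_mat)
    show "?c * (?y * ?x) = ?x * ?y"
    proof (rule mat_eqI[OF sq_mult_carrier[OF UT_carrier[OF c] UT_carrier[OF yxU(1)]] UT_carrier[OF yxU(2)]])
      fix i j assume ij: "i < n" "j < n"
      have "(?c * (?y * ?x)) $$ (i, j) = (\<Sum>k<n. ?c $$ (i, k) * (y * x) $$ (k, j) + ?c $$ (i, k) * w k j)"
        unfolding mat_mult_entry[OF UT_carrier[OF c] UT_carrier[OF yxU(1)] ij]
        by (rule sum.cong[OF refl]) (simp add: e(2)[OF _ ij(2)] distrib_left del: index_mult_mat)
      also have "\<dots> = (?c * (y * x)) $$ (i, j) + (\<Sum>k<n. ?c $$ (i, k) * w k j)"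
        unfolding mat_mult_entry[OF UT_carrier[OF c] UT_carrier[OF yxU(3)] ij] sum.distrib ..
      \<comment> \<open>\<open>w\<close> lives in rows 0 and 1, and columns 0 and 1 of
        \<open>?c\<close> are unit columns since its (0, 1) entry vanishes.\<close>
      also have "(\<Sum>k<n. ?c $$ (i, k) * w k j) = (\<Sum>k<n. (if k = i then 1 else 0) * w k j)"
      proof (rule sum.cong[OF refl])
        fix k assume "k \<in> {..<n}"
        consider "k = 0" | "k = 1" | "2 \<le> k" by linarith
        then show "?c $$ (i, k) * w k j = (if k = i then 1 else 0) * w k j"
        proof cases
          case 1 then show ?thesis using UT_lower[OF c, of 0 i] UT_diag[OF c N(3)] ij by auto
        next
          case 2
          then show ?thesis
            using UT_lower[OF c, of 1 i] UT_diag[OF c N(4)] c0(1) ij by (cases "i = 0"; cases "i = 1") auto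
        next
          case 3 then show ?thesis by (auto simp: w_def)
        qed
      qed
      also have "\<dots> = w i j" using ij by (simp only: sum_delta_mult) simp
      finally show "(?c * (?y * ?x)) $$ (i, j) = (?x * ?y) $$ (i, j)"
        unfolding comm_mult[OF x y] e(1)[OF ij] .
    qed
  qed
  ultimately show "subcentral n \<alpha> \<beta> ?c = comm ?x ?y" by simp
qed

section \<open>Decomposition\<close>

text \<open>Tracks how a change of a single entry passes through a conjugation.\<close>

lemma mult_perturbed_entry:
  fixes t A X s :: "'a::field mat"
  assumes c: "t \<in> carrier_mat n n" "A \<in> carrier_mat n n" "X \<in> carrier_mat n n" "s \<in> carrier_mat n n"
    and pq: "p < n" "q < n"
    and X: "\<And>k l. k < n \<Longrightarrow> l < n \<Longrightarrow> X $$ (k, l) = A $$ (k, l) + (if k = p \<and> l = q then x else 0)"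
    and ij: "i < n" "j < n"
  shows "(t * X * s) $$ (i, j) = (t * A * s) $$ (i, j) + t $$ (i, p) * x * s $$ (q, j)"
proof -
  note tX = sq_mult_carrier[OF c(1,3)] and tA = sq_mult_carrier[OF c(1,2)]
  have e: "(t * X) $$ (i, l) = (t * A) $$ (i, l) + (if l = q then t $$ (i, p) * x else 0)" if l: "l < n" for l
  proof -
    have "(t * X) $$ (i, l) = (\<Sum>k<n. t $$ (i, k) * A $$ (k, l)
        + t $$ (i, k) * (if k = p then (if l = q then x else 0) else 0))"
      unfolding mat_mult_entry[OF c(1,3) ij(1) l] using l by (intro sum.cong refl) (auto simp: X distrib_left)
    also have "\<dots> = (t * A) $$ (i, l) + t $$ (i, p) * (if l = q then x else 0)"
      unfolding mat_mult_entry[OF c(1,2) ij(1) l] using pq by (simp only: sum.distrib sum_delta_mult) simp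
    finally show ?thesis by (simp del: index_mult_mat)
  qed
  have "(t * X * s) $$ (i, j) = (\<Sum>l<n. (t * A) $$ (i, l) * s $$ (l, j)
      + (if l = q then t $$ (i, p) * x else 0) * s $$ (l, j))"
    unfolding mat_mult_entry[OF tX c(4) ij] by (intro sum.cong refl) (simp add: e distrib_right del: index_mult_mat)
  then show ?thesis
    unfolding mat_mult_entry[OF tA c(4) ij] using pq by (simp only: sum.distrib sum_delta_mult) simp
qed

text \<open>The subcentral terms were found inside the conjugation and the field automorphism, while
  the required order has them outside. Moving them out rescales their parameters; the discrepancy
  left in the corner is pulled inside as the central factor.\<close>

lemma PC_map_decomposition:
  fixes \<phi> :: "'a::field mat \<Rightarrow> 'a mat"
  assumes n: "4 \<le> n" and two: "(2::'a) \<noteq> 0" and \<phi>: "PC_map n \<phi>"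
    and K: "\<phi> ` K1 n \<subseteq> K1 n" "\<phi> ` K2 n \<subseteq> K2 n"
  shows "\<exists>s q th c. std_subcentral n s \<and> quasi_inner n q \<and> field_aut_map n th \<and> central_PC n c \<and>
    (\<forall>a\<in>UT n. \<phi> a = s (q (th (c a))))"
proof -
  note D = PC_mapD[OF \<phi>]
  obtain t \<theta> \<psi> where t: "t \<in> TT n" and \<theta>: "field_automorphism \<theta>" and norm: "normalized n \<psi>"
    and \<phi>\<psi>: "\<And>a. a \<in> UT n \<Longrightarrow> \<phi> a = t * map_mat \<theta> (\<psi> a) * minv t"
    by (rule PC_map_normalization[OF n two \<phi> K]) (rule that)
  obtain W \<alpha> \<beta> where W: "W \<in> UT n" and form:
    "\<And>g i j. g \<in> UT n \<Longrightarrow> i < n \<Longrightarrow> j < n \<Longrightarrow> \<not> (i = 0 \<and> j = n - 1) \<Longrightarrow>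
      (W * \<psi> g * minv W) $$ (i, j) = g $$ (i, j) + (if i = 1 \<and> j = n - 1 then \<alpha> * g $$ (0, 1) else 0)
        + (if i = 0 \<and> j = n - 2 then \<beta> * g $$ (n - 2, n - 1) else 0)"
    by (rule normalized_form[OF n norm]) (rule that)
  note \<theta>s = field_aut_simps[OF \<theta>]
  have N: "n - 1 < n" "n - 2 < n" "0 < n" "1 < n" "n - 2 \<noteq> n - 1" "n - 2 \<noteq> 0" "n - 2 \<noteq> 1" "n - 1 \<noteq> 0" "n - 1 \<noteq> 1" "Suc (n - 2) = n - 1"
    using n by auto
  let ?V = "map_mat \<theta> (minv W)" and ?V' = "map_mat \<theta> W"
  have V: "?V \<in> UT n" "?V' \<in> UT n" using map_mat_UT[OF \<theta>] W UT_minv(1)[OF W] by auto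
  have Wc: "W \<in> carrier_mat n n" "minv W \<in> carrier_mat n n"
    using UT_carrier[OF W] UT_carrier[OF UT_minv(1)[OF W]] by auto
  note Vc = UT_carrier[OF V(1)] UT_carrier[OF V(2)] and tt = TT_facts[OF t]
  have VV: "?V * ?V' = 1\<^sub>m n"
    using map_mat_mult_field_aut[OF \<theta> Wc(2,1)] UT_minv(3)[OF W] map_mat_UT[OF \<theta> UT_one] \<theta>s(1,2)
    by (intro mat_eqI[of _ n]) (auto intro!: sq_mult_carrier Vc simp flip: map_mat_mult_field_aut[OF \<theta> Wc(2,1)])
  \<comment> \<open>Conjugation by \<open>W\<close> sits inside the field automorphism; moved
    outside, it is undone by conjugation with \<open>?V\<close>, which merges with
    \<open>t\<close>.\<close>
  define r where "r = t * ?V"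
  have r: "r \<in> TT n" unfolding r_def by (rule TT_mult[OF t UT_subset_TT[OF V(1)]])
  note rr = TT_facts[OF r]
  have mr: "minv r = ?V' * minv t"
    unfolding r_def
  proof (rule minv_unique[OF sq_mult_carrier[OF tt(1) Vc(1)] sq_mult_carrier[OF Vc(2) tt(4)]])
    have "t * ?V * (?V' * minv t) = t * (?V * ?V') * minv t"
      using tt(1,4) Vc by (simp add: assoc_mult_mat[of _ n n _ n _ n])
    then show "t * ?V * (?V' * minv t) = 1\<^sub>m n" using VV tt by simp
  qed
  let ?O = "\<lambda>a. W * \<psi> a * minv W"
  have \<psi>U: "\<psi> a \<in> UT n" if "a \<in> UT n" for a by (rule norm_UT[OF n norm that])
  have OU: "?O a \<in> UT n" if "a \<in> UT n" for a by (rule conj_UT[OF UT_subset_TT[OF W] \<psi>U[OF that]])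
  have \<phi>O: "\<phi> a = r * map_mat \<theta> (?O a) * minv r" if a: "a \<in> UT n" for a
  proof -
    note Oc = UT_carrier[OF OU[OF a]] and \<psi>c = UT_carrier[OF \<psi>U[OF a]]
    have "\<psi> a = minv W * ?O a * W"
      using conj_conj_minv(2)[OF UT_subset_TT[OF W] \<psi>c] by simp
    then have "map_mat \<theta> (\<psi> a) = ?V * map_mat \<theta> (?O a) * ?V'"
      using map_mat_mult_field_aut[OF \<theta> sq_mult_carrier[OF Wc(2) Oc] Wc(1)]
        map_mat_mult_field_aut[OF \<theta> Wc(2) Oc] by simp
    then have "\<phi> a = t * (?V * map_mat \<theta> (?O a) * ?V') * minv t"
      using \<phi>\<psi>[OF a] by simp
    also have "\<dots> = r * map_mat \<theta> (?O a) * minv r"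
      unfolding mr unfolding r_def
      using tt(1,4) Vc UT_carrier[OF map_mat_UT[OF \<theta> OU[OF a]]]
      by (simp add: assoc_mult_mat[of _ n n _ n _ n] del: map_carrier_mat)
    finally show ?thesis .
  qed
  let ?r' = "minv r"
  note r'T = TT_facts(3)[OF rr(8)]
  \<comment> \<open>The numerator scales a perturbation at (1, n - 1), the denominator scales the
    (0, 1) entry that drives it; \<open>\<beta>'\<close> is formed in the same way.\<close>
  define \<alpha>' where "\<alpha>' = \<theta> \<alpha> * r $$ (1, 1) * ?r' $$ (n - 1, n - 1) / (r $$ (0, 0) * ?r' $$ (1, 1))"
  define \<beta>' where "\<beta>' = \<theta> \<beta> * r $$ (0, 0) * ?r' $$ (n - 2, n - 2) / (r $$ (n - 2, n - 2) * ?r' $$ (n - 1, n - 1))"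
  let ?M = "\<lambda>a. r * map_mat \<theta> a * ?r'"
  define B where "B a = subcentral n \<alpha>' \<beta>' (?M a)" for a
  have MU: "?M a \<in> UT n" if "a \<in> UT n" for a by (rule conj_UT[OF r map_mat_UT[OF \<theta> that]])
  have BPC: "PC_map n B"
    unfolding B_def
    by (rule PC_map_comp[OF subcentral_PC[OF n] PC_map_comp[OF conj_PC[OF r] field_aut_PC[OF \<theta>]]])
  have ri0: "r $$ (i, 0) = (if i = 0 then r $$ (0, 0) else 0)" if "i < n" for i
    using upper_triangularD[OF rr(2), of 0 i] rr(1) that by auto
  have ri1: "r $$ (i, 1) = 0" if "2 \<le> i" "i < n" for i
    using upper_triangularD[OF rr(2), of 1 i] rr(1) that by auto
  have rN: "?r' $$ (n - 1, j) = (if j = n - 1 then ?r' $$ (n - 1, n - 1) else 0)" if "j < n" for j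
    using upper_triangularD[OF rr(7), of j "n - 1"] rr(4) that by auto
  have rM: "?r' $$ (n - 2, j) = 0" if "j < n - 2" for j
    using upper_triangularD[OF rr(7), of j "n - 2"] rr(4) that N by auto
  have Bs: "B a $$ (i, j) = ?M a $$ (i, j)
      + (if i = 1 \<and> j = n - 1 then \<theta> (\<alpha> * a $$ (0, 1)) * r $$ (1, 1) * ?r' $$ (n - 1, n - 1) else 0)
      + (if i = 0 \<and> j = n - 2 then \<theta> (\<beta> * a $$ (n - 2, n - 1)) * r $$ (0, 0) * ?r' $$ (n - 2, n - 2) else 0)"
    if a: "a \<in> UT n" and ij: "i < n" "j < n" for a i j
  proof -
    note mU = map_mat_UT[OF \<theta> a] and ac = UT_carrier[OF a]
    have "?M a $$ (0, 1) = r $$ (0, 0) * \<theta> (a $$ (0, 1)) * ?r' $$ (1, 1)"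
      using conj_superdiag[OF r mU, of 0] ac N by simp
    moreover have "?M a $$ (n - 2, n - 1) = r $$ (n - 2, n - 2) * \<theta> (a $$ (n - 2, n - 1)) * ?r' $$ (n - 1, n - 1)"
      using conj_superdiag[OF r mU, of "n - 2"] ac N by simp
    ultimately show ?thesis
      unfolding B_def subcentral_entry[OF n MU[OF a] ij] \<alpha>'_def \<beta>'_def
      using rr(3)[OF N(3)] rr(3)[OF N(2)] r'T[OF N(4)] r'T[OF N(1)]
      by (simp add: \<theta>s(4) ac_simps del: index_mult_mat One_nat_def)
  qed
  have \<phi>B: "\<phi> a $$ (i, j) = B a $$ (i, j)" if a: "a \<in> UT n" and ij: "i < n" "j < n" "\<not> (i = 0 \<and> j = n - 1)" for a i j
  proof -
    note ac = UT_carrier[OF a] and Oc = UT_carrier[OF OU[OF a]]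
    let ?x = "\<theta> (\<alpha> * a $$ (0, 1))" and ?y = "\<theta> (\<beta> * a $$ (n - 2, n - 1))"
      and ?z = "\<theta> (?O a $$ (0, n - 1)) - \<theta> (a $$ (0, n - 1))"
    \<comment> \<open>The perturbations at (1, n - 1), (0, n - 2) and the corner are inserted one at
      a time.\<close>
    define X1 where "X1 = mat n n (\<lambda>(k, l). \<theta> (a $$ (k, l)) + (if k = 1 \<and> l = n - 1 then ?x else 0))"
    define X2 where "X2 = mat n n (\<lambda>(k, l). X1 $$ (k, l) + (if k = 0 \<and> l = n - 2 then ?y else 0))"
    have Xc: "X1 \<in> carrier_mat n n" "X2 \<in> carrier_mat n n" by (auto simp: X1_def X2_def)
    have mc: "map_mat \<theta> a \<in> carrier_mat n n" "map_mat \<theta> (?O a) \<in> carrier_mat n n"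
      using ac UT_carrier[OF map_mat_UT[OF \<theta> OU[OF a]]] by auto
    have "\<phi> a $$ (i, j) = (r * X2 * ?r') $$ (i, j) + r $$ (i, 0) * ?z * ?r' $$ (n - 1, j)"
      unfolding \<phi>O[OF a]
    proof (rule mult_perturbed_entry[OF rr(1) Xc(2) mc(2) rr(4) N(3,1) _ ij(1,2)])
      fix k l assume kl: "k < n" "l < n"
      show "map_mat \<theta> (?O a) $$ (k, l) = X2 $$ (k, l) + (if k = 0 \<and> l = n - 1 then ?z else 0)"
      proof (cases "k = 0 \<and> l = n - 1")
        case True
        then show ?thesis using kl Oc N by (simp add: X1_def X2_def del: index_mult_mat)
      next
        case False
        have "map_mat \<theta> (?O a) $$ (k, l) = \<theta> (?O a $$ (k, l))" using kl Oc by (simp del: index_mult_mat)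
        then show ?thesis unfolding form[OF a kl False] using kl False by (auto simp: X1_def X2_def \<theta>s)
      qed
    qed
    also have "(r * X2 * ?r') $$ (i, j) = (r * X1 * ?r') $$ (i, j) + r $$ (i, 0) * ?y * ?r' $$ (n - 2, j)"
      by (rule mult_perturbed_entry[OF rr(1) Xc(1,2) rr(4) N(3,2) _ ij(1,2)]) (simp add: X2_def)
    also have "(r * X1 * ?r') $$ (i, j) = ?M a $$ (i, j) + r $$ (i, 1) * ?x * ?r' $$ (n - 1, j)"
      by (rule mult_perturbed_entry[OF rr(1) mc(1) Xc(1) rr(4) N(4,1) _ ij(1,2)]) (use ac in \<open>simp add: X1_def\<close>)
    finally have e: "\<phi> a $$ (i, j) = ?M a $$ (i, j) + r $$ (i, 1) * ?x * ?r' $$ (n - 1, j)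
      + r $$ (i, 0) * ?y * ?r' $$ (n - 2, j) + r $$ (i, 0) * ?z * ?r' $$ (n - 1, j)" .
    \<comment> \<open>Conjugation by a triangular matrix keeps a corner change in the corner, so the
      unknown \<open>?z\<close> is not seen here.\<close>
    have "r $$ (i, 0) * ?z * ?r' $$ (n - 1, j) = 0" using ij(3) ri0[OF ij(1)] rN[OF ij(2)] by auto
    moreover have "r $$ (i, 0) * ?y * ?r' $$ (n - 2, j)
        = (if i = 0 \<and> j = n - 2 then ?y * r $$ (0, 0) * ?r' $$ (n - 2, n - 2) else 0)"
    proof -
      consider "i \<noteq> 0" | "i = 0" "j < n - 2" | "i = 0" "j = n - 2" using ij by linarith
      then show ?thesis using ri0[OF ij(1)] rM[of j] by cases auto
    qed
    moreover have "r $$ (i, 1) * ?x * ?r' $$ (n - 1, j)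
        = (if i = 1 \<and> j = n - 1 then ?x * r $$ (1, 1) * ?r' $$ (n - 1, n - 1) else 0)"
    proof -
      consider "j \<noteq> n - 1" | "2 \<le> i" | "i = 1" "j = n - 1" using ij by linarith
      then show ?thesis using rN[OF ij(2)] ri1[of i] ij(1) by cases auto
    qed
    ultimately show ?thesis unfolding e Bs[OF a ij(1,2)] by simp
  qed
  \<comment> \<open>The factor by which conjugation by \<open>r\<close> scales the corner;
    \<open>f\<close> undoes it together with \<open>\<theta>\<close>.\<close>
  let ?k = "r $$ (0, 0) * ?r' $$ (n - 1, n - 1)"
  have k0: "?k \<noteq> 0" using rr(3)[OF N(3)] r'T[OF N(1)] by simp
  define f where "f a = inv_into UNIV \<theta> ((\<phi> a $$ (0, n - 1) - B a $$ (0, n - 1)) / ?k)" for a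
  define c where "c a = a * tv n 0 (n - 1) (f a)" for a
  have cU: "c a \<in> UT n" if "a \<in> UT n" for a
    unfolding c_def using that n by (intro UT_mult tv_UT) auto
  have ce: "c a $$ (i, j) = a $$ (i, j) + (if i = 0 \<and> j = n - 1 then f a else 0)"
    if a: "a \<in> UT n" and ij: "i < n" "j < n" for a i j
    unfolding c_def tv_mult_right[OF UT_carrier[OF a] ij N(3)]
    using UT_lower[OF a, of 0 i] UT_diag[OF a N(3)] ij by auto
  have Bc: "B (c a) = \<phi> a" if a: "a \<in> UT n" for a
  proof (rule mat_eqI[OF UT_carrier[OF PC_mapD(1)[OF BPC cU[OF a]]] UT_carrier[OF D(1)[OF a]]])
    fix i j assume ij: "i < n" "j < n"
    note ac = UT_carrier[OF a] and cc = UT_carrier[OF cU[OF a]]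
    have M: "?M (c a) $$ (i, j) = ?M a $$ (i, j) + r $$ (i, 0) * \<theta> (f a) * ?r' $$ (n - 1, j)"
    proof (rule mult_perturbed_entry[OF rr(1) _ _ rr(4) N(3,1) _ ij])
      show "map_mat \<theta> a \<in> carrier_mat n n" "map_mat \<theta> (c a) \<in> carrier_mat n n" using ac cc by auto
      show "map_mat \<theta> (c a) $$ (k, l) = map_mat \<theta> a $$ (k, l) + (if k = 0 \<and> l = n - 1 then \<theta> (f a) else 0)"
        if "k < n" "l < n" for k l
        using that ac cc ce[OF a that] \<theta>s by auto
    qed
    have c01: "c a $$ (0, 1) = a $$ (0, 1)" "c a $$ (n - 2, n - 1) = a $$ (n - 2, n - 1)"
      using ce[OF a N(3,4)] ce[OF a N(2,1)] N by auto
    have "B (c a) $$ (i, j) = B a $$ (i, j) + r $$ (i, 0) * \<theta> (f a) * ?r' $$ (n - 1, j)"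
      unfolding Bs[OF cU[OF a] ij] Bs[OF a ij] M c01 by (simp del: index_mult_mat)
    also have "r $$ (i, 0) * \<theta> (f a) * ?r' $$ (n - 1, j) = (if i = 0 \<and> j = n - 1 then ?k * \<theta> (f a) else 0)"
      unfolding ri0[OF ij(1)] rN[OF ij(2)] by simp
    also have "?k * \<theta> (f a) = \<phi> a $$ (0, n - 1) - B a $$ (0, n - 1)"
      unfolding f_def \<theta>s(11) using k0 by simp
    finally show "B (c a) $$ (i, j) = \<phi> a $$ (i, j)"
      using \<phi>B[OF a ij] by (cases "i = 0 \<and> j = n - 1") auto
  qed
  have "PC_map n c" by (rule PC_map_factor[OF BPC \<phi> cU Bc])
  then have "central_PC n c" unfolding central_PC_def c_def by blast
  moreover have "std_subcentral n (subcentral n \<alpha>' \<beta>')"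
    unfolding std_subcentral_def subcentral_def by blast
  moreover have "quasi_inner n (\<lambda>a. r * a * ?r')" unfolding quasi_inner_def using r by blast
  moreover have "field_aut_map n (map_mat \<theta>)" unfolding field_aut_map_def using \<theta> by blast
  moreover have "\<forall>a\<in>UT n. \<phi> a = subcentral n \<alpha>' \<beta>' (r * map_mat \<theta> (c a) * ?r')"
    using Bc unfolding B_def by simp
  ultimately show ?thesis by blast
qed

theorem mainTheorem13:
  fixes n :: nat and \<phi> :: "'a::field mat \<Rightarrow> 'a mat"
  assumes "4 \<le> n" and "(2::'a) \<noteq> 0" and "PC_map n \<phi>"
  shows "\<exists>g s q th c. graph_aut n g \<and> std_subcentral n s \<and> quasi_inner n q \<and>
           field_aut_map n th \<and> central_PC n c \<and>
           (\<forall>a\<in>UT n. \<phi> a = g (s (q (th (c a)))))"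
proof -
  consider "\<phi> ` K1 n \<subseteq> K1 n" "\<phi> ` K2 n \<subseteq> K2 n" | "\<phi> ` K1 n \<subseteq> K2 n" "\<phi> ` K2 n \<subseteq> K1 n"
    using PC_map_K1_K2_cases[OF assms] by blast
  then show ?thesis
  proof cases
    case 1
    have "graph_aut n (\<lambda>a :: 'a mat. a)" by (simp add: graph_aut_def)
    then show ?thesis using PC_map_decomposition[OF assms 1] by blast
  next
    case 2
    \<comment> \<open>The graph automorphism restores the kinds; being an involution, it recovers
      \<open>\<phi>\<close> when applied once more.\<close>
    let ?g = "\<lambda>a :: 'a mat. flip n (minv a)"
    have "PC_map n (\<lambda>a. ?g (\<phi> a))" by (rule PC_map_comp[OF graph_PC assms(3)])
    moreover have "(\<lambda>a. ?g (\<phi> a)) ` K1 n \<subseteq> K1 n" "(\<lambda>a. ?g (\<phi> a)) ` K2 n \<subseteq> K2 n"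
      using 2 graph_K[OF assms(1,2)] by blast+
    ultimately obtain s q th c where d: "std_subcentral n s" "quasi_inner n q" "field_aut_map n th" "central_PC n c"
      "\<forall>a\<in>UT n. ?g (\<phi> a) = s (q (th (c a)))"
      using PC_map_decomposition[OF assms(1,2), of "\<lambda>a. ?g (\<phi> a)"] by blast
    have "\<phi> a = ?g (s (q (th (c a))))" if "a \<in> UT n" for a
      using graph_involution[OF PC_mapD(1)[OF assms(3) that]] d(5) that by simp
    then show ?thesis using d(1-4) graph_aut_flip by blast
  qed
qed

end
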